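(* Let $G$ be an almost abelian Lie group of dimension $n$ with a left-invariant Riemannian metric $g$, let $\mathfrak{s}$ be its Lie algebra with the inner product $\langle\cdot,\cdot\rangle$ induced by $g$, let $\mathfrak{a}\subset\mathfrak{s}$ be an abelian ideal of codimension $1$, let $e\in\mathfrak{s}$ be a unit vector orthogonal to $\mathfrak{a}$, and let $Q=\operatorname{ad}(e)|_{\mathfrak{a}}:\mathfrak{a}\to\mathfrak{a}$. Let $S=\frac12(Q+Q^t)$ be the symmetric part of $Q$. Then $(G,g)$ is weakly Einstein if and only if $Q$ is normal (i.e. $QQ^t=Q^tQ$) and $S^2$ is a multiple of the identity operator on $\mathfrak{a}$. Moreover, if $S$ itself is not a multiple of the identity, then $(G,g)$ is not Einstein.
   Context: An $n$-dimensional Riemannian manifold $(M,g)$ is called weakly Einstein if $\check{R}_{ij}:=R_{iabc}R_{j}{}^{abc}=\frac{\|R\|^2}{n}g_{ij}$, where $R$ is the Riemann curvature tensor (indices raised with $g$, repeated indices summed) and $\|R\|^2=R_{iabc}R^{iabc}$. The function $\|R\|^2$ is not required to be constant in the definition, and Einstein manifolds are not excluded. The curvature tensor is $R(X,Y,U,V)=\langle(\nabla_X\nabla_Y-\nabla_Y\nabla_X-\nabla_{[X,Y]})U,V\rangle$, with $\nabla$ the Levi-Civita connection. A Lie group is almost abelian if it contains an abelian normal subgroup of codimension $1$; a Lie algebra is almost abelian if it contains an abelian ideal of codimension $1$. The condition is used at the level of the Lie algebra: the Lie algebra $\mathfrak{s}$ of $G$ is almost abelian. The transpose $Q^t$ is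 taken with respect to the inner product $\langle\cdot,\cdot\rangle$ restricted to $\mathfrak{a}$. A Riemannian manifold is Einstein if its Ricci tensor is a constant multiple of the metric. *)

theory Defs
  imports "HOL-Analysis.Analysis" "HOL-Library.Function_Algebras"
begin

section \<open>Pointwise real vector space structure on functions\<close>

instantiation "fun" :: (type, real_vector) real_vector
begin

definition scaleR_fun :: "real \<Rightarrow> ('a \<Rightarrow> 'b) \<Rightarrow> 'a \<Rightarrow> 'b"
  where "scaleR_fun c f = (\<lambda>x. c *\<^sub>R f x)"

instance
  by standard (simp_all add: scaleR_fun_def fun_eq_iff scaleR_add_right scaleR_add_left)

end

section \<open>Smooth maps between Euclidean spaces\<close>

text \<open>Both notions are only meant for open sets \<open>S\<close>.\<close>

primrec Ck_on :: "nat \<Rightarrow> ('a::euclidean_space \<Rightarrow> 'b::real_normed_vector) \<Rightarrow> 'a set \<Rightarrow> bool" where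
  "Ck_on 0 f S \<longleftrightarrow> continuous_on S f"
| "Ck_on (Suc k) f S \<longleftrightarrow>
     f differentiable_on S \<and> (\<forall>v. Ck_on k (\<lambda>x. frechet_derivative f (at x) v) S)"

definition smooth_on :: "('a::euclidean_space \<Rightarrow> 'b::real_normed_vector) \<Rightarrow> 'a set \<Rightarrow> bool"
  where "smooth_on f S \<longleftrightarrow> (\<forall>k. Ck_on k f S)"

section \<open>Smooth manifolds\<close>

text \<open>A manifold is a Hausdorff, second countable type \<open>'g\<close> with a smooth atlas modelled on a
  Euclidean space \<open>'e\<close>; its dimension is \<open>DIM('e)\<close>. A chart is a pair of a domain and a coordinate
  map, the values of the latter outside of the domain being irrelevant.\<close>

type_synonym ('g, 'e) atlas = "('g set \<times> ('g \<Rightarrow> 'e)) set"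

definition smooth_atlas ::
    "('g::{t2_space,second_countable_topology}, 'e::euclidean_space) atlas \<Rightarrow> bool" where
  "smooth_atlas A \<longleftrightarrow>
     (\<forall>(U, \<phi>)\<in>A. open U \<and> open (\<phi> ` U) \<and> homeomorphism U (\<phi> ` U) \<phi> (inv_into U \<phi>)) \<and>
     (\<Union>(U, \<phi>)\<in>A. U) = UNIV \<and>
     (\<forall>(U, \<phi>)\<in>A. \<forall>(V, \<psi>)\<in>A. smooth_on (\<psi> \<circ> inv_into U \<phi>) (\<phi> ` (U \<inter> V)))"

definition smooth_fun ::
    "('g::topological_space, 'e::euclidean_space) atlas \<Rightarrow> 'g set \<Rightarrow> ('g \<Rightarrow> real) \<Rightarrow> bool" where
  "smooth_fun A W f \<longleftrightarrow> (\<forall>(U, \<phi>)\<in>A. smooth_on (f \<circ> inv_into U \<phi>) (\<phi> ` (U \<inter> W)))"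

definition smooth_near ::
    "('g::topological_space, 'e::euclidean_space) atlas \<Rightarrow> 'g \<Rightarrow> ('g \<Rightarrow> real) \<Rightarrow> bool" where
  "smooth_near A p f \<longleftrightarrow> (\<exists>W. open W \<and> p \<in> W \<and> smooth_fun A W f)"

text \<open>Tangent vectors at \<open>p\<close> are directional derivatives at \<open>p\<close>, acting on the functions that are
  smooth in a neighbourhood of \<open>p\<close>. To make them extensional, they are set to \<open>0\<close> on all other
  functions.\<close>

type_synonym 'g tangent = "('g \<Rightarrow> real) \<Rightarrow> real"

definition dir_deriv ::
    "('g::topological_space, 'e::euclidean_space) atlas \<Rightarrow> 'g set \<times> ('g \<Rightarrow> 'e) \<Rightarrow> 'g \<Rightarrow> 'e \<Rightarrow> 'g tangent" where
  "dir_deriv A = (\<lambda>(U, \<phi>) p v f.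
     if smooth_near A p f then frechet_derivative (f \<circ> inv_into U \<phi>) (at (\<phi> p)) v else 0)"

definition tangent_space ::
    "('g::topological_space, 'e::euclidean_space) atlas \<Rightarrow> 'g \<Rightarrow> 'g tangent set" where
  "tangent_space A p = {dir_deriv A (U, \<phi>) p v | U \<phi> v. (U, \<phi>) \<in> A \<and> p \<in> U}"

type_synonym 'g vfield = "'g \<Rightarrow> 'g tangent"

definition vector_fields ::
    "('g::topological_space, 'e::euclidean_space) atlas \<Rightarrow> 'g vfield set" where
  "vector_fields A = {X. (\<forall>p. X p \<in> tangent_space A p) \<and>
     (\<forall>W f. open W \<longrightarrow> smooth_fun A W f \<longrightarrow> smooth_fun A W (\<lambda>p. X p f))}"

definition bracket ::
    "('g::topological_space, 'e::euclidean_space) atlas \<Rightarrow> 'g vfield \<Rightarrow> 'g vfield \<Rightarrow> 'g vfield" where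
  "bracket A X Y = (\<lambda>p f.
     if smooth_near A p f then X p (\<lambda>q. Y q f) - Y p (\<lambda>q. X q f) else 0)"

section \<open>Riemannian metrics and curvature\<close>

text \<open>A metric \<open>g\<close> gives for each point \<open>p\<close> an inner product on the tangent space at \<open>p\<close>; the
  values of \<open>g p\<close> outside of this space are irrelevant.\<close>

type_synonym 'g metric = "'g \<Rightarrow> 'g tangent \<Rightarrow> 'g tangent \<Rightarrow> real"

definition riemannian_metric ::
    "('g::topological_space, 'e::euclidean_space) atlas \<Rightarrow> 'g metric \<Rightarrow> bool" where
  "riemannian_metric A g \<longleftrightarrow>
     (\<forall>p. \<forall>u\<in>tangent_space A p. \<forall>v\<in>tangent_space A p. \<forall>w\<in>tangent_space A p. \<forall>c.
        g p (u + v) w = g p u w + g p v w \<and>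
        g p (c *\<^sub>R u) w = c * g p u w \<and>
        g p u v = g p v u \<and>
        (u \<noteq> 0 \<longrightarrow> 0 < g p u u)) \<and>
     (\<forall>X\<in>vector_fields A. \<forall>Y\<in>vector_fields A. smooth_fun A UNIV (\<lambda>p. g p (X p) (Y p)))"

definition is_levi_civita ::
    "('g::topological_space, 'e::euclidean_space) atlas \<Rightarrow> 'g metric \<Rightarrow>
      ('g vfield \<Rightarrow> 'g vfield \<Rightarrow> 'g vfield) \<Rightarrow> bool" where
  "is_levi_civita A g D \<longleftrightarrow>
     (\<forall>X\<in>vector_fields A. \<forall>Y\<in>vector_fields A. D X Y \<in> vector_fields A) \<and>
     (\<forall>X\<in>vector_fields A. \<forall>Y\<in>vector_fields A. \<forall>Z\<in>vector_fields A. \<forall>h. smooth_fun A UNIV h \<longrightarrow>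
        D (X + Y) Z = D X Z + D Y Z \<and>
        D (\<lambda>p. h p *\<^sub>R X p) Z = (\<lambda>p. h p *\<^sub>R D X Z p) \<and>
        D X (Y + Z) = D X Y + D X Z \<and>
        D X (\<lambda>p. h p *\<^sub>R Y p) = (\<lambda>p. X p h *\<^sub>R Y p + h p *\<^sub>R D X Y p) \<and>
        D X Y - D Y X = bracket A X Y \<and>
        (\<forall>p. X p (\<lambda>q. g q (Y q) (Z q)) = g p (D X Y p) (Z p) + g p (Y p) (D X Z p)))"

text \<open>By the fundamental theorem of Riemannian geometry such a connection exists, and its values
  on vector fields are unique.\<close>

definition levi_civita ::
    "('g::topological_space, 'e::euclidean_space) atlas \<Rightarrow> 'g metric \<Rightarrow>
      'g vfield \<Rightarrow> 'g vfield \<Rightarrow> 'g vfield" where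
  "levi_civita A g = (SOME D. is_levi_civita A g D)"

definition curvature ::
    "('g::topological_space, 'e::euclidean_space) atlas \<Rightarrow> 'g metric \<Rightarrow>
      'g vfield \<Rightarrow> 'g vfield \<Rightarrow> 'g vfield \<Rightarrow> 'g vfield \<Rightarrow> 'g \<Rightarrow> real" where
  "curvature A g X Y U V p =
     (let D = levi_civita A g
      in g p ((D X (D Y U) - D Y (D X U) - D (bracket A X Y) U) p) (V p))"

text \<open>Contractions are computed in vector fields that form an orthonormal basis at the point under
  consideration, so that no indices have to be raised. As the curvature is tensorial, the results
  depend neither on this basis nor on its extension to vector fields.\<close>

definition orthonormal_at ::
    "('g::topological_space, 'e::euclidean_space) atlas \<Rightarrow> 'g metric \<Rightarrow> 'g \<Rightarrow> (nat \<Rightarrow> 'g vfield) \<Rightarrow> bool" where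
  "orthonormal_at A g p E \<longleftrightarrow>
     (\<forall>i<DIM('e). E i \<in> vector_fields A) \<and>
     (\<forall>i<DIM('e). \<forall>j<DIM('e). g p (E i p) (E j p) = (if i = j then 1 else 0))"

definition R_check ::
    "('g::topological_space, 'e::euclidean_space) atlas \<Rightarrow> 'g metric \<Rightarrow> (nat \<Rightarrow> 'g vfield) \<Rightarrow>
      'g vfield \<Rightarrow> 'g vfield \<Rightarrow> 'g \<Rightarrow> real" where
  "R_check A g E X Y p = (\<Sum>a<DIM('e). \<Sum>b<DIM('e). \<Sum>c<DIM('e).
     curvature A g X (E a) (E b) (E c) p * curvature A g Y (E a) (E b) (E c) p)"

definition R_norm_sq ::
    "('g::topological_space, 'e::euclidean_space) atlas \<Rightarrow> 'g metric \<Rightarrow> (nat \<Rightarrow> 'g vfield) \<Rightarrow>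
      'g \<Rightarrow> real" where
  "R_norm_sq A g E p = (\<Sum>i<DIM('e). \<Sum>a<DIM('e). \<Sum>b<DIM('e). \<Sum>c<DIM('e).
     (curvature A g (E i) (E a) (E b) (E c) p)\<^sup>2)"

definition ricci ::
    "('g::topological_space, 'e::euclidean_space) atlas \<Rightarrow> 'g metric \<Rightarrow> (nat \<Rightarrow> 'g vfield) \<Rightarrow>
      'g vfield \<Rightarrow> 'g vfield \<Rightarrow> 'g \<Rightarrow> real" where
  "ricci A g E X Y p = (\<Sum>a<DIM('e). curvature A g (E a) X Y (E a) p)"

definition weakly_einstein ::
    "('g::topological_space, 'e::euclidean_space) atlas \<Rightarrow> 'g metric \<Rightarrow> bool" where
  "weakly_einstein A g \<longleftrightarrow>
     (\<forall>p E. orthonormal_at A g p E \<longrightarrow>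
        (\<forall>X\<in>vector_fields A. \<forall>Y\<in>vector_fields A.
           R_check A g E X Y p = R_norm_sq A g E p / real DIM('e) * g p (X p) (Y p)))"

definition einstein ::
    "('g::topological_space, 'e::euclidean_space) atlas \<Rightarrow> 'g metric \<Rightarrow> bool" where
  "einstein A g \<longleftrightarrow>
     (\<exists>c. \<forall>p E. orthonormal_at A g p E \<longrightarrow>
        (\<forall>X\<in>vector_fields A. \<forall>Y\<in>vector_fields A. ricci A g E X Y p = c * g p (X p) (Y p)))"

section \<open>Lie groups\<close>

locale lie_group = group gmul gid ginv
  for gmul :: "'g::{t2_space,second_countable_topology} \<Rightarrow> 'g \<Rightarrow> 'g" and gid ginv +
  fixes A :: "('g, 'e::euclidean_space) atlas"
  assumes atlas: "smooth_atlas A"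
    and continuous_mult: "continuous_on UNIV (\<lambda>(x, y). gmul x y)"
    and continuous_inverse: "continuous_on UNIV ginv"
    and smooth_mult: "\<lbrakk>(U, \<phi>) \<in> A; (V, \<psi>) \<in> A; (W, \<theta>) \<in> A\<rbrakk> \<Longrightarrow>
      smooth_on (\<lambda>(a, b). \<theta> (gmul (inv_into U \<phi> a) (inv_into V \<psi> b)))
        {(\<phi> x, \<psi> y) | x y. x \<in> U \<and> y \<in> V \<and> gmul x y \<in> W}"
    and smooth_inverse: "\<lbrakk>(U, \<phi>) \<in> A; (V, \<psi>) \<in> A\<rbrakk> \<Longrightarrow>
      smooth_on (\<psi> \<circ> ginv \<circ> inv_into U \<phi>) (\<phi> ` {x \<in> U. ginv x \<in> V})"

definition push_left :: "('g \<Rightarrow> 'g \<Rightarrow> 'g) \<Rightarrow> 'g \<Rightarrow> 'g tangent \<Rightarrow> 'g tangent" where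
  \<comment> \<open>the differential of the left translation by \<open>a\<close>\<close>
  "push_left gmul a u = (\<lambda>f. u (\<lambda>q. f (gmul a q)))"

definition left_invariant_metric ::
    "('g \<Rightarrow> 'g \<Rightarrow> 'g) \<Rightarrow> ('g::topological_space, 'e::euclidean_space) atlas \<Rightarrow> 'g metric \<Rightarrow> bool" where
  "left_invariant_metric gmul A g \<longleftrightarrow>
     (\<forall>a p. \<forall>u\<in>tangent_space A p. \<forall>v\<in>tangent_space A p.
        g (gmul a p) (push_left gmul a u) (push_left gmul a v) = g p u v)"

definition lie_algebra ::
    "('g \<Rightarrow> 'g \<Rightarrow> 'g) \<Rightarrow> ('g::topological_space, 'e::euclidean_space) atlas \<Rightarrow> 'g vfield set" where
  "lie_algebra gmul A =
     {X \<in> vector_fields A. \<forall>a p. X (gmul a p) = push_left gmul a (X p)}"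

definition lie_inner :: "'g \<Rightarrow> 'g metric \<Rightarrow> 'g vfield \<Rightarrow> 'g vfield \<Rightarrow> real" where
  "lie_inner gid g X Y = g gid (X gid) (Y gid)"

definition abelian_ideal_codim_one ::
    "('g \<Rightarrow> 'g \<Rightarrow> 'g) \<Rightarrow> ('g::topological_space, 'e::euclidean_space) atlas \<Rightarrow> 'g vfield set \<Rightarrow> bool" where
  "abelian_ideal_codim_one gmul A \<aa> \<longleftrightarrow>
     \<aa> \<subseteq> lie_algebra gmul A \<and> subspace \<aa> \<and>
     (\<forall>X\<in>lie_algebra gmul A. \<forall>Y\<in>\<aa>. bracket A X Y \<in> \<aa>) \<and>
     (\<forall>X\<in>\<aa>. \<forall>Y\<in>\<aa>. bracket A X Y = 0) \<and>
     dim (lie_algebra gmul A) = dim \<aa> + 1"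

definition transpose_on ::
    "'v set \<Rightarrow> ('v \<Rightarrow> 'v \<Rightarrow> real) \<Rightarrow> ('v \<Rightarrow> 'v) \<Rightarrow> 'v \<Rightarrow> 'v" where
  "transpose_on V ip f y = (THE z. z \<in> V \<and> (\<forall>x\<in>V. ip (f x) y = ip x z))"

end

theory Submission
  imports Defs
begin

text \<open>Let \<open>S\<close> and \<open>B\<close> be the symmetric and the skew part of \<open>Q\<close>. For \<open>X, Y\<close> in the ideal the Levi-Civita
  connection is \<open>\<nabla>\<^sub>e e = 0\<close>, \<open>\<nabla>\<^sub>e X = B X\<close>, \<open>\<nabla>\<^sub>X e = - S X\<close>, \<open>\<nabla>\<^sub>X Y = \<langle>S X, Y\<rangle> e\<close>. With
  \<open>T = S\<^sup>2 + [S, B]\<close> the curvature is \<open>R(e, X, Y, e) = - \<langle>T X, Y\<rangle>\<close> and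
  \<open>R(X, Y, Z, W) = \<langle>S X, Z\<rangle> \<langle>S Y, W\<rangle> - \<langle>S Y, Z\<rangle> \<langle>S X, W\<rangle>\<close>, so the weakly Einstein condition reads
  \<open>T\<^sup>2 + tr(S\<^sup>2) S\<^sup>2 - S\<^sup>4 = tr(T\<^sup>2) I\<close>. As \<open>tr(S\<^sup>2 [S, B]) = 0\<close>, its trace on the \<open>m\<close>-dimensional
  ideal is \<open>(m - 1) \<parallel>[S, B]\<parallel>\<^sup>2 + (m tr(S\<^sup>4) - (tr(S\<^sup>2))\<^sup>2) = 0\<close>, a sum of two nonnegative terms
  which vanish only if \<open>Q\<close> is normal and \<open>S\<^sup>2\<close> is a multiple of \<open>I\<close>
  (for \<open>m = 1\<close> the commutator is \<open>0\<close> anyway). In the same way the traced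
  Einstein equation is \<open>(tr S)\<^sup>2 = m tr(S\<^sup>2)\<close>, the equality case of Cauchy-Schwarz.

  The left-invariant fields provide a global frame, in which tensoriality and the existence of the
  Levi-Civita connection are checked directly, so that no bump functions are needed.\<close>


section \<open>Calculus of smooth maps\<close>

text \<open>The definitions contract the curvature in arbitrary vector fields that are orthonormal
  at one point only, and \<open>levi_civita\<close> is a mere choice. Before any matrix can appear,
  the connection has to be pinned down by uniqueness, and every slot of the curvature has to be
  shown tensorial. The right-hand side \<open>tr(T^2) I\<close> of the weakly Einstein equation
  originates in the component \<open>(e, e)\<close> of the contracted curvature: it equals
  \<open>2 tr(T^2)\<close> and so fixes the proportionality factor, while the components mixing
  \<open>e\<close> with the ideal vanish identically. Normality enters through
  \<open>Q Q^t - Q^t Q = -2 [S, B]\<close>. The trace is informative because \<open>[S, B]\<close>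
  is symmetric, so that \<open>tr(T^2)\<close> splits into \<open>tr(S^4)\<close> and the squared
  norm of \<open>[S, B]\<close>, and because \<open>m tr(S^4) - (tr(S^2))^2\<close> is
  \<open>m\<close> times the squared distance of \<open>S^2\<close> from the scalar
  matrices.\<close>

lemma Ck_on_cong:
  assumes "open S" "\<And>x. x \<in> S \<Longrightarrow> f x = h x"
  shows "Ck_on k f S \<longleftrightarrow> Ck_on k h S"
  using assms
proof (induction k arbitrary: f h)
  case 0
  then show ?case by (auto cong: continuous_on_cong)
next
  case (Suc k)
  have der: "frechet_derivative f (at x) = frechet_derivative h (at x)" if "x \<in> S" for x
  proof -
    have "(f has_derivative D) (at x) \<longleftrightarrow> (h has_derivative D) (at x)" for D
      using Suc.prems that by (metis has_derivative_transform_within_open)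
    then show ?thesis unfolding frechet_derivative_def by simp
  qed
  have "f differentiable_on S \<longleftrightarrow> h differentiable_on S"
    using Suc.prems(2) by (auto simp: differentiable_on_def intro: differentiable_transform_within[OF _ zero_less_one])
  moreover have "Ck_on k (\<lambda>x. frechet_derivative f (at x) v) S \<longleftrightarrow> Ck_on k (\<lambda>x. frechet_derivative h (at x) v) S" for v
    by (rule Suc.IH) (use Suc.prems der in auto)
  ultimately show ?case by simp
qed

lemma Ck_on_subset: "Ck_on k f S \<Longrightarrow> T \<subseteq> S \<Longrightarrow> Ck_on k f T"
  by (induction k arbitrary: f) (auto intro: continuous_on_subset differentiable_on_subset)

lemma Ck_on_SucD: "Ck_on (Suc k) f S \<Longrightarrow> Ck_on k f S"
proof (induction k arbitrary: f)
  case 0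
  then show ?case by (simp add: differentiable_imp_continuous_on)
next
  case (Suc k)
  then show ?case by (metis Ck_on.simps(2))
qed

text \<open>Lets the closure properties below exhibit a derivative \<open>D\<close> in closed form
  instead of computing \<open>frechet_derivative\<close> of a compound map.\<close>

lemma Ck_on_SucI:
  assumes "open S" "\<And>x. x \<in> S \<Longrightarrow> (f has_derivative D x) (at x)" "\<And>v. Ck_on k (\<lambda>x. D x v) S"
  shows "Ck_on (Suc k) f S"
proof -
  have "frechet_derivative f (at x) = D x" if "x \<in> S" for x
    using assms(2)[OF that] by (metis frechet_derivative_at)
  then have "Ck_on k (\<lambda>x. frechet_derivative f (at x) v) S" for v
    using assms(1,3) Ck_on_cong[of S "\<lambda>x. frechet_derivative f (at x) v" "\<lambda>x. D x v" k] by simp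
  moreover have "f differentiable_on S"
    using assms(2) by (meson differentiable_at_imp_differentiable_on differentiable_def)
  ultimately show ?thesis by simp
qed

lemma Ck_on_Suc_has_derivative:
  "Ck_on (Suc k) f S \<Longrightarrow> open S \<Longrightarrow> x \<in> S \<Longrightarrow> (f has_derivative frechet_derivative f (at x)) (at x)"
  by (auto simp: differentiable_on_eq_differentiable_at frechet_derivative_works)

lemma Ck_on_local:
  assumes "\<And>x. x \<in> S \<Longrightarrow> \<exists>T. open T \<and> x \<in> T \<and> Ck_on k f T"
  shows "Ck_on k f S"
  using assms
proof (induction k arbitrary: f)
  case 0
  then show ?case
    by (metis Ck_on.simps(1) continuous_at_imp_continuous_on continuous_on_eq_continuous_at)
next
  case (Suc k)
  have "f differentiable_on S"
    using Suc.prems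
    by (metis Ck_on.simps(2) differentiable_at_imp_differentiable_on differentiable_on_eq_differentiable_at)
  moreover have "Ck_on k (\<lambda>x. frechet_derivative f (at x) v) S" for v
  proof (rule Suc.IH)
    fix x assume "x \<in> S"
    then obtain T where "open T" "x \<in> T" "Ck_on (Suc k) f T" using Suc.prems by blast
    then show "\<exists>T. open T \<and> x \<in> T \<and> Ck_on k (\<lambda>x. frechet_derivative f (at x) v) T" by auto
  qed
  ultimately show ?case by simp
qed

lemma Ck_on_const: "open S \<Longrightarrow> Ck_on k (\<lambda>x. c) S"
proof (induction k arbitrary: c)
  case (Suc k)
  show ?case by (rule Ck_on_SucI[where D = "\<lambda>_ _. 0"]) (use Suc in auto)
qed simp

lemma Ck_on_bounded_linear:
  assumes "bounded_linear L" "open S"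
  shows "Ck_on k L S"
proof (cases k)
  case 0
  then show ?thesis using assms by (simp add: bounded_linear.linear linear_continuous_on)
next
  case (Suc j)
  show ?thesis unfolding Suc
    by (rule Ck_on_SucI[where D = "\<lambda>_. L"])
      (use assms in \<open>auto intro: bounded_linear_imp_has_derivative Ck_on_const\<close>)
qed

lemma Ck_on_linear_compose:
  assumes "bounded_linear L" "open S" "Ck_on k f S"
  shows "Ck_on k (\<lambda>x. L (f x)) S"
  using assms(3)
proof (induction k arbitrary: f)
  case 0
  then show ?case
    using assms(1) by (simp add: bounded_linear.continuous_on)
next
  case (Suc k)
  show ?case
    by (rule Ck_on_SucI[where D = "\<lambda>x v. L (frechet_derivative f (at x) v)"])
      (use Suc Ck_on_Suc_has_derivative[OF Suc.prems] assms(1,2) in \<open>auto intro: bounded_linear.has_derivative\<close>)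
qed

lemma Ck_on_add:
  assumes "open S" "Ck_on k f S" "Ck_on k h S"
  shows "Ck_on k (\<lambda>x. f x + h x) S"
  using assms(2,3)
proof (induction k arbitrary: f h)
  case 0
  then show ?case by (auto intro: continuous_on_add)
next
  case (Suc k)
  show ?case
    by (rule Ck_on_SucI[where D = "\<lambda>x v. frechet_derivative f (at x) v + frechet_derivative h (at x) v"])
      (use Suc Ck_on_Suc_has_derivative[OF Suc.prems(1)] Ck_on_Suc_has_derivative[OF Suc.prems(2)] assms(1)
        in \<open>auto intro: has_derivative_add\<close>)
qed

lemma Ck_on_sum:
  assumes "open S" "\<And>i. i \<in> I \<Longrightarrow> Ck_on k (f i) S"
  shows "Ck_on k (\<lambda>x. \<Sum>i\<in>I. f i x) S"
  using assms(2)
  by (induction I rule: infinite_finite_induct) (auto intro: Ck_on_const Ck_on_add assms(1))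

lemma Ck_on_scaleR:
  assumes "open S" "Ck_on k r S" "Ck_on k f S"
  shows "Ck_on k (\<lambda>x. r x *\<^sub>R f x) S"
  using assms(2,3)
proof (induction k arbitrary: f r)
  case 0
  then show ?case by (auto intro: continuous_on_scaleR)
next
  case (Suc k)
  show ?case
  proof (rule Ck_on_SucI[OF assms(1)])
    show "((\<lambda>x. r x *\<^sub>R f x) has_derivative
        (\<lambda>v. r x *\<^sub>R frechet_derivative f (at x) v + frechet_derivative r (at x) v *\<^sub>R f x)) (at x)"
      if "x \<in> S" for x
      using Ck_on_Suc_has_derivative[OF Suc.prems(1) assms(1) that]
        Ck_on_Suc_has_derivative[OF Suc.prems(2) assms(1) that]
      by (rule has_derivative_scaleR)
    show "Ck_on k (\<lambda>x. r x *\<^sub>R frechet_derivative f (at x) v + frechet_derivative r (at x) v *\<^sub>R f x) S" for v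
      by (intro Ck_on_add Suc.IH assms) (use Suc.prems Ck_on_SucD in auto)
  qed
qed

text \<open>The chain rule evaluates the derivative of \<open>h\<close> in a direction that varies
  with \<open>x\<close>, to which the induction hypothesis does not apply. Expanding that direction
  in \<open>Basis\<close> leaves scalar coefficients times derivatives of \<open>h\<close> in fixed
  directions, composed with \<open>f\<close>.\<close>

lemma Ck_on_compose:
  fixes f :: "'a::euclidean_space \<Rightarrow> 'b::euclidean_space"
    and h :: "'b \<Rightarrow> 'c::real_normed_vector"
  assumes "open S" "open T" "f ` S \<subseteq> T" "Ck_on k f S" "Ck_on k h T"
  shows "Ck_on k (\<lambda>x. h (f x)) S"
  using assms(4,5)
proof (induction k arbitrary: h)
  case 0
  then show ?case using assms(3) by (auto intro: continuous_on_compose2)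
next
  case (Suc k)
  have dh: "(h has_derivative frechet_derivative h (at (f x))) (at (f x))" if "x \<in> S" for x
    using Ck_on_Suc_has_derivative[OF Suc.prems(2) assms(2)] assms(3) that by auto
  show ?case
  proof (rule Ck_on_SucI[OF assms(1)])
    show "((\<lambda>x. h (f x)) has_derivative
        (\<lambda>v. \<Sum>b\<in>Basis. (frechet_derivative f (at x) v \<bullet> b) *\<^sub>R frechet_derivative h (at (f x)) b)) (at x)"
      if "x \<in> S" for x
    proof -
      have "((\<lambda>x. h (f x)) has_derivative
          (\<lambda>v. frechet_derivative h (at (f x)) (frechet_derivative f (at x) v))) (at x)"
        using Ck_on_Suc_has_derivative[OF Suc.prems(1) assms(1) that] dh[OF that]
        by (rule has_derivative_compose)
      moreover have "frechet_derivative h (at (f x)) w = (\<Sum>b\<in>Basis. (w \<bullet> b) *\<^sub>R frechet_derivative h (at (f x)) b)" for w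
      proof -
        have lin: "linear (frechet_derivative h (at (f x)))"
          using dh[OF that] has_derivative_linear by blast
        have "frechet_derivative h (at (f x)) w = frechet_derivative h (at (f x)) (\<Sum>b\<in>Basis. (w \<bullet> b) *\<^sub>R b)"
          by (simp add: euclidean_representation)
        then show ?thesis by (simp add: linear_sum[OF lin] linear_cmul[OF lin])
      qed
      then have "(\<lambda>v. frechet_derivative h (at (f x)) (frechet_derivative f (at x) v)) =
        (\<lambda>v. \<Sum>b\<in>Basis. (frechet_derivative f (at x) v \<bullet> b) *\<^sub>R frechet_derivative h (at (f x)) b)"
        by (rule ext)
      ultimately show ?thesis by (simp only:)
    qed
    show "Ck_on k (\<lambda>x. \<Sum>b\<in>Basis. (frechet_derivative f (at x) v \<bullet> b) *\<^sub>R frechet_derivative h (at (f x)) b) S" for v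
    proof (intro Ck_on_sum Ck_on_scaleR assms(1))
      show "Ck_on k (\<lambda>x. frechet_derivative f (at x) v \<bullet> b) S" for b :: 'b
        by (rule Ck_on_linear_compose[OF bounded_linear_inner_left assms(1)]) (use Suc.prems in auto)
      show "Ck_on k (\<lambda>x. frechet_derivative h (at (f x)) b) S" for b
        by (rule Suc.IH) (use Suc.prems Ck_on_SucD in auto)
    qed
  qed
qed

lemma smooth_on_cong:
  "open S \<Longrightarrow> (\<And>x. x \<in> S \<Longrightarrow> f x = h x) \<Longrightarrow> smooth_on f S \<longleftrightarrow> smooth_on h S"
  unfolding smooth_on_def using Ck_on_cong by blast

lemma smooth_on_subset: "smooth_on f S \<Longrightarrow> T \<subseteq> S \<Longrightarrow> smooth_on f T"
  unfolding smooth_on_def using Ck_on_subset by blast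

lemma smooth_on_local:
  "(\<And>x. x \<in> S \<Longrightarrow> \<exists>T. open T \<and> x \<in> T \<and> smooth_on f T) \<Longrightarrow> smooth_on f S"
  unfolding smooth_on_def by (meson Ck_on_local)

lemma smooth_on_const: "open S \<Longrightarrow> smooth_on (\<lambda>x. c) S"
  unfolding smooth_on_def using Ck_on_const by blast

lemma smooth_on_linear_compose:
  "bounded_linear L \<Longrightarrow> open S \<Longrightarrow> smooth_on f S \<Longrightarrow> smooth_on (\<lambda>x. L (f x)) S"
  unfolding smooth_on_def using Ck_on_linear_compose by blast

lemma smooth_on_id: "open S \<Longrightarrow> smooth_on (\<lambda>x. x) S"
  unfolding smooth_on_def using Ck_on_bounded_linear[OF bounded_linear_ident] by blast

lemma smooth_on_add:
  "open S \<Longrightarrow> smooth_on f S \<Longrightarrow> smooth_on h S \<Longrightarrow> smooth_on (\<lambda>x. f x + h x) S"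
  unfolding smooth_on_def using Ck_on_add by blast

lemma smooth_on_mult:
  fixes f h :: "'a::euclidean_space \<Rightarrow> real"
  shows "open S \<Longrightarrow> smooth_on f S \<Longrightarrow> smooth_on h S \<Longrightarrow> smooth_on (\<lambda>x. f x * h x) S"
  unfolding smooth_on_def using Ck_on_scaleR[of S _ f h] by simp

lemma smooth_on_compose:
  fixes f :: "'a::euclidean_space \<Rightarrow> 'b::euclidean_space"
    and h :: "'b \<Rightarrow> 'c::real_normed_vector"
  shows "open S \<Longrightarrow> open T \<Longrightarrow> f ` S \<subseteq> T \<Longrightarrow> smooth_on f S \<Longrightarrow> smooth_on h T \<Longrightarrow>
    smooth_on (\<lambda>x. h (f x)) S"
  unfolding smooth_on_def using Ck_on_compose by blast

lemma smooth_on_Pair: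
  assumes "open S" "smooth_on f S" "smooth_on h S"
  shows "smooth_on (\<lambda>x. (f x, h x)) S"
proof -
  have "bounded_linear (\<lambda>x::'b. (x, 0::'c))" "bounded_linear (\<lambda>x::'c. (0::'b, x))"
    by (intro bounded_linear_Pair bounded_linear_ident bounded_linear_zero)+
  from smooth_on_linear_compose[OF this(1) assms(1,2)] smooth_on_linear_compose[OF this(2) assms(1,3)]
  have "smooth_on (\<lambda>x. (f x, 0) + (0, h x)) S" by (rule smooth_on_add[OF assms(1)])
  then show ?thesis by simp
qed

lemma smooth_on_has_derivative:
  "smooth_on f S \<Longrightarrow> open S \<Longrightarrow> x \<in> S \<Longrightarrow> (f has_derivative frechet_derivative f (at x)) (at x)"
  unfolding smooth_on_def using Ck_on_Suc_has_derivative by blast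

lemma smooth_on_frechet_derivative:
  "smooth_on f S \<Longrightarrow> smooth_on (\<lambda>x. frechet_derivative f (at x) v) S"
  unfolding smooth_on_def by (metis Ck_on.simps(2))

section \<open>Tangent vectors as derivations\<close>

lemma chart_facts:
  assumes "smooth_atlas A" "(U, \<phi>) \<in> A"
  shows "open U" "open (\<phi> ` U)" "continuous_on U \<phi>" "continuous_on (\<phi> ` U) (inv_into U \<phi>)"
    "inj_on \<phi> U" "homeomorphism U (\<phi> ` U) \<phi> (inv_into U \<phi>)"
proof -
  show *: "open U" "open (\<phi> ` U)" "homeomorphism U (\<phi> ` U) \<phi> (inv_into U \<phi>)"
    using assms unfolding smooth_atlas_def by blast+
  show "continuous_on U \<phi>" "continuous_on (\<phi> ` U) (inv_into U \<phi>)" "inj_on \<phi> U"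
    using *(3) unfolding homeomorphism_def by (auto intro: inj_on_inverseI)
qed

lemma open_chart_image:
  assumes "smooth_atlas A" "(U, \<phi>) \<in> A" "open W"
  shows "open (\<phi> ` (U \<inter> W))"
proof -
  have "openin (top_of_set (\<phi> ` U)) (\<phi> ` (U \<inter> W))"
    using homeomorphism_imp_open_map[OF chart_facts(6)[OF assms(1,2)]] assms(3)
    by (simp add: openin_open_Int)
  then show ?thesis using chart_facts(2)[OF assms(1,2)] openin_open_trans by blast
qed

lemma chart_exists:
  assumes "smooth_atlas A"
  obtains U \<phi> where "(U, \<phi>) \<in> A" "p \<in> U"
  using assms unfolding smooth_atlas_def by blast

lemma chart_inv:
  assumes "smooth_atlas A" "(U, \<phi>) \<in> A" "p \<in> U"
  shows "inv_into U \<phi> (\<phi> p) = p"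
  using chart_facts(5)[OF assms(1,2)] assms(3) by simp

lemma smooth_transition:
  "smooth_atlas A \<Longrightarrow> (U, \<phi>) \<in> A \<Longrightarrow> (V, \<psi>) \<in> A \<Longrightarrow> smooth_on (\<psi> \<circ> inv_into U \<phi>) (\<phi> ` (U \<inter> V))"
  unfolding smooth_atlas_def by blast

lemma smooth_funD: "smooth_fun A W f \<Longrightarrow> (U, \<phi>) \<in> A \<Longrightarrow> smooth_on (f \<circ> inv_into U \<phi>) (\<phi> ` (U \<inter> W))"
  unfolding smooth_fun_def by blast

lemma smooth_fun_subset: "smooth_fun A W f \<Longrightarrow> W' \<subseteq> W \<Longrightarrow> smooth_fun A W' f"
  unfolding smooth_fun_def by (auto intro: smooth_on_subset)

lemma smooth_fun_local:
  assumes "smooth_atlas A" "\<And>p. p \<in> W \<Longrightarrow> smooth_near A p f"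
  shows "smooth_fun A W f"
  unfolding smooth_fun_def
proof safe
  fix U \<phi> assume U: "(U, \<phi>) \<in> A"
  show "smooth_on (f \<circ> inv_into U \<phi>) (\<phi> ` (U \<inter> W))"
  proof (rule smooth_on_local)
    fix x assume "x \<in> \<phi> ` (U \<inter> W)"
    then obtain p where p: "p \<in> U" "p \<in> W" "x = \<phi> p" by blast
    then obtain W' where "open W'" "p \<in> W'" "smooth_fun A W' f"
      using assms(2) unfolding smooth_near_def by blast
    then show "\<exists>T. open T \<and> x \<in> T \<and> smooth_on (f \<circ> inv_into U \<phi>) T"
      using open_chart_image[OF assms(1) U] smooth_funD[OF _ U] p by blast
  qed
qed

text \<open>Any other chart sees the function through a transition map, so on the domain of a chart
  this one chart decides smoothness.\<close>

lemma smooth_fun_chart: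
  assumes A: "smooth_atlas A" and U: "(U, \<phi>) \<in> A" and W: "open W"
    and f: "smooth_on (f \<circ> inv_into U \<phi>) (\<phi> ` (U \<inter> W))"
  shows "smooth_fun A (U \<inter> W) f"
  unfolding smooth_fun_def
proof safe
  fix V \<psi> assume V: "(V, \<psi>) \<in> A"
  let ?S = "\<psi> ` (V \<inter> (U \<inter> W))"
  have S: "open ?S"
    by (intro open_chart_image[OF A V] open_Int W chart_facts(1)[OF A U])
  have "smooth_on (\<lambda>x. (f \<circ> inv_into U \<phi>) ((\<phi> \<circ> inv_into V \<psi>) x)) ?S"
  proof (rule smooth_on_compose[OF S open_chart_image[OF A U W] _ _ f])
    show "(\<phi> \<circ> inv_into V \<psi>) ` ?S \<subseteq> \<phi> ` (U \<inter> W)"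
      using chart_inv[OF A V] by auto
    show "smooth_on (\<phi> \<circ> inv_into V \<psi>) ?S"
      by (rule smooth_on_subset[OF smooth_transition[OF A V U]]) auto
  qed
  then show "smooth_on (f \<circ> inv_into V \<psi>) ?S"
    by (subst (asm) smooth_on_cong[OF S]) (auto simp: chart_inv[OF A V] chart_inv[OF A U])
qed

lemma smooth_fun_coordinate:
  assumes A: "smooth_atlas A" and U: "(U, \<phi>) \<in> A"
  shows "smooth_fun A U (\<lambda>q. \<phi> q \<bullet> b)"
  unfolding smooth_fun_def
proof safe
  fix V \<psi> assume V: "(V, \<psi>) \<in> A"
  show "smooth_on ((\<lambda>q. \<phi> q \<bullet> b) \<circ> inv_into V \<psi>) (\<psi> ` (V \<inter> U))"
    using smooth_on_linear_compose[OF bounded_linear_inner_left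
      open_chart_image[OF A V chart_facts(1)[OF A U]] smooth_transition[OF A V U]]
    by (simp add: o_def)
qed

lemma smooth_fun_const: "smooth_atlas A \<Longrightarrow> open W \<Longrightarrow> smooth_fun A W (\<lambda>_. c)"
  unfolding smooth_fun_def o_def by (auto intro!: smooth_on_const open_chart_image)

lemma smooth_fun_add:
  "smooth_atlas A \<Longrightarrow> open W \<Longrightarrow> smooth_fun A W f \<Longrightarrow> smooth_fun A W h \<Longrightarrow> smooth_fun A W (\<lambda>q. f q + h q)"
  unfolding smooth_fun_def o_def by (auto intro!: smooth_on_add open_chart_image)

lemma smooth_fun_mult:
  "smooth_atlas A \<Longrightarrow> open W \<Longrightarrow> smooth_fun A W f \<Longrightarrow> smooth_fun A W h \<Longrightarrow> smooth_fun A W (\<lambda>q. f q * h q)"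
  unfolding smooth_fun_def o_def by (auto intro!: smooth_on_mult open_chart_image)

lemma smooth_fun_sum:
  "smooth_atlas A \<Longrightarrow> open W \<Longrightarrow> (\<And>i. i \<in> I \<Longrightarrow> smooth_fun A W (f i)) \<Longrightarrow>
    smooth_fun A W (\<lambda>q. \<Sum>i\<in>I. f i q)"
  by (induction I rule: infinite_finite_induct) (auto intro!: smooth_fun_const smooth_fun_add)

lemma smooth_nearI: "smooth_fun A W f \<Longrightarrow> open W \<Longrightarrow> p \<in> W \<Longrightarrow> smooth_near A p f"
  unfolding smooth_near_def by blast

lemma smooth_near_const: "smooth_atlas A \<Longrightarrow> smooth_near A p (\<lambda>_. c)"
  using smooth_fun_const[of A UNIV c] by (intro smooth_nearI[of A UNIV]) auto

lemma smooth_near_add_mult: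
  assumes "smooth_atlas A" "smooth_near A p f" "smooth_near A p h"
  shows "smooth_near A p (\<lambda>q. f q + h q)" "smooth_near A p (\<lambda>q. f q * h q)"
proof -
  obtain W W' where W: "open W" "p \<in> W" "smooth_fun A W f" "open W'" "p \<in> W'" "smooth_fun A W' h"
    using assms unfolding smooth_near_def by blast
  then have *: "smooth_fun A (W \<inter> W') f" "smooth_fun A (W \<inter> W') h" "open (W \<inter> W')" "p \<in> W \<inter> W'"
    using smooth_fun_subset by blast+
  then show "smooth_near A p (\<lambda>q. f q + h q)" "smooth_near A p (\<lambda>q. f q * h q)"
    by (auto intro!: smooth_nearI[of A "W \<inter> W'"] smooth_fun_add[OF assms(1)] smooth_fun_mult[OF assms(1)])
qed

lemma smooth_near_has_derivative:
  assumes A: "smooth_atlas A" and U: "(U, \<phi>) \<in> A" "p \<in> U" and f: "smooth_near A p f"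
  shows "(f \<circ> inv_into U \<phi> has_derivative frechet_derivative (f \<circ> inv_into U \<phi>) (at (\<phi> p))) (at (\<phi> p))"
proof -
  obtain W where W: "open W" "p \<in> W" "smooth_fun A W f"
    using f unfolding smooth_near_def by blast
  show ?thesis
    by (rule smooth_on_has_derivative[OF smooth_funD[OF W(3) U(1)]])
      (use W U open_chart_image[OF A U(1) W(1)] in auto)
qed

lemma dir_deriv_eqI:
  assumes "smooth_near A p f" "(f \<circ> inv_into U \<phi> has_derivative D) (at (\<phi> p))"
  shows "dir_deriv A (U, \<phi>) p v f = D v"
  using assms frechet_derivative_at[of _ D] by (simp add: dir_deriv_def)

section \<open>Smooth self-maps and their differentials\<close>

definition smooth_map :: "('g::topological_space, 'e::euclidean_space) atlas \<Rightarrow> ('g \<Rightarrow> 'g) \<Rightarrow> bool" where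
  "smooth_map A F \<longleftrightarrow> continuous_on UNIV F \<and>
     (\<forall>(U, \<phi>)\<in>A. \<forall>(V, \<psi>)\<in>A. smooth_on (\<psi> \<circ> F \<circ> inv_into U \<phi>) (\<phi> ` (U \<inter> F -` V)))"

lemma smooth_map_id: "smooth_atlas A \<Longrightarrow> smooth_map A (\<lambda>q. q)"
  unfolding smooth_map_def using smooth_transition by (auto simp: o_def)

lemma smooth_map_compose_fun:
  assumes A: "smooth_atlas A" and F: "smooth_map A F" and W: "open W" "smooth_fun A W f"
  shows "smooth_fun A (F -` W) (\<lambda>q. f (F q))"
  unfolding smooth_fun_def
proof safe
  fix U \<phi> assume U: "(U, \<phi>) \<in> A"
  show "smooth_on ((\<lambda>q. f (F q)) \<circ> inv_into U \<phi>) (\<phi> ` (U \<inter> F -` W))"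
  proof (rule smooth_on_local)
    fix x assume "x \<in> \<phi> ` (U \<inter> F -` W)"
    then obtain p where p: "p \<in> U" "F p \<in> W" "x = \<phi> p" by blast
    obtain V \<psi> where V: "(V, \<psi>) \<in> A" "F p \<in> V" using chart_exists[OF A] by blast
    have cont: "continuous_on UNIV F" using F unfolding smooth_map_def by blast
    let ?S = "\<phi> ` (U \<inter> F -` (V \<inter> W))"
    have S: "open ?S"
      by (intro open_chart_image[OF A U] open_vimage[OF _ cont] open_Int chart_facts(1)[OF A V(1)] W(1))
    have "smooth_on (\<lambda>x. (f \<circ> inv_into V \<psi>) ((\<psi> \<circ> F \<circ> inv_into U \<phi>) x)) ?S"
    proof (rule smooth_on_compose[OF S open_chart_image[OF A V(1) W(1)] _ _ smooth_funD[OF W(2) V(1)]])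
      show "(\<psi> \<circ> F \<circ> inv_into U \<phi>) ` ?S \<subseteq> \<psi> ` (V \<inter> W)"
        by (auto simp: chart_inv[OF A U])
      have "smooth_on (\<psi> \<circ> F \<circ> inv_into U \<phi>) (\<phi> ` (U \<inter> F -` V))"
        using F U V(1) unfolding smooth_map_def by blast
      then show "smooth_on (\<psi> \<circ> F \<circ> inv_into U \<phi>) ?S"
        by (rule smooth_on_subset) auto
    qed
    then have "smooth_on ((\<lambda>q. f (F q)) \<circ> inv_into U \<phi>) ?S"
      by (subst (asm) smooth_on_cong[OF S]) (auto simp: chart_inv[OF A U] chart_inv[OF A V(1)])
    then show "\<exists>T. open T \<and> x \<in> T \<and> smooth_on ((\<lambda>q. f (F q)) \<circ> inv_into U \<phi>) T"
      using S p V by blast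
  qed
qed

lemma smooth_map_compose_near:
  assumes A: "smooth_atlas A" and F: "smooth_map A F" and f: "smooth_near A (F p) f"
  shows "smooth_near A p (\<lambda>q. f (F q))"
proof -
  obtain W where W: "open W" "F p \<in> W" "smooth_fun A W f"
    using f unfolding smooth_near_def by blast
  have "open (F -` W)"
    using F W(1) open_vimage unfolding smooth_map_def by blast
  then show ?thesis
    using smooth_nearI[OF smooth_map_compose_fun[OF A F W(1,3)], of p] W(2) by blast
qed

text \<open>The chain rule in coordinates. It serves twice: for left translations, and for the
  identity, where it expresses a tangent vector in another chart.\<close>

lemma dir_deriv_push:
  assumes A: "smooth_atlas A" and F: "smooth_map A F"
    and U: "(U, \<phi>) \<in> A" "p \<in> U" and V: "(V, \<psi>) \<in> A" "F p \<in> V"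
    and f: "smooth_near A (F p) f"
  shows "dir_deriv A (U, \<phi>) p v (\<lambda>q. f (F q)) =
    dir_deriv A (V, \<psi>) (F p) (frechet_derivative (\<psi> \<circ> F \<circ> inv_into U \<phi>) (at (\<phi> p)) v) f"
proof (rule dir_deriv_eqI[OF smooth_map_compose_near[OF A F f]])
  let ?S = "\<phi> ` (U \<inter> F -` V)"
  have cont: "continuous_on UNIV F" and sm: "smooth_on (\<psi> \<circ> F \<circ> inv_into U \<phi>) ?S"
    using F U V unfolding smooth_map_def by blast+
  have S: "open ?S"
    by (intro open_chart_image[OF A U(1)] open_vimage[OF _ cont] chart_facts(1)[OF A V(1)])
  have pS: "\<phi> p \<in> ?S" using U V by blast
  have "((\<lambda>x. (f \<circ> inv_into V \<psi>) ((\<psi> \<circ> F \<circ> inv_into U \<phi>) x)) has_derivative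
      (\<lambda>v. dir_deriv A (V, \<psi>) (F p) (frechet_derivative (\<psi> \<circ> F \<circ> inv_into U \<phi>) (at (\<phi> p)) v) f)) (at (\<phi> p))"
    using has_derivative_compose[OF smooth_on_has_derivative[OF sm S pS],
        of "f \<circ> inv_into V \<psi>" "frechet_derivative (f \<circ> inv_into V \<psi>) (at (\<psi> (F p)))"]
      smooth_near_has_derivative[OF A V f] f
    by (simp add: chart_inv[OF A U] dir_deriv_def)
  then show "((\<lambda>q. f (F q)) \<circ> inv_into U \<phi> has_derivative
      (\<lambda>v. dir_deriv A (V, \<psi>) (F p) (frechet_derivative (\<psi> \<circ> F \<circ> inv_into U \<phi>) (at (\<phi> p)) v) f)) (at (\<phi> p))"
    by (rule has_derivative_transform_within_open[OF _ S pS])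
      (auto simp: chart_inv[OF A U(1)] chart_inv[OF A V(1)])
qed

lemma dir_deriv_change_chart:
  assumes A: "smooth_atlas A" and U: "(U, \<phi>) \<in> A" "p \<in> U" and V: "(V, \<psi>) \<in> A" "p \<in> V"
  shows "dir_deriv A (U, \<phi>) p v =
    dir_deriv A (V, \<psi>) p (frechet_derivative (\<psi> \<circ> inv_into U \<phi>) (at (\<phi> p)) v)"
proof
  fix f
  have o: "\<psi> \<circ> (\<lambda>q. q) \<circ> inv_into U \<phi> = \<psi> \<circ> inv_into U \<phi>" by (simp add: fun_eq_iff)
  show "dir_deriv A (U, \<phi>) p v f =
      dir_deriv A (V, \<psi>) p (frechet_derivative (\<psi> \<circ> inv_into U \<phi>) (at (\<phi> p)) v) f"
  proof (cases "smooth_near A p f")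
    case True
    show ?thesis using dir_deriv_push[OF A smooth_map_id[OF A] U V True] by (simp only: o)
  qed (simp add: dir_deriv_def)
qed

lemma tangent_space_eq:
  assumes A: "smooth_atlas A" and U: "(U, \<phi>) \<in> A" "p \<in> U"
  shows "tangent_space A p = range (dir_deriv A (U, \<phi>) p)"
  unfolding tangent_space_def using dir_deriv_change_chart[OF A _ _ U] U by blast

lemma linear_dir_deriv:
  assumes A: "smooth_atlas A" and U: "(U, \<phi>) \<in> A" "p \<in> U"
  shows "linear (dir_deriv A (U, \<phi>) p)"
proof -
  have lin: "linear (frechet_derivative (f \<circ> inv_into U \<phi>) (at (\<phi> p)))" if "smooth_near A p f" for f
    using smooth_near_has_derivative[OF A U that] has_derivative_linear by blast
  show ?thesis
    by (rule linearI)
      (auto simp: fun_eq_iff dir_deriv_def scaleR_fun_def linear_add[OF lin] linear_cmul[OF lin])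
qed

text \<open>Applying the tangent vector to the coordinate functions recovers the components of
  \<open>v\<close>. These functions are smooth only on \<open>U\<close>, which is enough because
  tangent vectors act on functions that are smooth near \<open>p\<close>.\<close>

lemma inj_dir_deriv:
  assumes A: "smooth_atlas A" and U: "(U, \<phi>) \<in> A" "p \<in> U"
  shows "inj (dir_deriv A (U, \<phi>) p)"
proof (subst linear_injective_0[OF linear_dir_deriv[OF A U]], safe)
  fix v assume v: "dir_deriv A (U, \<phi>) p v = 0"
  have "v \<bullet> b = 0" for b
  proof -
    have "dir_deriv A (U, \<phi>) p v (\<lambda>q. \<phi> q \<bullet> b) = v \<bullet> b"
    proof (rule dir_deriv_eqI)
      show "smooth_near A p (\<lambda>q. \<phi> q \<bullet> b)"
        using smooth_nearI[OF smooth_fun_coordinate[OF A U(1)] chart_facts(1)[OF A U(1)] U(2)] .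
      have "((\<lambda>x. x \<bullet> b) has_derivative (\<lambda>x. x \<bullet> b)) (at (\<phi> p))"
        by (rule bounded_linear_imp_has_derivative[OF bounded_linear_inner_left])
      then show "((\<lambda>q. \<phi> q \<bullet> b) \<circ> inv_into U \<phi> has_derivative (\<lambda>x. x \<bullet> b)) (at (\<phi> p))"
        by (rule has_derivative_transform_within_open[OF _ chart_facts(2)[OF A U(1)]])
          (use U in \<open>auto simp: chart_inv[OF A U(1)]\<close>)
    qed
    then show ?thesis using v by simp
  qed
  then show "v = 0" by (metis inner_eq_zero_iff)
qed

lemma subspace_tangent_space:
  assumes "smooth_atlas A"
  shows "subspace (tangent_space A p)"
proof -
  obtain U \<phi> where "(U, \<phi>) \<in> A" "p \<in> U" using chart_exists[OF assms] by blast
  then show ?thesis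
    using tangent_space_eq linear_dir_deriv linear_subspace_image subspace_UNIV assms by metis
qed

lemma tangent_not_smooth:
  "u \<in> tangent_space A p \<Longrightarrow> \<not> smooth_near A p f \<Longrightarrow> u f = 0"
  unfolding tangent_space_def dir_deriv_def by auto

lemma tangent_derivation:
  assumes A: "smooth_atlas A" and u: "u \<in> tangent_space A p"
    and f: "smooth_near A p f" and h: "smooth_near A p h"
  shows "u (\<lambda>q. f q + h q) = u f + u h" "u (\<lambda>q. f q * h q) = f p * u h + u f * h p"
    "u (\<lambda>q. c) = 0"
proof -
  obtain U \<phi> v where U: "(U, \<phi>) \<in> A" "p \<in> U" and u: "u = dir_deriv A (U, \<phi>) p v"
    using u unfolding tangent_space_def by blast
  note df = smooth_near_has_derivative[OF A U f] and dh = smooth_near_has_derivative[OF A U h]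
  have uf: "u f = frechet_derivative (f \<circ> inv_into U \<phi>) (at (\<phi> p)) v"
    and uh: "u h = frechet_derivative (h \<circ> inv_into U \<phi>) (at (\<phi> p)) v"
    using f h by (simp_all add: u dir_deriv_def)
  show "u (\<lambda>q. f q + h q) = u f + u h"
    unfolding uf uh unfolding u
    by (rule dir_deriv_eqI[OF smooth_near_add_mult(1)[OF A f h]])
      (use has_derivative_add[OF df dh] in \<open>simp add: o_def\<close>)
  show "u (\<lambda>q. f q * h q) = f p * u h + u f * h p"
    unfolding uf uh unfolding u
    by (rule dir_deriv_eqI[OF smooth_near_add_mult(2)[OF A f h]])
      (use has_derivative_mult[OF df dh] in \<open>simp add: o_def chart_inv[OF A U]\<close>)
  show "u (\<lambda>q. c) = 0"
    unfolding u by (rule dir_deriv_eqI[OF smooth_near_const[OF A]]) (simp add: o_def)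
qed

section \<open>Left-invariant vector fields\<close>

lemma vector_fieldD:
  assumes "X \<in> vector_fields A"
  shows "X p \<in> tangent_space A p" "open W \<Longrightarrow> smooth_fun A W f \<Longrightarrow> smooth_fun A W (\<lambda>p. X p f)"
    "smooth_near A p f \<Longrightarrow> smooth_near A p (\<lambda>q. X q f)"
  using assms unfolding vector_fields_def smooth_near_def by blast+

lemma vector_field_add:
  assumes "smooth_atlas A" "X \<in> vector_fields A" "Y \<in> vector_fields A"
  shows "X + Y \<in> vector_fields A"
  using assms unfolding vector_fields_def
  by (auto intro: smooth_fun_add subspace_add[OF subspace_tangent_space])

lemma vector_field_scale:
  assumes "smooth_atlas A" "X \<in> vector_fields A" "smooth_fun A UNIV h"
  shows "(\<lambda>p. h p *\<^sub>R X p) \<in> vector_fields A"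
proof -
  have "h p *\<^sub>R X p \<in> tangent_space A p" for p
    by (rule subspace_scale[OF subspace_tangent_space[OF assms(1)] vector_fieldD(1)[OF assms(2)]])
  moreover have "smooth_fun A W (\<lambda>p. (h p *\<^sub>R X p) f)" if "open W" "smooth_fun A W f" for W f
    using smooth_fun_mult[OF assms(1) that(1) smooth_fun_subset[OF assms(3)] vector_fieldD(2)[OF assms(2) that]]
    by (simp add: scaleR_fun_def)
  ultimately show ?thesis unfolding vector_fields_def by blast
qed

lemma vector_field_scaleR:
  "smooth_atlas A \<Longrightarrow> X \<in> vector_fields A \<Longrightarrow> c *\<^sub>R X \<in> vector_fields A"
  using vector_field_scale[of A X "\<lambda>_. c"] smooth_fun_const[of A UNIV c]
  by (simp add: scaleR_fun_def[of c X])

lemma vector_field_zero: "smooth_atlas A \<Longrightarrow> 0 \<in> vector_fields A"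
  unfolding vector_fields_def
  by (auto intro: smooth_fun_const subspace_0[OF subspace_tangent_space])

lemma vector_field_diff:
  "smooth_atlas A \<Longrightarrow> X \<in> vector_fields A \<Longrightarrow> Y \<in> vector_fields A \<Longrightarrow> X - Y \<in> vector_fields A"
  using vector_field_add[of A X "(-1) *\<^sub>R Y"] vector_field_scaleR[of A Y "-1"] by simp

lemma vector_field_sum:
  "smooth_atlas A \<Longrightarrow> (\<And>i. i \<in> I \<Longrightarrow> X i \<in> vector_fields A) \<Longrightarrow> (\<Sum>i\<in>I. X i) \<in> vector_fields A"
  by (induction I rule: infinite_finite_induct) (auto intro: vector_field_zero vector_field_add)

section \<open>Left translations and the Lie algebra\<close>

context lie_group
begin

lemma left_mult_inverse [simp]: "gmul (ginv a) (gmul a p) = p" "gmul a (gmul (ginv a) p) = p"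
  by (simp_all flip: assoc)

text \<open>This is the set on which \<open>smooth_mult\<close> speaks; the calculus above can be
  used on it only once it is known to be open.\<close>

lemma open_mult_domain:
  assumes U: "(U, \<phi>) \<in> A" and V: "(V, \<psi>) \<in> A" and W: "open W"
  shows "open {(\<phi> x, \<psi> y) | x y. x \<in> U \<and> y \<in> V \<and> gmul x y \<in> W}"
proof -
  let ?m = "\<lambda>z. gmul (inv_into U \<phi> (fst z)) (inv_into V \<psi> (snd z))"
  have "continuous_on (\<phi> ` U \<times> \<psi> ` V) (\<lambda>z. (inv_into U \<phi> (fst z), inv_into V \<psi> (snd z)))"
    by (intro continuous_on_Pair continuous_on_compose2[OF chart_facts(4)[OF atlas U]]
        continuous_on_compose2[OF chart_facts(4)[OF atlas V]] continuous_on_fst continuous_on_snd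
        continuous_on_id) auto
  then have "continuous_on (\<phi> ` U \<times> \<psi> ` V) ?m"
    using continuous_on_compose2[OF continuous_mult] by fastforce
  then have "open ((\<phi> ` U \<times> \<psi> ` V) \<inter> ?m -` W)"
    by (intro continuous_open_preimage open_Times chart_facts(2)[OF atlas U] chart_facts(2)[OF atlas V] W)
  moreover have "(\<phi> ` U \<times> \<psi> ` V) \<inter> ?m -` W = {(\<phi> x, \<psi> y) | x y. x \<in> U \<and> y \<in> V \<and> gmul x y \<in> W}"
    by (auto simp: chart_inv[OF atlas U] chart_inv[OF atlas V]) blast
  ultimately show ?thesis by simp
qed

text \<open>Multiplication is jointly smooth in coordinates; its first argument is frozen at the
  coordinates of \<open>a\<close>.\<close>

lemma smooth_left_mult: "smooth_map A (gmul a)"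
  unfolding smooth_map_def
proof safe
  show cont: "continuous_on UNIV (gmul a)"
    using continuous_on_compose2[OF continuous_mult, of UNIV "\<lambda>q. (a, q)"]
    by (simp add: continuous_on_Pair)
  fix U \<phi> V \<psi> assume U: "(U, \<phi>) \<in> A" and V: "(V, \<psi>) \<in> A"
  obtain W \<theta> where W: "(W, \<theta>) \<in> A" "a \<in> W" using chart_exists[OF atlas] by blast
  let ?S = "\<phi> ` (U \<inter> gmul a -` V)"
  have S: "open ?S"
    by (intro open_chart_image[OF atlas U] open_vimage[OF _ cont] chart_facts(1)[OF atlas V])
  have "smooth_on (\<lambda>y. (\<lambda>(x, y). \<psi> (gmul (inv_into W \<theta> x) (inv_into U \<phi> y))) (\<theta> a, y)) ?S"
    by (rule smooth_on_compose[OF S open_mult_domain[OF W(1) U chart_facts(1)[OF atlas V]] _ _ smooth_mult[OF W(1) U V]])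
      (use W smooth_on_Pair[OF S smooth_on_const[OF S] smooth_on_id[OF S], of "\<theta> a"] in auto)
  then show "smooth_on (\<psi> \<circ> gmul a \<circ> inv_into U \<phi>) ?S"
    by (simp add: o_def chart_inv[OF atlas W])
qed

lemma push_left_tangent:
  assumes u: "u \<in> tangent_space A p"
  shows "push_left gmul a u \<in> tangent_space A (gmul a p)"
proof -
  obtain U \<phi> v where U: "(U, \<phi>) \<in> A" "p \<in> U" and v: "u = dir_deriv A (U, \<phi>) p v"
    using u unfolding tangent_space_def by blast
  obtain V \<psi> where V: "(V, \<psi>) \<in> A" "gmul a p \<in> V" using chart_exists[OF atlas] by blast
  have "push_left gmul a u =
    dir_deriv A (V, \<psi>) (gmul a p) (frechet_derivative (\<psi> \<circ> gmul a \<circ> inv_into U \<phi>) (at (\<phi> p)) v)"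
  proof
    fix f
    show "push_left gmul a u f = dir_deriv A (V, \<psi>) (gmul a p)
        (frechet_derivative (\<psi> \<circ> gmul a \<circ> inv_into U \<phi>) (at (\<phi> p)) v) f"
    proof (cases "smooth_near A (gmul a p) f")
      case True
      show ?thesis unfolding push_left_def v
        by (rule dir_deriv_push[OF atlas smooth_left_mult U V True])
    next
      case False
      \<comment> \<open>Both sides are \<open>0\<close> by the convention for functions that are not
        smooth nearby: translating back by \<open>ginv a\<close> shows that \<open>f\<close> and its
        translate are smooth near the respective points simultaneously.\<close>
      have "\<not> smooth_near A p (\<lambda>q. f (gmul a q))"
      proof
        assume "smooth_near A p (\<lambda>q. f (gmul a q))"
        then have "smooth_near A (gmul a p) (\<lambda>q. f (gmul a (gmul (ginv a) q)))"
          using smooth_map_compose_near[OF atlas smooth_left_mult, of "ginv a" "gmul a p" "\<lambda>q. f (gmul a q)"]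
          by simp
        then show False using False by simp
      qed
      then show ?thesis
        using tangent_not_smooth[OF u] False by (simp add: push_left_def dir_deriv_def)
    qed
  qed
  then show ?thesis using V unfolding tangent_space_def by blast
qed

text \<open>In coordinates \<open>f (gmul q y)\<close> is smooth in both variables together. The
  left-invariant field applied to \<open>f\<close> at \<open>q\<close> is its partial derivative in
  \<open>y\<close> at \<open>gid\<close>, and a partial derivative in a fixed direction is again
  smooth in \<open>q\<close>.\<close>

lemma left_field_smooth:
  assumes u: "u \<in> tangent_space A gid" and W: "open W" "smooth_fun A W f"
  shows "smooth_fun A W (\<lambda>p. push_left gmul p u f)"
proof (rule smooth_fun_local[OF atlas])
  fix p assume p: "p \<in> W"
  obtain U \<phi> where U: "(U, \<phi>) \<in> A" "p \<in> U" using chart_exists[OF atlas] by blast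
  obtain V \<psi> v where V: "(V, \<psi>) \<in> A" "gid \<in> V" and v: "u = dir_deriv A (V, \<psi>) gid v"
    using u unfolding tangent_space_def by blast
  \<comment> \<open>The chart \<open>U\<close> around \<open>p\<close> also serves as target chart,
    because products with \<open>y\<close> near \<open>gid\<close> stay near
    \<open>x\<close>.\<close>
  let ?O = "{(\<phi> x, \<psi> y) | x y. x \<in> U \<and> y \<in> V \<and> gmul x y \<in> U \<inter> W}"
  let ?F = "\<lambda>z. f (gmul (inv_into U \<phi> (fst z)) (inv_into V \<psi> (snd z)))"
  have O: "open ?O"
    by (intro open_mult_domain U V open_Int W chart_facts(1)[OF atlas U(1)])
  have "smooth_on (\<lambda>z. (f \<circ> inv_into U \<phi>) ((\<lambda>(a, b). \<phi> (gmul (inv_into U \<phi> a) (inv_into V \<psi> b))) z)) ?O"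
    by (rule smooth_on_compose[OF O open_chart_image[OF atlas U(1) W(1)] _ _ smooth_funD[OF W(2) U(1)]],
        use U V in \<open>auto simp: chart_inv[OF atlas U(1)] chart_inv[OF atlas V(1)]\<close>,
        rule smooth_on_subset[OF smooth_mult[OF U(1) V(1) U(1)]], auto)
  then have F: "smooth_on ?F ?O"
    by (subst (asm) smooth_on_cong[OF O])
      (auto simp: chart_inv[OF atlas U(1)] chart_inv[OF atlas V(1)])
  let ?S = "\<phi> ` (U \<inter> W)"
  have S: "open ?S" by (rule open_chart_image[OF atlas U(1) W(1)])
  have inO: "(\<phi> q, \<psi> gid) \<in> ?O" if "q \<in> U \<inter> W" for q
    using that V(2) right_neutral by force
  have "smooth_on (\<lambda>x. frechet_derivative ?F (at (x, \<psi> gid)) (0, v)) ?S"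
    by (rule smooth_on_compose[OF S O _ _ smooth_on_frechet_derivative[OF F]])
      (use inO in \<open>auto intro!: smooth_on_Pair smooth_on_const smooth_on_id S\<close>)
  moreover have "((\<lambda>q. push_left gmul q u f) \<circ> inv_into U \<phi>) x =
      frechet_derivative ?F (at (x, \<psi> gid)) (0, v)" if x: "x \<in> ?S" for x
  proof -
    obtain q where q: "q \<in> U \<inter> W" "x = \<phi> q" using x by blast
    have sm: "smooth_near A (gmul q gid) f"
      using q W by (auto intro: smooth_nearI)
    have "((\<lambda>y. (\<phi> q, y)) has_derivative (\<lambda>w. (0, w))) (at (\<psi> gid))"
      by (intro has_derivative_Pair has_derivative_const has_derivative_ident)
    from has_derivative_compose[OF this smooth_on_has_derivative[OF F O inO[OF q(1)]]]
    have "(((\<lambda>y. f (gmul q y)) \<circ> inv_into V \<psi>) has_derivative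
        (\<lambda>w. frechet_derivative ?F (at (\<phi> q, \<psi> gid)) (0, w))) (at (\<psi> gid))"
      using q(1) by (simp add: o_def chart_inv[OF atlas U(1)])
    from dir_deriv_eqI[OF smooth_map_compose_near[OF atlas smooth_left_mult sm] this]
    show ?thesis
      using q by (simp add: push_left_def v chart_inv[OF atlas U(1)])
  qed
  ultimately have "smooth_on ((\<lambda>q. push_left gmul q u f) \<circ> inv_into U \<phi>) ?S"
    by (subst smooth_on_cong[OF S])
  then show "smooth_near A p (\<lambda>q. push_left gmul q u f)"
    using smooth_nearI[OF smooth_fun_chart[OF atlas U(1) W(1)]] chart_facts(1)[OF atlas U(1)] W(1) U p
    by blast
qed

lemma left_field_in_lie_algebra:
  assumes "u \<in> tangent_space A gid"
  shows "(\<lambda>p. push_left gmul p u) \<in> lie_algebra gmul A"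
proof -
  have "push_left gmul p u \<in> tangent_space A p" for p
    using push_left_tangent[OF assms, of p] by simp
  then show ?thesis
    using left_field_smooth[OF assms]
    by (auto simp: lie_algebra_def vector_fields_def push_left_def assoc)
qed

lemma lie_algebraD:
  assumes "X \<in> lie_algebra gmul A"
  shows "X \<in> vector_fields A" "X (gmul a p) = push_left gmul a (X p)" "X p = push_left gmul p (X gid)"
  proof -
  show *: "X \<in> vector_fields A" "X (gmul a p) = push_left gmul a (X p)" for a p
    using assms unfolding lie_algebra_def by blast+
  show "X p = push_left gmul p (X gid)" using *(2)[of p gid] by simp
qed

lemma lie_algebra_through:
  assumes u: "u \<in> tangent_space A p"
  obtains X where "X \<in> lie_algebra gmul A" "X p = u"
proof -
  have "push_left gmul (ginv p) u \<in> tangent_space A gid"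
    using push_left_tangent[OF u, of "ginv p"] by simp
  from left_field_in_lie_algebra[OF this] show ?thesis
    by (rule that) (simp add: push_left_def)
qed

text \<open>A left-invariant field is determined by its value at \<open>gid\<close>, and every
  tangent vector there occurs; a chart identifies these vectors with the model space. This is the
  source of the dimension of the Lie algebra.\<close>

lemma lie_algebra_param:
  obtains \<Phi> :: "'e \<Rightarrow> 'g vfield" where "linear \<Phi>" "inj \<Phi>" "range \<Phi> = lie_algebra gmul A"
proof -
  obtain U \<phi> where U: "(U, \<phi>) \<in> A" "gid \<in> U" using chart_exists[OF atlas] by blast
  let ?d = "dir_deriv A (U, \<phi>) gid"
  define \<Phi> where "\<Phi> = (\<lambda>v p. push_left gmul p (?d v))"
  note lin = linear_dir_deriv[OF atlas U]
  have id: "\<Phi> v gid = ?d v" for v by (simp add: \<Phi>_def push_left_def)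
  show ?thesis
  proof
    show "linear \<Phi>"
      by (rule linearI)
        (simp_all add: \<Phi>_def fun_eq_iff push_left_def linear_add[OF lin] linear_cmul[OF lin] scaleR_fun_def)
    show "inj \<Phi>"
      using inj_dir_deriv[OF atlas U] id by (metis injD injI)
    show "range \<Phi> = lie_algebra gmul A"
    proof
      show "range \<Phi> \<subseteq> lie_algebra gmul A"
        unfolding \<Phi>_def using left_field_in_lie_algebra tangent_space_eq[OF atlas U] by blast
      show "lie_algebra gmul A \<subseteq> range \<Phi>"
      proof
        fix X assume X: "X \<in> lie_algebra gmul A"
        then have "X gid \<in> range ?d"
          using vector_fieldD(1)[OF lie_algebraD(1)[OF X]] tangent_space_eq[OF atlas U] by blast
        then obtain v where "X gid = ?d v" by blast
        then have "X = \<Phi> v"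
          unfolding \<Phi>_def using lie_algebraD(3)[OF X] by (intro ext) metis
        then show "X \<in> range \<Phi>" by blast
      qed
    qed
  qed
qed

lemma subspace_lie_algebra: "subspace (lie_algebra gmul A)"
proof -
  obtain \<Phi> :: "'e \<Rightarrow> 'g vfield" where "linear \<Phi>" "range \<Phi> = lie_algebra gmul A"
    by (rule lie_algebra_param)
  then show ?thesis using linear_subspace_image[OF _ subspace_UNIV] by metis
qed

lemma lie_algebra_basis:
  obtains B where "finite B" "card B = DIM('e)" "independent B" "span B = lie_algebra gmul A"
proof -
  obtain \<Phi> :: "'e \<Rightarrow> 'g vfield" where \<Phi>: "linear \<Phi>" "inj \<Phi>" "range \<Phi> = lie_algebra gmul A"
    by (rule lie_algebra_param)
  show ?thesis
  proof
    show "finite (\<Phi> ` Basis)" by simp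
    show "card (\<Phi> ` Basis) = DIM('e)"
      by (rule card_image) (use \<Phi>(2) inj_on_subset in blast)
    show "independent (\<Phi> ` Basis)"
      using linear_independent_injective_image[OF \<Phi>(1) independent_Basis] \<Phi>(2) inj_on_subset by blast
    show "span (\<Phi> ` Basis) = lie_algebra gmul A"
      using linear_span_image[OF \<Phi>(1)] \<Phi>(3) by simp
  qed
qed

lemma lie_inner_left_invariant:
  assumes "left_invariant_metric gmul A g" "X \<in> lie_algebra gmul A" "Y \<in> lie_algebra gmul A"
  shows "g p (X p) (Y p) = lie_inner gid g X Y"
proof -
  have "g (gmul p gid) (push_left gmul p (X gid)) (push_left gmul p (Y gid)) = g gid (X gid) (Y gid)"
    using assms vector_fieldD(1) lie_algebraD(1) unfolding left_invariant_metric_def by blast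
  then show ?thesis
    using lie_algebraD(3)[OF assms(2), of p] lie_algebraD(3)[OF assms(3), of p]
    by (simp add: lie_inner_def)
qed

end

section \<open>Levi-Civita connection of a homogeneous frame\<close>

lemma bracket_apply:
  "smooth_near A p f \<Longrightarrow> bracket A X Y p f = X p (\<lambda>q. Y q f) - Y p (\<lambda>q. X q f)"
  by (simp add: bracket_def)

lemma bracket_antisym: "bracket A Y X = - bracket A X Y"
  by (simp add: bracket_def fun_eq_iff)

lemma metric_tangent:
  assumes "smooth_atlas A" "riemannian_metric A g"
    and "u \<in> tangent_space A p" "v \<in> tangent_space A p" "w \<in> tangent_space A p"
  shows "g p (u + v) w = g p u w + g p v w" "g p (c *\<^sub>R u) w = c * g p u w" "g p u v = g p v u"
    "u \<noteq> 0 \<Longrightarrow> 0 < g p u u" "g p (u - v) w = g p u w - g p v w"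
proof -
  have *: "g p (u + v) w = g p u w + g p v w \<and> g p (c *\<^sub>R u) w = c * g p u w \<and> g p u v = g p v u \<and>
      (u \<noteq> 0 \<longrightarrow> 0 < g p u u)"
    if "u \<in> tangent_space A p" "v \<in> tangent_space A p" "w \<in> tangent_space A p" for u v w c
    using assms(2) that unfolding riemannian_metric_def by blast
  show "g p (u + v) w = g p u w + g p v w" "g p (c *\<^sub>R u) w = c * g p u w" "g p u v = g p v u"
    "u \<noteq> 0 \<Longrightarrow> 0 < g p u u"
    using *[OF assms(3-5)] by blast+
  have "(-1) *\<^sub>R v \<in> tangent_space A p"
    by (rule subspace_scale[OF subspace_tangent_space[OF assms(1)] assms(4)])
  then have "g p (u + (-1) *\<^sub>R v) w = g p u w + g p ((-1) *\<^sub>R v) w"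
    using *[OF assms(3) _ assms(5)] by blast
  moreover have "g p ((-1) *\<^sub>R v) w = (-1) * g p v w"
    using *[OF assms(4,4,5)] by blast
  ultimately show "g p (u - v) w = g p u w - g p v w"
    by (simp only: scaleR_minus1_left diff_conv_add_uminus mult_minus1)
qed

lemma metric_sum:
  assumes "smooth_atlas A" "riemannian_metric A g"
    and "\<And>i. i \<in> I \<Longrightarrow> u i \<in> tangent_space A p" "w \<in> tangent_space A p"
  shows "g p (\<Sum>i\<in>I. u i) w = (\<Sum>i\<in>I. g p (u i) w)"
proof -
  note T = subspace_tangent_space[OF assms(1), of p]
  have 0: "g p 0 w = 0"
    using metric_tangent(2)[OF assms(1,2) subspace_0[OF T] subspace_0[OF T] assms(4), of 0] by simp
  show ?thesis
    using assms(3)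
  proof (induction I rule: infinite_finite_induct)
    case (insert i I)
    have "g p (u i + (\<Sum>i\<in>I. u i)) w = g p (u i) w + g p (\<Sum>i\<in>I. u i) w"
      by (rule metric_tangent(1)[OF assms(1,2) _ _ assms(4)])
        (use insert.prems in \<open>auto intro!: subspace_sum[OF T]\<close>)
    moreover have "g p (\<Sum>i\<in>I. u i) w = (\<Sum>i\<in>I. g p (u i) w)"
      by (rule insert.IH) (use insert.prems in auto)
    ultimately show ?case
      by (simp only: sum.insert[OF insert.hyps])
  qed (simp_all add: 0)
qed

lemma sum_rotate:
  fixes f :: "'a \<Rightarrow> 'b \<Rightarrow> 'c \<Rightarrow> 'd::comm_monoid_add"
  shows "(\<Sum>i\<in>I. \<Sum>j\<in>J. \<Sum>k\<in>K. f i j k) = (\<Sum>k\<in>K. \<Sum>i\<in>I. \<Sum>j\<in>J. f i j k)"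
proof -
  have "(\<Sum>i\<in>I. \<Sum>j\<in>J. \<Sum>k\<in>K. f i j k) = (\<Sum>i\<in>I. \<Sum>k\<in>K. \<Sum>j\<in>J. f i j k)"
    by (rule sum.cong[OF refl]) (rule sum.swap)
  also have "\<dots> = (\<Sum>k\<in>K. \<Sum>i\<in>I. \<Sum>j\<in>J. f i j k)" by (rule sum.swap)
  finally show ?thesis .
qed

lemma sum_fun_apply: "(\<Sum>i\<in>I. f i) x = (\<Sum>i\<in>I. f i x)"
  by (induction I rule: infinite_finite_induct) auto

text \<open>A global orthonormal frame whose structure constants \<open>c\<close> do not depend on
  the point. \<open>\<Gamma> i j k\<close> is meant as the \<open>E k\<close>-component of the
  covariant derivative of \<open>E j\<close> along \<open>E i\<close>. Instead of Koszul's formula,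
  its two characteristic properties are assumed: skewness, which expresses compatibility with the
  metric, and absence of torsion. Both can be checked entry by entry for a concrete
  \<open>\<Gamma>\<close>.\<close>

locale homogeneous_frame =
  fixes A :: "('g::{t2_space,second_countable_topology}, 'e::euclidean_space) atlas"
    and g :: "'g metric" and E :: "nat \<Rightarrow> 'g vfield" and c \<Gamma> :: "nat \<Rightarrow> nat \<Rightarrow> nat \<Rightarrow> real"
    and n :: nat
  assumes n_def: "n = DIM('e)"
    and atlas: "smooth_atlas A" and metric: "riemannian_metric A g"
    and E_field: "i < n \<Longrightarrow> E i \<in> vector_fields A"
    and orthonormal: "i < n \<Longrightarrow> j < n \<Longrightarrow> g p (E i p) (E j p) = (if i = j then 1 else 0)"
    and expansion: "u \<in> tangent_space A p \<Longrightarrow> u = (\<Sum>i<n. g p u (E i p) *\<^sub>R E i p)"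
    and bracket_frame: "i < n \<Longrightarrow> j < n \<Longrightarrow> bracket A (E i) (E j) = (\<Sum>k<n. c i j k *\<^sub>R E k)"
    and \<Gamma>_metric: "i < n \<Longrightarrow> j < n \<Longrightarrow> k < n \<Longrightarrow> \<Gamma> i j k = - \<Gamma> i k j"
    and \<Gamma>_torsion: "i < n \<Longrightarrow> j < n \<Longrightarrow> k < n \<Longrightarrow> \<Gamma> i j k - \<Gamma> j i k = c i j k"
begin

definition comp :: "'g vfield \<Rightarrow> nat \<Rightarrow> 'g \<Rightarrow> real" where
  "comp X i p = g p (X p) (E i p)"

lemma frame_tangent: "i < n \<Longrightarrow> E i p \<in> tangent_space A p"
  using vector_fieldD(1) E_field by blast

lemma comp_smooth: "X \<in> vector_fields A \<Longrightarrow> i < n \<Longrightarrow> smooth_fun A UNIV (comp X i)"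
  using metric E_field unfolding riemannian_metric_def comp_def by blast

lemma comp_near: "X \<in> vector_fields A \<Longrightarrow> i < n \<Longrightarrow> smooth_near A p (comp X i)"
  using comp_smooth smooth_nearI[of A UNIV] by blast

lemma field_expansion: "X \<in> vector_fields A \<Longrightarrow> X p = (\<Sum>i<n. comp X i p *\<^sub>R E i p)"
  unfolding comp_def by (rule expansion[OF vector_fieldD(1)])

lemma comp_linear:
  assumes "X \<in> vector_fields A" "Y \<in> vector_fields A" "i < n"
  shows "comp (X + Y) i p = comp X i p + comp Y i p" "comp (X - Y) i p = comp X i p - comp Y i p"
    "comp (\<lambda>p. h p *\<^sub>R X p) i p = h p * comp X i p"
  using metric_tangent[OF atlas metric vector_fieldD(1)[OF assms(1)] vector_fieldD(1)[OF assms(2)]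
      frame_tangent[OF assms(3)]]
  by (simp_all add: comp_def)

lemma comp_frame: "i < n \<Longrightarrow> j < n \<Longrightarrow> comp (E i) j p = (if i = j then 1 else 0)"
  by (simp add: comp_def orthonormal)

lemma field_eqI:
  assumes "X \<in> vector_fields A" "Y \<in> vector_fields A" "\<And>i p. i < n \<Longrightarrow> comp X i p = comp Y i p"
  shows "X = Y"
proof
  fix p
  show "X p = Y p"
    unfolding field_expansion[OF assms(1), of p] field_expansion[OF assms(2), of p]
    using assms(3) by simp
qed

definition of_comps :: "(nat \<Rightarrow> 'g \<Rightarrow> real) \<Rightarrow> 'g vfield" where
  "of_comps h = (\<lambda>p. \<Sum>k<n. h k p *\<^sub>R E k p)"

lemma of_comps_field:
  assumes "\<And>k. k < n \<Longrightarrow> smooth_fun A UNIV (h k)"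
  shows "of_comps h \<in> vector_fields A"
proof -
  have "of_comps h = (\<Sum>k<n. (\<lambda>p. h k p *\<^sub>R E k p))"
    by (simp add: of_comps_def fun_eq_iff sum_fun_apply)
  then show ?thesis
    using assms by (auto intro!: vector_field_sum[OF atlas] vector_field_scale[OF atlas] E_field)
qed

lemma comp_of_comps: "i < n \<Longrightarrow> comp (of_comps h) i p = h i p"
proof -
  assume i: "i < n"
  have "comp (of_comps h) i p = (\<Sum>k<n. g p (h k p *\<^sub>R E k p) (E i p))"
    unfolding comp_def of_comps_def
    by (rule metric_sum[OF atlas metric _ frame_tangent[OF i]])
      (auto intro: subspace_scale[OF subspace_tangent_space[OF atlas]] frame_tangent)
  also have "\<dots> = (\<Sum>k<n. if k = i then h k p else 0)"
    by (rule sum.cong)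
      (auto simp: metric_tangent(2)[OF atlas metric frame_tangent frame_tangent[OF i] frame_tangent[OF i]] orthonormal i)
  also have "\<dots> = h i p" using i by simp
  finally show ?thesis .
qed

lemma field_derivation:
  assumes "X \<in> vector_fields A" "smooth_near A p f" "smooth_near A p h"
  shows "X p (\<lambda>q. f q + h q) = X p f + X p h" "X p (\<lambda>q. f q * h q) = f p * X p h + X p f * h p"
    "X p (\<lambda>q. k) = 0"
  using tangent_derivation[OF atlas vector_fieldD(1)[OF assms(1)] assms(2,3)] by auto

lemma field_derivation_sum:
  assumes "X \<in> vector_fields A" "\<And>i. i \<in> I \<Longrightarrow> smooth_near A p (f i)"
  shows "X p (\<lambda>q. \<Sum>i\<in>I. f i q) = (\<Sum>i\<in>I. X p (f i))"
proof -
  have "smooth_near A p (\<lambda>q. \<Sum>i\<in>I. f i q) \<and> X p (\<lambda>q. \<Sum>i\<in>I. f i q) = (\<Sum>i\<in>I. X p (f i))"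
    using assms(2)
    by (induction I rule: infinite_finite_induct)
      (auto simp: smooth_near_const[OF atlas] smooth_near_add_mult[OF atlas]
        field_derivation[OF assms(1)] field_derivation(3)[OF assms(1) smooth_near_const[OF atlas] smooth_near_const[OF atlas]])
  then show ?thesis by blast
qed

lemma inner_comps:
  assumes "X \<in> vector_fields A" "Y \<in> vector_fields A"
  shows "g p (X p) (Y p) = (\<Sum>i<n. comp X i p * comp Y i p)"
proof -
  note Yp = vector_fieldD(1)[OF assms(2)]
  have "g p (X p) (Y p) = (\<Sum>i<n. g p (comp X i p *\<^sub>R E i p) (Y p))"
    by (subst field_expansion[OF assms(1)], rule metric_sum[OF atlas metric _ Yp])
      (auto intro: subspace_scale[OF subspace_tangent_space[OF atlas]] frame_tangent)
  also have "\<dots> = (\<Sum>i<n. comp X i p * comp Y i p)"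
    using metric_tangent(2,3)[OF atlas metric frame_tangent Yp Yp]
    by (intro sum.cong) (auto simp: comp_def)
  finally show ?thesis .
qed

lemma derivation_along_frame:
  assumes "X \<in> vector_fields A"
  shows "X p f = (\<Sum>i<n. comp X i p * E i p f)"
  by (subst field_expansion[OF assms]) (simp add: sum_fun_apply scaleR_fun_def)

text \<open>Prepares the torsion computation: when \<open>X\<close> and \<open>Y\<close> are
  exchanged and the results subtracted, the double sum retains only brackets of frame
  fields.\<close>

lemma second_derivation:
  assumes X: "X \<in> vector_fields A" and Y: "Y \<in> vector_fields A" and f: "smooth_near A p f"
  shows "X p (\<lambda>q. Y q f) = (\<Sum>j<n. X p (comp Y j) * E j p f) +
    (\<Sum>i<n. \<Sum>j<n. comp X i p * comp Y j p * E i p (\<lambda>q. E j q f))"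
proof -
  have Ef: "smooth_near A p (\<lambda>q. E j q f)" if "j < n" for j
    using vector_fieldD(3)[OF E_field[OF that] f] .
  have "X p (\<lambda>q. Y q f) = X p (\<lambda>q. \<Sum>j<n. comp Y j q * E j q f)"
    by (simp only: derivation_along_frame[OF Y, of _ f])
  also have "\<dots> = (\<Sum>j<n. X p (\<lambda>q. comp Y j q * E j q f))"
    by (rule field_derivation_sum[OF X]) (auto intro: smooth_near_add_mult[OF atlas] comp_near[OF Y] Ef)
  also have "\<dots> = (\<Sum>j<n. comp Y j p * X p (\<lambda>q. E j q f) + X p (comp Y j) * E j p f)"
    by (rule sum.cong) (auto simp: field_derivation(2)[OF X comp_near[OF Y] Ef])
  also have "\<dots> = (\<Sum>j<n. X p (comp Y j) * E j p f) + (\<Sum>j<n. \<Sum>i<n. comp X i p * comp Y j p * E i p (\<lambda>q. E j q f))"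
    by (simp add: sum.distrib derivation_along_frame[OF X, of p "\<lambda>q. E _ q f"] sum_distrib_left mult_ac)
  finally show ?thesis by (subst sum.swap)
qed

definition conn_comp :: "'g vfield \<Rightarrow> 'g vfield \<Rightarrow> nat \<Rightarrow> 'g \<Rightarrow> real" where
  "conn_comp X Y k p = X p (comp Y k) + (\<Sum>i<n. \<Sum>j<n. \<Gamma> i j k * comp X i p * comp Y j p)"

definition conn :: "'g vfield \<Rightarrow> 'g vfield \<Rightarrow> 'g vfield" where
  "conn X Y = of_comps (conn_comp X Y)"

lemma conn_field:
  assumes "X \<in> vector_fields A" "Y \<in> vector_fields A"
  shows "conn X Y \<in> vector_fields A"
  unfolding conn_def
proof (rule of_comps_field)
  fix k assume k: "k < n"
  have "smooth_fun A UNIV (\<lambda>p. X p (comp Y k) + (\<Sum>i<n. \<Sum>j<n. \<Gamma> i j k * comp X i p * comp Y j p))"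
    by (intro smooth_fun_add[OF atlas] smooth_fun_sum[OF atlas] smooth_fun_mult[OF atlas]
      smooth_fun_const[OF atlas] open_UNIV vector_fieldD(2)[OF assms(1)] comp_smooth assms k) simp_all
  then show "smooth_fun A UNIV (conn_comp X Y k)"
    by (simp only: conn_comp_def[abs_def])
qed

lemma comp_conn: "k < n \<Longrightarrow> comp (conn X Y) k p = conn_comp X Y k p"
  unfolding conn_def by (rule comp_of_comps)

lemma conn_torsion:
  assumes X: "X \<in> vector_fields A" and Y: "Y \<in> vector_fields A"
  shows "conn X Y - conn Y X = bracket A X Y"
proof (intro ext)
  fix p f
  show "(conn X Y - conn Y X) p f = bracket A X Y p f"
  proof (cases "smooth_near A p f")
    case True
    let ?x = "\<lambda>i. comp X i p" and ?y = "\<lambda>i. comp Y i p"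
    have Efr: "E i p (\<lambda>q. E j q f) - E j p (\<lambda>q. E i q f) = (\<Sum>k<n. c i j k * E k p f)"
      if "i < n" "j < n" for i j
      using bracket_apply[OF True, of "E i" "E j"] bracket_frame[OF that]
      by (simp add: sum_fun_apply scaleR_fun_def)
    have "bracket A X Y p f = (\<Sum>k<n. (X p (comp Y k) - Y p (comp X k)) * E k p f) +
       ((\<Sum>i<n. \<Sum>j<n. ?x i * ?y j * E i p (\<lambda>q. E j q f)) - (\<Sum>i<n. \<Sum>j<n. ?y i * ?x j * E i p (\<lambda>q. E j q f)))"
      unfolding bracket_apply[OF True] second_derivation[OF X Y True] second_derivation[OF Y X True]
      by (simp add: left_diff_distrib sum_subtractf)
    also have "(\<Sum>i<n. \<Sum>j<n. ?y i * ?x j * E i p (\<lambda>q. E j q f)) = (\<Sum>i<n. \<Sum>j<n. ?x i * ?y j * E j p (\<lambda>q. E i q f))"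
      by (subst sum.swap) (simp add: mult_ac)
    also have "(\<Sum>i<n. \<Sum>j<n. ?x i * ?y j * E i p (\<lambda>q. E j q f)) - \<dots> =
        (\<Sum>i<n. \<Sum>j<n. ?x i * ?y j * (E i p (\<lambda>q. E j q f) - E j p (\<lambda>q. E i q f)))"
      by (simp add: right_diff_distrib sum_subtractf)
    also have "\<dots> = (\<Sum>i<n. \<Sum>j<n. ?x i * ?y j * (\<Sum>k<n. c i j k * E k p f))"
      by (simp add: Efr)
    also have "\<dots> = (\<Sum>k<n. (\<Sum>i<n. \<Sum>j<n. c i j k * ?x i * ?y j) * E k p f)"
      unfolding sum_distrib_left sum_distrib_right
      by (subst sum_rotate) (simp add: mult_ac)
    finally have B: "bracket A X Y p f = (\<Sum>k<n. (X p (comp Y k) - Y p (comp X k)) * E k p f) + \<dots>" .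
    have "(\<Sum>i<n. \<Sum>j<n. \<Gamma> i j k * ?y i * ?x j) = (\<Sum>i<n. \<Sum>j<n. \<Gamma> j i k * ?x i * ?y j)" for k
      by (subst sum.swap) (simp add: mult_ac)
    then have "(\<Sum>i<n. \<Sum>j<n. \<Gamma> i j k * ?x i * ?y j) - (\<Sum>i<n. \<Sum>j<n. \<Gamma> i j k * ?y i * ?x j) =
        (\<Sum>i<n. \<Sum>j<n. (\<Gamma> i j k - \<Gamma> j i k) * ?x i * ?y j)" for k
      by (simp add: left_diff_distrib sum_subtractf)
    then have \<Gamma>: "(\<Sum>i<n. \<Sum>j<n. \<Gamma> i j k * ?x i * ?y j) - (\<Sum>i<n. \<Sum>j<n. \<Gamma> i j k * ?y i * ?x j) =
        (\<Sum>i<n. \<Sum>j<n. c i j k * ?x i * ?y j)" if "k < n" for k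
      using \<Gamma>_torsion that by simp
    have "(conn X Y - conn Y X) p f = (\<Sum>k<n. (conn_comp X Y k p - conn_comp Y X k p) * E k p f)"
      by (simp add: conn_def of_comps_def sum_fun_apply scaleR_fun_def left_diff_distrib sum_subtractf)
    also have "\<dots> = (\<Sum>k<n. (X p (comp Y k) - Y p (comp X k) + (\<Sum>i<n. \<Sum>j<n. c i j k * ?x i * ?y j)) * E k p f)"
      by (rule sum.cong) (auto simp: conn_comp_def \<Gamma>[symmetric])
    also have "\<dots> = bracket A X Y p f"
      unfolding B by (simp add: distrib_right sum.distrib)
    finally show ?thesis .
  next
    case False
    \<comment> \<open>On functions that are not smooth near \<open>p\<close>, tangent vectors and
      \<open>bracket\<close> are \<open>0\<close> by convention, so the left side only has to be
      recognised as a vector field.\<close>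
    have "conn X Y - conn Y X \<in> vector_fields A"
      by (intro vector_field_diff[OF atlas] conn_field X Y)
    then show ?thesis
      using tangent_not_smooth[OF vector_fieldD(1) False] False by (simp only: bracket_def if_False)
  qed
qed

lemma conn_compatible:
  assumes X: "X \<in> vector_fields A" and Y: "Y \<in> vector_fields A" and Z: "Z \<in> vector_fields A"
  shows "X p (\<lambda>q. g q (Y q) (Z q)) = g p (conn X Y p) (Z p) + g p (Y p) (conn X Z p)"
proof -
  let ?x = "\<lambda>i. comp X i p" and ?y = "\<lambda>i. comp Y i p" and ?z = "\<lambda>i. comp Z i p"
  have "X p (\<lambda>q. g q (Y q) (Z q)) = X p (\<lambda>q. \<Sum>k<n. comp Y k q * comp Z k q)"
    using inner_comps[OF Y Z] by presburger
  also have "\<dots> = (\<Sum>k<n. X p (\<lambda>q. comp Y k q * comp Z k q))"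
    by (rule field_derivation_sum[OF X]) (auto intro: smooth_near_add_mult[OF atlas] comp_near Y Z)
  also have "\<dots> = (\<Sum>k<n. ?y k * X p (comp Z k) + X p (comp Y k) * ?z k)"
    by (rule sum.cong) (auto simp: field_derivation(2)[OF X comp_near[OF Y] comp_near[OF Z]])
  finally have L: "X p (\<lambda>q. g q (Y q) (Z q)) = (\<Sum>k<n. ?y k * X p (comp Z k)) + (\<Sum>k<n. X p (comp Y k) * ?z k)"
    by (simp add: sum.distrib)
  \<comment> \<open>The terms with \<open>\<Gamma>\<close> cancel: renaming \<open>j\<close> and
    \<open>k\<close> turns one triple sum into the negative of the other, by skewness in the last
    two indices.\<close>
  have "(\<Sum>k<n. \<Sum>i<n. \<Sum>j<n. \<Gamma> i j k * ?x i * ?y j * ?z k) = (\<Sum>i<n. \<Sum>k<n. \<Sum>j<n. \<Gamma> i j k * ?x i * ?y j * ?z k)"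
    by (rule sum.swap)
  also have "\<dots> = (\<Sum>i<n. \<Sum>k<n. \<Sum>j<n. \<Gamma> i k j * ?x i * ?y k * ?z j)"
    by (rule sum.cong[OF refl]) (rule sum.swap)
  also have "\<dots> = (\<Sum>k<n. \<Sum>i<n. \<Sum>j<n. \<Gamma> i k j * ?x i * ?y k * ?z j)"
    by (rule sum.swap)
  also have "\<dots> = - (\<Sum>k<n. \<Sum>i<n. \<Sum>j<n. \<Gamma> i j k * ?x i * ?z j * ?y k)"
    unfolding sum_negf[symmetric] by (intro sum.cong refl) (subst \<Gamma>_metric, auto)
  finally have "(\<Sum>k<n. (\<Sum>i<n. \<Sum>j<n. \<Gamma> i j k * ?x i * ?y j) * ?z k) +
      (\<Sum>k<n. ?y k * (\<Sum>i<n. \<Sum>j<n. \<Gamma> i j k * ?x i * ?z j)) = 0"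
    by (simp add: sum_distrib_left sum_distrib_right mult_ac)
  then show ?thesis
    unfolding L inner_comps[OF conn_field[OF X Y] Z] inner_comps[OF Y conn_field[OF X Z]]
    by (simp add: comp_conn conn_comp_def algebra_simps sum.distrib)
qed

lemma levi_civita_conn: "is_levi_civita A g conn"
proof -
  have "conn (X + Y) Z = conn X Z + conn Y Z" "conn X (Y + Z) = conn X Y + conn X Z"
    "conn (\<lambda>p. h p *\<^sub>R X p) Z = (\<lambda>p. h p *\<^sub>R conn X Z p)"
    "conn X (\<lambda>p. h p *\<^sub>R Y p) = (\<lambda>p. X p h *\<^sub>R Y p + h p *\<^sub>R conn X Y p)"
    if X: "X \<in> vector_fields A" and Y: "Y \<in> vector_fields A" and Z: "Z \<in> vector_fields A"
      and h: "smooth_fun A UNIV h" for X Y Z h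
  proof -
    have hn: "smooth_near A p h" for p using h smooth_nearI[of A UNIV] by blast
    note hX = vector_field_scale[OF atlas X h] and hY = vector_field_scale[OF atlas Y h]
    have hZ: "(\<lambda>p. h p *\<^sub>R conn X Z p) \<in> vector_fields A" "(\<lambda>p. h p *\<^sub>R conn X Y p) \<in> vector_fields A"
      "(\<lambda>p. X p h *\<^sub>R Y p) \<in> vector_fields A"
      by (intro vector_field_scale[OF atlas] conn_field X Y Z h vector_fieldD(2)[OF X open_UNIV h])+
    note XY = vector_field_add[OF atlas X Y] and YZ = vector_field_add[OF atlas Y Z]
    note lin = comp_linear(1)[OF X Y] comp_linear(1)[OF Y Z]
      comp_linear(1)[OF conn_field[OF X Z] conn_field[OF Y Z]]
      comp_linear(1)[OF conn_field[OF X Y] conn_field[OF X Z]]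
      comp_linear(3)[OF X X] comp_linear(3)[OF Y Y] comp_linear(1)[OF hZ(3) hZ(2)]
      comp_linear(3)[OF conn_field[OF X Z] conn_field[OF X Z]]
      comp_linear(3)[OF conn_field[OF X Y] conn_field[OF X Y]]
    note eq = comp_conn conn_comp_def lin
    show "conn (X + Y) Z = conn X Z + conn Y Z"
    proof (rule field_eqI)
      show "comp (conn (X + Y) Z) k p = comp (conn X Z + conn Y Z) k p" if "k < n" for k p
        using that by (simp add: eq distrib_left distrib_right sum.distrib)
    qed (intro conn_field vector_field_add[OF atlas] X Y Z)+
    show "conn X (Y + Z) = conn X Y + conn X Z"
    proof (rule field_eqI)
      show "comp (conn X (Y + Z)) k p = comp (conn X Y + conn X Z) k p" if "k < n" for k p
      proof -
        have "comp (Y + Z) k = (\<lambda>q. comp Y k q + comp Z k q)"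
          by (rule ext) (rule lin(2)[OF that])
        then have "X p (comp (Y + Z) k) = X p (comp Y k) + X p (comp Z k)"
          using field_derivation(1)[OF X comp_near[OF Y that] comp_near[OF Z that]] by simp
        then show ?thesis using that by (simp add: eq distrib_left distrib_right sum.distrib)
      qed
    qed (intro conn_field vector_field_add[OF atlas] X Y Z)+
    show "conn (\<lambda>p. h p *\<^sub>R X p) Z = (\<lambda>p. h p *\<^sub>R conn X Z p)"
    proof (rule field_eqI)
      show "comp (conn (\<lambda>p. h p *\<^sub>R X p) Z) k p = comp (\<lambda>p. h p *\<^sub>R conn X Z p) k p" if "k < n" for k p
        using that by (simp add: eq scaleR_fun_def[of "h p" "X p"] distrib_left sum_distrib_left mult_ac)
    qed (intro conn_field hX hZ Z)+
    have sum: "(\<lambda>p. X p h *\<^sub>R Y p + h p *\<^sub>R conn X Y p) = (\<lambda>p. X p h *\<^sub>R Y p) + (\<lambda>p. h p *\<^sub>R conn X Y p)"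
      by (simp add: plus_fun_def)
    show "conn X (\<lambda>p. h p *\<^sub>R Y p) = (\<lambda>p. X p h *\<^sub>R Y p + h p *\<^sub>R conn X Y p)"
      unfolding sum
    proof (rule field_eqI)
      show "comp (conn X (\<lambda>p. h p *\<^sub>R Y p)) k p =
          comp ((\<lambda>p. X p h *\<^sub>R Y p) + (\<lambda>p. h p *\<^sub>R conn X Y p)) k p" if "k < n" for k p
      proof -
        have "comp (\<lambda>p. h p *\<^sub>R Y p) k = (\<lambda>q. h q * comp Y k q)"
          by (rule ext) (rule lin(6)[OF that])
        then have "X p (comp (\<lambda>p. h p *\<^sub>R Y p) k) = h p * X p (comp Y k) + X p h * comp Y k p"
          using field_derivation(2)[OF X hn comp_near[OF Y that]] by simp
        then show ?thesis using that by (simp add: eq distrib_left sum_distrib_left mult_ac)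
      qed
    qed (intro conn_field vector_field_add[OF atlas] hY hZ X)+
  qed
  then show ?thesis
    unfolding is_levi_civita_def
    by (intro conjI ballI allI impI conn_field conn_torsion conn_compatible) assumption+
qed

end

section \<open>Curvature in a homogeneous frame\<close>

lemma levi_civita_field:
  "is_levi_civita A g D \<Longrightarrow> X \<in> vector_fields A \<Longrightarrow> Y \<in> vector_fields A \<Longrightarrow> D X Y \<in> vector_fields A"
  unfolding is_levi_civita_def by blast

lemma levi_civitaD:
  assumes "smooth_atlas A" "is_levi_civita A g D"
    and "X \<in> vector_fields A" "Y \<in> vector_fields A" "Z \<in> vector_fields A"
  shows "D (X + Y) Z = D X Z + D Y Z" "D X (Y + Z) = D X Y + D X Z"
    "bracket A X Y = D X Y - D Y X"
    "X p (\<lambda>q. g q (Y q) (Z q)) = g p (D X Y p) (Z p) + g p (Y p) (D X Z p)"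
    "smooth_fun A UNIV h \<Longrightarrow> D (\<lambda>p. h p *\<^sub>R X p) Z = (\<lambda>p. h p *\<^sub>R D X Z p)"
    "smooth_fun A UNIV h \<Longrightarrow> D X (\<lambda>p. h p *\<^sub>R Y p) = (\<lambda>p. X p h *\<^sub>R Y p + h p *\<^sub>R D X Y p)"
proof -
  note lc = assms(2)[unfolded is_levi_civita_def]
  note * = conjunct2[OF lc, rule_format, OF assms(3-5)]
  note ** = *[OF smooth_fun_const[OF assms(1) open_UNIV, of 0]]
  show "D (X + Y) Z = D X Z + D Y Z" by (rule conjunct1[OF **])
  show "D X (Y + Z) = D X Y + D X Z" by (rule conjunct1[OF conjunct2[OF conjunct2[OF **]]])
  show "bracket A X Y = D X Y - D Y X"
    by (rule conjunct1[OF conjunct2[OF conjunct2[OF conjunct2[OF conjunct2[OF **]]]], symmetric])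
  show "X p (\<lambda>q. g q (Y q) (Z q)) = g p (D X Y p) (Z p) + g p (Y p) (D X Z p)"
    by (rule conjunct2[OF conjunct2[OF conjunct2[OF conjunct2[OF conjunct2[OF **]]]], rule_format])
  show "D (\<lambda>p. h p *\<^sub>R X p) Z = (\<lambda>p. h p *\<^sub>R D X Z p)" if "smooth_fun A UNIV h"
    by (rule conjunct1[OF conjunct2[OF *[OF that]]])
  show "D X (\<lambda>p. h p *\<^sub>R Y p) = (\<lambda>p. X p h *\<^sub>R Y p + h p *\<^sub>R D X Y p)" if "smooth_fun A UNIV h"
    by (rule conjunct1[OF conjunct2[OF conjunct2[OF conjunct2[OF *[OF that]]]]])
qed

lemma diff_eq_diff_exchange: "a - b = c - d \<Longrightarrow> a - c = b - (d :: 'a::ab_group_add)"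
  by (simp add: diff_eq_eq algebra_simps)

text \<open>The difference tensor of two such connections is symmetric in its first two and skew in its
  last two arguments.\<close>

lemma levi_civita_unique:
  assumes A: "smooth_atlas A" and g: "riemannian_metric A g"
    and D: "is_levi_civita A g D" and D': "is_levi_civita A g D'"
    and X: "X \<in> vector_fields A" and Y: "Y \<in> vector_fields A"
  shows "D X Y = D' X Y"
proof
  fix p
  define S where "S X Y Z = g p (D X Y p - D' X Y p) (Z p)" for X Y Z
  have S: "S X Y Z = g p (D X Y p) (Z p) - g p (D' X Y p) (Z p)"
    if "X \<in> vector_fields A" "Y \<in> vector_fields A" "Z \<in> vector_fields A" for X Y Z
    unfolding S_def
    by (intro metric_tangent(5)[OF A g] vector_fieldD(1) that
        levi_civita_field[OF D] levi_civita_field[OF D'])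
  have sym: "S X Y Z = S Y X Z"
    if "X \<in> vector_fields A" "Y \<in> vector_fields A" "Z \<in> vector_fields A" for X Y Z
  proof -
    have "D X Y - D Y X = D' X Y - D' Y X"
      using levi_civitaD(3)[OF A D that] levi_civitaD(3)[OF A D' that] by (rule trans[OF sym])
    then have "(D X Y - D Y X) p = (D' X Y - D' Y X) p" by (rule arg_cong)
    then have "D X Y p - D' X Y p = D Y X p - D' Y X p"
      unfolding minus_apply[of _ _ p] by (rule diff_eq_diff_exchange)
    then show ?thesis unfolding S_def by (rule arg_cong)
  qed
  have skew: "S X Y Z = - S X Z Y"
    if XYZ: "X \<in> vector_fields A" "Y \<in> vector_fields A" "Z \<in> vector_fields A" for X Y Z
  proof -
    have *: "g p (Y p) (D X Z p) = g p (D X Z p) (Y p)" "g p (Y p) (D' X Z p) = g p (D' X Z p) (Y p)"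
      by (intro metric_tangent(3)[OF A g, where w = "Y p"] vector_fieldD(1) XYZ
        levi_civita_field[OF D] levi_civita_field[OF D'])+
    show ?thesis
      using levi_civitaD(4)[OF A D XYZ, of p] levi_civitaD(4)[OF A D' XYZ, of p]
      unfolding S[OF XYZ] S[OF XYZ(1,3,2)] * by linarith
  qed
  have "S X Y Z = 0"
    if XYZ: "X \<in> vector_fields A" "Y \<in> vector_fields A" "Z \<in> vector_fields A" for X Y Z
    \<comment> \<open>Alternating the two symmetries six times runs through all orders of the
      arguments and returns to \<open>S X Y Z\<close> with three sign changes.\<close>
    using sym[OF XYZ] skew[OF XYZ(2,1,3)] sym[OF XYZ(2,3,1)] skew[OF XYZ(3,2,1)] sym[OF XYZ(3,1,2)]
      skew[OF XYZ] by linarith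
  \<comment> \<open>The difference of the two derivatives is itself a global field and can be
    inserted as \<open>Z\<close>, so that positivity of the metric applies without extending tangent
    vectors.\<close>
  from this[OF X Y vector_field_diff[OF A levi_civita_field[OF D X Y] levi_civita_field[OF D' X Y]]]
  have "g p ((D X Y - D' X Y) p) ((D X Y - D' X Y) p) = 0" unfolding S_def by simp
  moreover have "(D X Y - D' X Y) p \<in> tangent_space A p"
    by (intro vector_fieldD(1) vector_field_diff[OF A] levi_civita_field[OF D] levi_civita_field[OF D'] X Y)
  ultimately have "(D X Y - D' X Y) p = 0"
    using metric_tangent(4)[OF A g] by fastforce
  then show "D X Y p = D' X Y p" by (simp only: minus_apply eq_iff_diff_eq_0[symmetric])
qed

text \<open>The component along \<open>E l\<close> of the curvature operator of \<open>E i\<close>,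
  \<open>E j\<close> applied to \<open>E k\<close>. As \<open>\<Gamma>\<close> is constant, iterated
  covariant derivatives are products of its entries and no derivatives of \<open>\<Gamma>\<close>
  occur.\<close>

definition frame_curvature ::
    "nat \<Rightarrow> (nat \<Rightarrow> nat \<Rightarrow> nat \<Rightarrow> real) \<Rightarrow> (nat \<Rightarrow> nat \<Rightarrow> nat \<Rightarrow> real) \<Rightarrow> nat \<Rightarrow> nat \<Rightarrow> nat \<Rightarrow> nat \<Rightarrow> real" where
  "frame_curvature n c \<Gamma> i j k l =
    (\<Sum>m<n. \<Gamma> j k m * \<Gamma> i m l - \<Gamma> i k m * \<Gamma> j m l - c i j m * \<Gamma> m k l)"

context homogeneous_frame
begin

abbreviation D :: "'g vfield \<Rightarrow> 'g vfield \<Rightarrow> 'g vfield" where "D \<equiv> levi_civita A g"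

text \<open>The existence of \<open>conn\<close> makes the choice in \<open>levi_civita\<close>
  meaningful; uniqueness then identifies the chosen connection with \<open>conn\<close> on vector
  fields.\<close>

lemma levi_civita_D: "is_levi_civita A g D"
  unfolding levi_civita_def by (rule someI[of "is_levi_civita A g", OF levi_civita_conn])

lemma D_conn: "X \<in> vector_fields A \<Longrightarrow> Y \<in> vector_fields A \<Longrightarrow> D X Y = conn X Y"
  by (rule levi_civita_unique[OF atlas metric levi_civita_D levi_civita_conn])

lemmas D_in = levi_civita_field[OF levi_civita_D]
lemmas D_add_left = levi_civitaD(1)[OF atlas levi_civita_D]
lemmas D_add_right = levi_civitaD(2)[OF atlas levi_civita_D]
lemmas bracket_D = levi_civitaD(3)[OF atlas levi_civita_D]
lemmas D_scale_left = levi_civitaD(5)[OF atlas levi_civita_D]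
lemmas D_leibniz = levi_civitaD(6)[OF atlas levi_civita_D]

lemma bracket_field: "X \<in> vector_fields A \<Longrightarrow> Y \<in> vector_fields A \<Longrightarrow> bracket A X Y \<in> vector_fields A"
  by (subst bracket_D[of X Y Y]) (auto intro: vector_field_diff[OF atlas] D_in)

lemma D_diff_left:
  assumes X: "X \<in> vector_fields A" and Y: "Y \<in> vector_fields A" and Z: "Z \<in> vector_fields A"
  shows "D (X - Y) Z = D X Z - D Y Z"
proof -
  have "D ((X - Y) + Y) Z = D (X - Y) Z + D Y Z"
    by (rule D_add_left[OF vector_field_diff[OF atlas X Y] Y Z])
  then show ?thesis by (simp only: diff_add_cancel eq_diff_eq)
qed

section \<open>Tensoriality of the curvature\<close>

definition curv :: "'g vfield \<Rightarrow> 'g vfield \<Rightarrow> 'g vfield \<Rightarrow> 'g vfield" where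
  "curv X Y U = D X (D Y U) - D Y (D X U) - D (bracket A X Y) U"

lemma curvature_curv: "curvature A g X Y U V p = g p (curv X Y U p) (V p)"
  by (simp only: curvature_def curv_def Let_def)

lemma curv_field:
  "X \<in> vector_fields A \<Longrightarrow> Y \<in> vector_fields A \<Longrightarrow> U \<in> vector_fields A \<Longrightarrow> curv X Y U \<in> vector_fields A"
  unfolding curv_def by (intro vector_field_diff[OF atlas] D_in bracket_field)

lemma curv_apply: "curv X Y U p = D X (D Y U) p - D Y (D X U) p - D (bracket A X Y) U p"
  by (simp only: curv_def minus_apply)

lemma bracket_add_left:
  assumes X: "X \<in> vector_fields A" and Y: "Y \<in> vector_fields A" and Z: "Z \<in> vector_fields A"
  shows "bracket A (X + Y) Z = bracket A X Z + bracket A Y Z"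
  unfolding bracket_D[OF vector_field_add[OF atlas X Y] Z Z] bracket_D[OF X Z Z] bracket_D[OF Y Z Z]
    D_add_left[OF X Y Z] D_add_right[OF Z X Y]
  by (rule add_diff_add)

lemma curv_swap:
  assumes X: "X \<in> vector_fields A" and Y: "Y \<in> vector_fields A" and U: "U \<in> vector_fields A"
  shows "curv Y X U = - curv X Y U"
proof -
  note B = bracket_field[OF X Y]
  have "D (0 - bracket A X Y) U = D 0 U - D (bracket A X Y) U"
    by (rule D_diff_left[OF vector_field_zero[OF atlas] B U])
  \<comment> \<open>This instance of additivity yields \<open>D 0 U = 0\<close>.\<close>
  moreover have "D (0 - 0) U = D 0 U - D 0 U"
    by (rule D_diff_left[OF vector_field_zero[OF atlas] vector_field_zero[OF atlas] U])
  ultimately have "D (bracket A Y X) U = - D (bracket A X Y) U"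
    unfolding bracket_antisym[of A Y X] by (simp only: diff_0 diff_self)
  then show ?thesis unfolding curv_def by (simp only: minus_diff_eq diff_minus_eq_add) (simp only: algebra_simps)
qed

lemma curv_add:
  assumes X: "X \<in> vector_fields A" and Y: "Y \<in> vector_fields A" and Z: "Z \<in> vector_fields A"
    and U: "U \<in> vector_fields A"
  shows "curv (X + Y) Z U = curv X Z U + curv Y Z U" "curv X Z (Y + U) = curv X Z Y + curv X Z U"
  unfolding curv_def bracket_add_left[OF X Y Z] D_add_left[OF X Y U] D_add_left[OF X Y D_in[OF Z U]]
    D_add_right[OF Z D_in[OF X U] D_in[OF Y U]] D_add_left[OF bracket_field[OF X Z] bracket_field[OF Y Z] U]
    D_add_right[OF Z Y U] D_add_right[OF X Y U] D_add_right[OF bracket_field[OF X Z] Y U]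
    D_add_right[OF Z D_in[OF X Y] D_in[OF X U]] D_add_right[OF X D_in[OF Z Y] D_in[OF Z U]]
  by (simp_all only: add_diff_add)

text \<open>\<open>[h X, Y] = h [X, Y] - (Y h) X\<close>, and the correction term cancels the
  Leibniz term that arises from differentiating \<open>h D X U\<close> along
  \<open>Y\<close>.\<close>

lemma curv_scale_left:
  assumes X: "X \<in> vector_fields A" and Y: "Y \<in> vector_fields A" and U: "U \<in> vector_fields A"
    and h: "smooth_fun A UNIV h"
  shows "curv (\<lambda>p. h p *\<^sub>R X p) Y U p = h p *\<^sub>R curv X Y U p"
proof -
  note B = bracket_field[OF X Y]
  have h': "smooth_fun A UNIV (\<lambda>p. Y p h)" by (rule vector_fieldD(2)[OF Y open_UNIV h])
  note hX = vector_field_scale[OF atlas X h] and hB = vector_field_scale[OF atlas B h]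
    and YhX = vector_field_scale[OF atlas X h']
  have "bracket A (\<lambda>p. h p *\<^sub>R X p) Y = (\<lambda>p. h p *\<^sub>R bracket A X Y p) - (\<lambda>p. Y p h *\<^sub>R X p)"
    unfolding bracket_D[OF hX Y Y] bracket_D[OF X Y Y] D_scale_left[OF X X Y h] D_leibniz[OF Y X X h]
    by (rule ext) (simp only: minus_apply scaleR_right_diff_distrib diff_diff_eq add.commute)
  then have "D (bracket A (\<lambda>p. h p *\<^sub>R X p) Y) U =
      (\<lambda>p. h p *\<^sub>R D (bracket A X Y) U p) - (\<lambda>p. Y p h *\<^sub>R D X U p)"
    by (simp only: D_diff_left[OF hB YhX U] D_scale_left[OF B B U h] D_scale_left[OF X X U h'])
  then show ?thesis
    unfolding curv_apply D_scale_left[OF X X U h] D_scale_left[OF X X D_in[OF Y U] h]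
      D_leibniz[OF Y D_in[OF X U] U h]
    by (simp only: minus_apply scaleR_right_diff_distrib) (simp only: algebra_simps)
qed

text \<open>The terms containing first derivatives of \<open>h\<close> and derivatives of
  \<open>U\<close> cancel in pairs, and what multiplies \<open>U\<close> is
  \<open>X (Y h) - Y (X h) - [X, Y] h = 0\<close>.\<close>

lemma curv_scale_right:
  assumes X: "X \<in> vector_fields A" and Y: "Y \<in> vector_fields A" and U: "U \<in> vector_fields A"
    and h: "smooth_fun A UNIV h"
  shows "curv X Y (\<lambda>p. h p *\<^sub>R U p) p = h p *\<^sub>R curv X Y U p"
proof -
  note B = bracket_field[OF X Y]
  have Xh: "smooth_fun A UNIV (\<lambda>p. X p h)" and Yh: "smooth_fun A UNIV (\<lambda>p. Y p h)"
    using vector_fieldD(2)[OF X open_UNIV h] vector_fieldD(2)[OF Y open_UNIV h] .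
  have second: "D X (D Y (\<lambda>p. h p *\<^sub>R U p)) p =
      X p (\<lambda>q. Y q h) *\<^sub>R U p + Y p h *\<^sub>R D X U p + (X p h *\<^sub>R D Y U p + h p *\<^sub>R D X (D Y U) p)"
    if X: "X \<in> vector_fields A" and Y: "Y \<in> vector_fields A" and Yh: "smooth_fun A UNIV (\<lambda>p. Y p h)" for X Y
  proof -
    have "D Y (\<lambda>p. h p *\<^sub>R U p) = (\<lambda>p. Y p h *\<^sub>R U p) + (\<lambda>p. h p *\<^sub>R D Y U p)"
      unfolding D_leibniz[OF Y U U h] by (simp only: plus_fun_def)
    then have "D X (D Y (\<lambda>p. h p *\<^sub>R U p)) = D X (\<lambda>p. Y p h *\<^sub>R U p) + D X (\<lambda>p. h p *\<^sub>R D Y U p)"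
      by (simp only: D_add_right[OF X vector_field_scale[OF atlas U Yh] vector_field_scale[OF atlas D_in[OF Y U] h]])
    then show ?thesis
      unfolding D_leibniz[OF X U U Yh] D_leibniz[OF X D_in[OF Y U] U h] by (simp only: plus_fun_apply)
  qed
  have "smooth_near A p h" using h smooth_nearI[of A UNIV] by blast
  note br = bracket_apply[OF this, of X Y]
  show ?thesis
    unfolding curv_apply second[OF X Y Yh] second[OF Y X Xh] D_leibniz[OF B U U h] br
    by (simp only: scaleR_right_diff_distrib scaleR_left_diff_distrib) (simp only: algebra_simps)
qed

definition tensorial_at :: "'g \<Rightarrow> ('g vfield \<Rightarrow> real) \<Rightarrow> bool" where
  "tensorial_at p T \<longleftrightarrow> (\<forall>X\<in>vector_fields A. \<forall>Y\<in>vector_fields A. T (X + Y) = T X + T Y) \<and>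
     (\<forall>X\<in>vector_fields A. \<forall>h. smooth_fun A UNIV h \<longrightarrow> T (\<lambda>q. h q *\<^sub>R X q) = h p * T X)"

text \<open>\<open>X\<close> is globally a combination of frame fields with smooth coefficients, so
  homogeneity over smooth functions shows that only the value of \<open>X\<close> at
  \<open>p\<close> matters.\<close>

lemma tensorial_expand:
  assumes T: "tensorial_at p T" and X: "X \<in> vector_fields A"
  shows "T X = (\<Sum>i<n. comp X i p * T (E i))"
proof -
  have add: "T (X + Y) = T X + T Y" if "X \<in> vector_fields A" "Y \<in> vector_fields A" for X Y
    using T that unfolding tensorial_at_def by blast
  have scale: "T (\<lambda>q. h q *\<^sub>R X q) = h p * T X" if "X \<in> vector_fields A" "smooth_fun A UNIV h" for X h
    using T that unfolding tensorial_at_def by blast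
  let ?F = "\<lambda>i q. comp X i q *\<^sub>R E i q"
  have F: "?F i \<in> vector_fields A" if "i < n" for i
    by (intro vector_field_scale[OF atlas] E_field comp_smooth X that)
  have "T 0 = 0" using add[OF vector_field_zero[OF atlas] vector_field_zero[OF atlas]] by simp
  then have "I \<subseteq> {..<n} \<Longrightarrow> T (\<Sum>i\<in>I. ?F i) = (\<Sum>i\<in>I. T (?F i))" for I
  proof (induction I rule: infinite_finite_induct)
    case (insert i I)
    have "T (?F i + (\<Sum>i\<in>I. ?F i)) = T (?F i) + T (\<Sum>i\<in>I. ?F i)"
      by (intro add vector_field_sum[OF atlas] F) (use insert.prems in auto)
    with insert show ?case by (simp only: sum.insert[OF insert.hyps] insert_subset simp_thms)
  qed (simp_all only: sum.infinite sum.empty not_False_eq_True)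
  from this[of "{..<n}"] have "T (\<Sum>i<n. ?F i) = (\<Sum>i<n. T (?F i))" by blast
  moreover have "(\<Sum>i<n. ?F i) = X"
    by (rule ext, subst sum_fun_apply, rule field_expansion[OF X, symmetric])
  moreover have "T (?F i) = comp X i p * T (E i)" if "i < n" for i
    by (rule scale[OF E_field[OF that] comp_smooth[OF X that]])
  ultimately show ?thesis by simp
qed

text \<open>The first and third slots are direct; the second is reduced to the first by
  skew-symmetry, and the fourth is the metric's own linearity after exchanging its
  arguments.\<close>

lemma tensorial_curvature:
  assumes X: "X \<in> vector_fields A" and Y: "Y \<in> vector_fields A" and U: "U \<in> vector_fields A"
    and V: "V \<in> vector_fields A"
  shows "tensorial_at p (\<lambda>X. curvature A g X Y U V p)" "tensorial_at p (\<lambda>Y. curvature A g X Y U V p)"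
    "tensorial_at p (\<lambda>U. curvature A g X Y U V p)" "tensorial_at p (\<lambda>V. curvature A g X Y U V p)"
proof -
  note gt = metric_tangent[OF atlas metric vector_fieldD(1) vector_fieldD(1) vector_fieldD(1)]
  have 1: "tensorial_at p (\<lambda>X. curvature A g X Y U V p)" if Y: "Y \<in> vector_fields A" for Y
    unfolding tensorial_at_def curvature_curv
    using gt(1)[OF curv_field[OF _ Y U] curv_field[OF _ Y U] V, of _ _ p]
      gt(2)[OF curv_field[OF _ Y U] V V, of _ p]
    by (auto simp only: curv_add(1)[OF _ _ Y U] plus_fun_apply curv_scale_left[OF _ Y U])
  have swap: "curvature A g X Y U V p = - curvature A g Y X U V p" if Y: "Y \<in> vector_fields A" for Y
    using gt(2)[OF curv_field[OF Y X U] V V, of p "-1"]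
    by (simp only: curvature_curv curv_swap[OF Y X U] fun_Compl_def scaleR_minus1_left mult_minus1)
  show "tensorial_at p (\<lambda>X. curvature A g X Y U V p)" by (rule 1[OF Y])
  show "tensorial_at p (\<lambda>Y. curvature A g X Y U V p)"
    unfolding tensorial_at_def
  proof (intro conjI ballI allI impI)
    fix Y Z h assume Y: "Y \<in> vector_fields A"
    show "curvature A g X (Y + Z) U V p = curvature A g X Y U V p + curvature A g X Z U V p"
      if Z: "Z \<in> vector_fields A"
      using 1[OF X] Y Z
      unfolding swap[OF vector_field_add[OF atlas Y Z]] swap[OF Y] swap[OF Z] tensorial_at_def by simp
    show "curvature A g X (\<lambda>q. h q *\<^sub>R Y q) U V p = h p * curvature A g X Y U V p"
      if h: "smooth_fun A UNIV h"
      using 1[OF X] Y h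
      unfolding swap[OF vector_field_scale[OF atlas Y h]] swap[OF Y] tensorial_at_def by simp
  qed
  show "tensorial_at p (\<lambda>U. curvature A g X Y U V p)"
    unfolding tensorial_at_def curvature_curv
    using gt(1)[OF curv_field[OF X Y] curv_field[OF X Y] V, of _ _ p]
      gt(2)[OF curv_field[OF X Y] V V, of _ p]
    by (auto simp only: curv_add(2)[OF X _ Y] plus_fun_apply curv_scale_right[OF X Y])
  have sym: "curvature A g X Y U V p = g p (V p) (curv X Y U p)" if V: "V \<in> vector_fields A" for V
    unfolding curvature_curv by (rule gt(3)[OF curv_field[OF X Y U] V V])
  show "tensorial_at p (\<lambda>V. curvature A g X Y U V p)"
    unfolding tensorial_at_def
  proof (intro conjI ballI allI impI)
    fix V W h assume V: "V \<in> vector_fields A"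
    show "curvature A g X Y U (V + W) p = curvature A g X Y U V p + curvature A g X Y U W p"
      if W: "W \<in> vector_fields A"
      unfolding sym[OF vector_field_add[OF atlas V W]] sym[OF V] sym[OF W]
      using gt(1)[OF V W curv_field[OF X Y U]] by (simp only: plus_fun_apply)
    show "curvature A g X Y U (\<lambda>q. h q *\<^sub>R V q) p = h p * curvature A g X Y U V p"
      if h: "smooth_fun A UNIV h"
      unfolding sym[OF vector_field_scale[OF atlas V h]] sym[OF V]
      by (rule gt(2)[OF V V curv_field[OF X Y U]])
  qed
qed

abbreviation Rm :: "nat \<Rightarrow> nat \<Rightarrow> nat \<Rightarrow> nat \<Rightarrow> real" where "Rm \<equiv> frame_curvature n c \<Gamma>"

text \<open>Constant components have no derivative, so only the terms with \<open>\<Gamma>\<close>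
  survive. Covariant derivatives and brackets of frame fields again have constant components, which
  allows iteration.\<close>

lemma comp_D_constant:
  assumes X: "X \<in> vector_fields A" and Y: "Y \<in> vector_fields A" and k: "k < n"
    and x: "\<And>i p. i < n \<Longrightarrow> comp X i p = x i" and y: "\<And>i p. i < n \<Longrightarrow> comp Y i p = y i"
  shows "comp (D X Y) k p = (\<Sum>i<n. \<Sum>j<n. \<Gamma> i j k * x i * y j)"
proof -
  have "comp Y k = (\<lambda>_. y k)" using y[OF k] by (rule ext)
  then have "X p (comp Y k) = 0"
    using field_derivation(3)[OF X smooth_near_const[OF atlas] smooth_near_const[OF atlas]] by simp
  then show ?thesis
    unfolding D_conn[OF X Y] comp_conn[OF k] conn_comp_def using x y by simp
qed

lemma sum_delta_mult:
  "i < n \<Longrightarrow> (\<Sum>m<n. f m * (if i = m then 1 else 0)) = (f i :: real)"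
  "i < n \<Longrightarrow> (\<Sum>m<n. (if i = m then 1 else 0) * f m) = (f i :: real)"
  by (simp_all add: if_distrib[of "\<lambda>x. _ * x"] if_distrib[of "\<lambda>x. x * _"] cong: if_cong)

lemma curvature_frame:
  assumes i: "i < n" and j: "j < n" and k: "k < n" and l: "l < n"
  shows "curvature A g (E i) (E j) (E k) (E l) p = Rm i j k l"
proof -
  have DE: "comp (D (E i) (E j)) k p = \<Gamma> i j k" if i: "i < n" and j: "j < n" and k: "k < n" for i j k p
  proof -
    have "comp (D (E i) (E j)) k p =
        (\<Sum>a<n. \<Sum>b<n. \<Gamma> a b k * (if i = a then 1 else 0) * (if j = b then 1 else 0))"
      by (rule comp_D_constant[OF E_field[OF i] E_field[OF j] k comp_frame[OF i] comp_frame[OF j]])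
    then show ?thesis by (simp add: sum_delta_mult i j)
  qed
  have DE2: "comp (D (E i) (D (E j) (E k))) l p = (\<Sum>m<n. \<Gamma> i m l * \<Gamma> j k m)"
    if i: "i < n" and j: "j < n" and k: "k < n" and l: "l < n" for i j k l
  proof -
    have "comp (D (E i) (D (E j) (E k))) l p =
        (\<Sum>a<n. \<Sum>m<n. \<Gamma> a m l * (if i = a then 1 else 0) * \<Gamma> j k m)"
      by (rule comp_D_constant[OF E_field[OF i] D_in[OF E_field[OF j] E_field[OF k]] l comp_frame[OF i] DE[OF j k]])
    also have "\<dots> = (\<Sum>m<n. \<Sum>a<n. (\<Gamma> a m l * \<Gamma> j k m) * (if i = a then 1 else 0))"
      by (subst sum.swap) (simp add: mult_ac)
    finally show ?thesis by (simp add: sum_delta_mult i)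
  qed
  have br: "comp (bracket A (E i) (E j)) m p = c i j m" if m: "m < n" for m p
    unfolding bracket_D[OF E_field[OF i] E_field[OF j] E_field[OF j]]
      comp_linear(2)[OF D_in[OF E_field[OF i] E_field[OF j]] D_in[OF E_field[OF j] E_field[OF i]] m]
    using DE[OF i j m, of p] DE[OF j i m, of p] \<Gamma>_torsion[OF i j m] by simp
  have "comp (D (bracket A (E i) (E j)) (E k)) l p = (\<Sum>m<n. \<Sum>b<n. \<Gamma> m b l * c i j m * (if k = b then 1 else 0))"
    by (rule comp_D_constant[OF bracket_field[OF E_field[OF i] E_field[OF j]] E_field[OF k] l br comp_frame[OF k]])
  then have 3: "comp (D (bracket A (E i) (E j)) (E k)) l p = (\<Sum>m<n. \<Gamma> m k l * c i j m)"
    by (simp add: sum_delta_mult k)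
  have "curvature A g (E i) (E j) (E k) (E l) p = comp (curv (E i) (E j) (E k)) l p"
    by (simp only: curvature_curv comp_def)
  also have "\<dots> = comp (D (E i) (D (E j) (E k))) l p - comp (D (E j) (D (E i) (E k))) l p -
      comp (D (bracket A (E i) (E j)) (E k)) l p"
    unfolding curv_def
    by (simp only: comp_linear(2)[OF _ _ l] vector_field_diff[OF atlas] D_in bracket_field E_field i j k)
  also have "\<dots> = Rm i j k l"
    unfolding DE2[OF i j k l] DE2[OF j i k l] 3 by (simp add: frame_curvature_def sum_subtractf mult_ac)
  finally show ?thesis .
qed

end

section \<open>Contractions and orthonormal bases\<close>

text \<open>With \<open>P\<close> the Gram matrix of the columns, \<open>\<parallel>P - I\<parallel>\<^sup>2 = tr P\<^sup>2 - 2 tr P + n = 0\<close>.\<close>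

lemma orthonormal_rows_imp_columns:
  fixes O' :: "nat \<Rightarrow> nat \<Rightarrow> real"
  assumes rows: "\<And>a b. a < n \<Longrightarrow> b < n \<Longrightarrow> (\<Sum>k<n. O' a k * O' b k) = (if a = b then 1 else 0)"
    and k: "k < n" and l: "l < n"
  shows "(\<Sum>a<n. O' a k * O' a l) = (if k = l then 1 else 0)"
proof -
  define P where "P k l = (\<Sum>a<n. O' a k * O' a l)" for k l
  define \<delta> :: "nat \<Rightarrow> nat \<Rightarrow> real" where "\<delta> k l = (if k = l then 1 else 0)" for k l
  \<comment> \<open>Reordering the fourfold sum turns the squared norm of the Gram matrix of the
    columns into that of the rows, which is the identity.\<close>
  have P2: "(\<Sum>k<n. \<Sum>l<n. P k l * P k l) = real n"
  proof -
    have "(\<Sum>k<n. \<Sum>l<n. P k l * P k l) =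
        (\<Sum>k<n. \<Sum>l<n. \<Sum>a<n. \<Sum>b<n. (O' a k * O' b k) * (O' a l * O' b l))"
      by (simp add: P_def sum_product mult_ac)
    also have "\<dots> = (\<Sum>a<n. \<Sum>k<n. \<Sum>l<n. \<Sum>b<n. (O' a k * O' b k) * (O' a l * O' b l))"
      by (rule sum_rotate)
    also have "\<dots> = (\<Sum>a<n. \<Sum>b<n. \<Sum>k<n. \<Sum>l<n. (O' a k * O' b k) * (O' a l * O' b l))"
      by (rule sum.cong[OF refl], rule sum_rotate)
    also have "\<dots> = (\<Sum>a<n. \<Sum>b<n. (\<Sum>k<n. O' a k * O' b k) * (\<Sum>l<n. O' a l * O' b l))"
      by (simp only: sum_product)
    also have "\<dots> = (\<Sum>a<n. \<Sum>b<n. if a = b then 1 else 0)"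
      by (intro sum.cong refl) (simp add: rows)
    finally show ?thesis by simp
  qed
  have P1: "(\<Sum>k<n. \<Sum>l<n. P k l * \<delta> k l) = real n"
  proof -
    have "(\<Sum>k<n. \<Sum>l<n. P k l * \<delta> k l) = (\<Sum>k<n. P k k)"
      by (intro sum.cong refl) (simp add: \<delta>_def if_distrib[of "\<lambda>x. _ * x"] cong: if_cong)
    also have "\<dots> = (\<Sum>a<n. \<Sum>k<n. O' a k * O' a k)"
      unfolding P_def by (rule sum.swap)
    finally show ?thesis by (simp add: rows)
  qed
  have P0: "(\<Sum>k<n. \<Sum>l<n. \<delta> k l * \<delta> k l) = real n"
    by (simp add: \<delta>_def if_distrib[of "\<lambda>x. _ * x"] cong: if_cong)
  have "(\<Sum>k<n. \<Sum>l<n. (P k l - \<delta> k l)\<^sup>2) =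
      (\<Sum>k<n. \<Sum>l<n. P k l * P k l) - 2 * (\<Sum>k<n. \<Sum>l<n. P k l * \<delta> k l) + (\<Sum>k<n. \<Sum>l<n. \<delta> k l * \<delta> k l)"
    by (simp add: power2_eq_square algebra_simps sum.distrib sum_subtractf sum_distrib_left)
  also have "\<dots> = 0" unfolding P2 P1 P0 by simp
  finally have "(\<Sum>l<n. (P k l - \<delta> k l)\<^sup>2) = 0"
    using k by (simp add: sum_nonneg_eq_0_iff sum_nonneg)
  then have "P k l - \<delta> k l = 0" using l by (simp add: sum_nonneg_eq_0_iff)
  then show ?thesis by (simp add: P_def \<delta>_def)
qed

definition contract3 :: "nat \<Rightarrow> (nat \<Rightarrow> nat \<Rightarrow> nat \<Rightarrow> nat \<Rightarrow> real) \<Rightarrow> nat \<Rightarrow> nat \<Rightarrow> real" where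
  "contract3 n R i j = (\<Sum>a<n. \<Sum>b<n. \<Sum>c<n. R i a b c * R j a b c)"

section \<open>Independence of contractions from the orthonormal fields\<close>

context homogeneous_frame
begin

lemma orthonormal_frame: "orthonormal_at A g p E"
  unfolding orthonormal_at_def n_def[symmetric] by (simp add: E_field orthonormal)

text \<open>The components at \<open>p\<close> of fields orthonormal at \<open>p\<close> form a
  matrix with orthonormal rows. Its columns are then orthonormal too, and this collapses the double
  sum over frame indices.\<close>

lemma tensorial_contract:
  assumes F: "orthonormal_at A g p F" and T: "tensorial_at p T" and T': "tensorial_at p T'"
  shows "(\<Sum>a<n. T (F a) * T' (F a)) = (\<Sum>k<n. T (E k) * T' (E k))"
proof -
  have Ff: "F a \<in> vector_fields A" if "a < n" for a
    using F that unfolding orthonormal_at_def n_def[symmetric] by blast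
  have "(\<Sum>k<n. comp (F a) k p * comp (F b) k p) = (if a = b then 1 else 0)" if "a < n" "b < n" for a b
    using F that unfolding orthonormal_at_def n_def[symmetric]
    by (simp add: inner_comps[OF Ff Ff, symmetric])
  note cols = orthonormal_rows_imp_columns[of n "\<lambda>a k. comp (F a) k p", OF this]
  have "(\<Sum>a<n. T (F a) * T' (F a)) =
      (\<Sum>a<n. (\<Sum>k<n. comp (F a) k p * T (E k)) * (\<Sum>l<n. comp (F a) l p * T' (E l)))"
    by (intro sum.cong refl arg_cong2[where f = "(*)"] tensorial_expand T T' Ff) simp_all
  also have "\<dots> = (\<Sum>a<n. \<Sum>k<n. \<Sum>l<n. (comp (F a) k p * comp (F a) l p) * (T (E k) * T' (E l)))"
    by (simp add: sum_product mult_ac)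
  also have "\<dots> = (\<Sum>k<n. \<Sum>l<n. (\<Sum>a<n. comp (F a) k p * comp (F a) l p) * (T (E k) * T' (E l)))"
    unfolding sum_distrib_right by (rule sum_rotate[symmetric])
  also have "\<dots> = (\<Sum>k<n. \<Sum>l<n. (if k = l then 1 else 0) * (T (E k) * T' (E l)))"
    by (intro sum.cong refl) (simp add: cols)
  also have "\<dots> = (\<Sum>k<n. T (E k) * T' (E k))"
    by (intro sum.cong refl) (simp add: sum_delta_mult(2))
  finally show ?thesis .
qed

text \<open>One slot is exchanged at a time, with its sum moved innermost; the other slots are then
  parameters of two tensors in a single argument.\<close>

lemma R_check_frame_independent:
  assumes F: "orthonormal_at A g p F" and X: "X \<in> vector_fields A" and Y: "Y \<in> vector_fields A"
  shows "R_check A g F X Y p = R_check A g E X Y p"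
proof -
  have Ff: "F a \<in> vector_fields A" if "a < n" for a
    using F that unfolding orthonormal_at_def n_def[symmetric] by blast
  have "R_check A g F X Y p = (\<Sum>a<n. \<Sum>b<n. \<Sum>c<n.
      curvature A g X (F a) (F b) (E c) p * curvature A g Y (F a) (F b) (E c) p)"
    unfolding R_check_def n_def[symmetric]
    by (intro sum.cong refl tensorial_contract[OF F] tensorial_curvature(4)[where V = X]) (auto intro: Ff X Y)
  also have "\<dots> = (\<Sum>a<n. \<Sum>c<n. \<Sum>b<n.
      curvature A g X (F a) (F b) (E c) p * curvature A g Y (F a) (F b) (E c) p)"
    by (rule sum.cong[OF refl], rule sum.swap)
  also have "\<dots> = (\<Sum>a<n. \<Sum>c<n. \<Sum>b<n.
      curvature A g X (F a) (E b) (E c) p * curvature A g Y (F a) (E b) (E c) p)"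
    by (intro sum.cong refl tensorial_contract[OF F] tensorial_curvature(3)[where U = X]) (auto intro: Ff X Y E_field)
  also have "\<dots> = (\<Sum>c<n. \<Sum>b<n. \<Sum>a<n.
      curvature A g X (F a) (E b) (E c) p * curvature A g Y (F a) (E b) (E c) p)"
    by (rule sum_rotate[symmetric])
  also have "\<dots> = (\<Sum>c<n. \<Sum>b<n. \<Sum>a<n.
      curvature A g X (E a) (E b) (E c) p * curvature A g Y (E a) (E b) (E c) p)"
    by (intro sum.cong refl tensorial_contract[OF F] tensorial_curvature(2)[where Y = X]) (auto intro: Ff X Y E_field)
  also have "\<dots> = (\<Sum>a<n. \<Sum>c<n. \<Sum>b<n.
      curvature A g X (E a) (E b) (E c) p * curvature A g Y (E a) (E b) (E c) p)"
    by (rule sum_rotate)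
  also have "\<dots> = R_check A g E X Y p"
    unfolding R_check_def n_def[symmetric] by (rule sum.cong[OF refl], rule sum.swap)
  finally show ?thesis .
qed

abbreviation Rc :: "nat \<Rightarrow> nat \<Rightarrow> real" where "Rc \<equiv> contract3 n Rm"

lemma R_check_frame: "i < n \<Longrightarrow> j < n \<Longrightarrow> R_check A g E (E i) (E j) p = Rc i j"
  unfolding R_check_def n_def[symmetric] contract3_def by (simp add: curvature_frame)

lemma R_check_expand:
  assumes X: "X \<in> vector_fields A" and Y: "Y \<in> vector_fields A"
  shows "R_check A g E X Y p = (\<Sum>i<n. \<Sum>j<n. comp X i p * comp Y j p * Rc i j)"
proof -
  have *: "curvature A g X (E a) (E b) (E c) p = (\<Sum>i<n. comp X i p * Rm i a b c)"
    if "a < n" "b < n" "c < n" "X \<in> vector_fields A" for a b c X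
    using tensorial_expand[OF tensorial_curvature(1)[OF that(4) E_field[OF that(1)] E_field[OF that(2)]
        E_field[OF that(3)]] that(4)] that
    by (simp add: curvature_frame)
  have "R_check A g E X Y p = (\<Sum>a<n. \<Sum>b<n. \<Sum>c<n. \<Sum>i<n. \<Sum>j<n.
      comp X i p * comp Y j p * (Rm i a b c * Rm j a b c))"
    unfolding R_check_def n_def[symmetric] by (simp add: * X Y sum_product mult_ac)
  also have "\<dots> = (\<Sum>a<n. \<Sum>i<n. \<Sum>b<n. \<Sum>c<n. \<Sum>j<n.
      comp X i p * comp Y j p * (Rm i a b c * Rm j a b c))"
    by (rule sum.cong[OF refl], rule sum_rotate)
  also have "\<dots> = (\<Sum>i<n. \<Sum>a<n. \<Sum>b<n. \<Sum>c<n. \<Sum>j<n.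
      comp X i p * comp Y j p * (Rm i a b c * Rm j a b c))"
    by (rule sum.swap)
  also have "\<dots> = (\<Sum>i<n. \<Sum>a<n. \<Sum>j<n. \<Sum>b<n. \<Sum>c<n.
      comp X i p * comp Y j p * (Rm i a b c * Rm j a b c))"
    by (rule sum.cong[OF refl], rule sum.cong[OF refl], rule sum_rotate)
  also have "\<dots> = (\<Sum>i<n. \<Sum>j<n. \<Sum>a<n. \<Sum>b<n. \<Sum>c<n.
      comp X i p * comp Y j p * (Rm i a b c * Rm j a b c))"
    by (rule sum.cong[OF refl], rule sum.swap)
  finally show ?thesis unfolding contract3_def by (simp only: sum_distrib_left)
qed

lemma R_norm_sq_frame:
  assumes F: "orthonormal_at A g p F"
  shows "R_norm_sq A g F p = (\<Sum>i<n. Rc i i)"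
proof -
  have Ff: "F a \<in> vector_fields A" if "a < n" for a
    using F that unfolding orthonormal_at_def n_def[symmetric] by blast
  have "R_norm_sq A g F p = (\<Sum>i<n. R_check A g F (F i) (F i) p)"
    unfolding R_norm_sq_def R_check_def n_def[symmetric] by (simp only: power2_eq_square)
  also have "\<dots> = (\<Sum>i<n. R_check A g E (F i) (F i) p)"
    by (simp add: R_check_frame_independent[OF F Ff Ff])
  also have "\<dots> = (\<Sum>i<n. \<Sum>a<n. \<Sum>b<n. \<Sum>c<n.
      curvature A g (F i) (E a) (E b) (E c) p * curvature A g (F i) (E a) (E b) (E c) p)"
    unfolding R_check_def n_def[symmetric] ..
  also have "\<dots> = (\<Sum>a<n. \<Sum>b<n. \<Sum>c<n. \<Sum>i<n.
      curvature A g (F i) (E a) (E b) (E c) p * curvature A g (F i) (E a) (E b) (E c) p)"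
    by (subst sum.swap, rule sum.cong[OF refl], rule sum_rotate[symmetric])
  also have "\<dots> = (\<Sum>a<n. \<Sum>b<n. \<Sum>c<n. \<Sum>i<n.
      curvature A g (E i) (E a) (E b) (E c) p * curvature A g (E i) (E a) (E b) (E c) p)"
    by (intro sum.cong refl tensorial_contract[OF F] tensorial_curvature(1)) (auto intro: E_field)
  also have "\<dots> = (\<Sum>i<n. \<Sum>a<n. \<Sum>b<n. \<Sum>c<n.
      curvature A g (E i) (E a) (E b) (E c) p * curvature A g (E i) (E a) (E b) (E c) p)"
    by (subst (5) sum.swap, rule sum.cong[OF refl], rule sum_rotate)
  also have "\<dots> = (\<Sum>i<n. Rc i i)"
    unfolding contract3_def by (simp add: curvature_frame)
  finally show ?thesis .
qed

text \<open>Homogeneity reduces a condition on all points and all fields orthonormal there to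
  finitely many equations between constants.\<close>

lemma weakly_einstein_iff:
  "weakly_einstein A g \<longleftrightarrow>
    (\<forall>i<n. \<forall>j<n. Rc i j = (if i = j then (\<Sum>k<n. Rc k k) / real n else 0))"
proof
  assume W: "weakly_einstein A g"
  have *: "R_check A g E (E i) (E j) p = R_norm_sq A g E p / real n * g p (E i p) (E j p)"
    if "i < n" "j < n" for i j p
    using W orthonormal_frame E_field that unfolding weakly_einstein_def n_def[symmetric] by blast
  show "\<forall>i<n. \<forall>j<n. Rc i j = (if i = j then (\<Sum>k<n. Rc k k) / real n else 0)"
  proof (intro allI impI)
    fix i j assume ij: "i < n" "j < n"
    show "Rc i j = (if i = j then (\<Sum>k<n. Rc k k) / real n else 0)"
      \<comment> \<open>Any point will do, as both sides are constant.\<close>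
      using *[OF ij, of undefined]
      unfolding R_check_frame[OF ij] R_norm_sq_frame[OF orthonormal_frame] orthonormal[OF ij] by simp
  qed
next
  assume R: "\<forall>i<n. \<forall>j<n. Rc i j = (if i = j then (\<Sum>k<n. Rc k k) / real n else 0)"
  define s where "s = (\<Sum>k<n. Rc k k) / real n"
  have Rs: "Rc i j = (if i = j then s else 0)" if "i < n" "j < n" for i j
    using R that unfolding s_def by blast
  show "weakly_einstein A g"
    unfolding weakly_einstein_def n_def[symmetric]
  proof (intro allI impI ballI)
    fix p F X Y
    assume F: "orthonormal_at A g p F" and X: "X \<in> vector_fields A" and Y: "Y \<in> vector_fields A"
    have "R_check A g F X Y p = (\<Sum>i<n. \<Sum>j<n. comp X i p * comp Y j p * Rc i j)"
      unfolding R_check_frame_independent[OF F X Y] by (rule R_check_expand[OF X Y])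
    also have "\<dots> = (\<Sum>i<n. \<Sum>j<n. (s * (comp X i p * comp Y j p)) * (if i = j then 1 else 0))"
      by (intro sum.cong refl) (simp add: Rs)
    also have "\<dots> = (\<Sum>i<n. s * (comp X i p * comp Y i p))"
      by (intro sum.cong refl) (simp add: sum_delta_mult(1))
    also have "\<dots> = s * g p (X p) (Y p)"
      unfolding inner_comps[OF X Y] by (simp only: sum_distrib_left)
    finally show "R_check A g F X Y p = R_norm_sq A g F p / real n * g p (X p) (Y p)"
      by (simp only: s_def R_norm_sq_frame[OF F])
  qed
qed

text \<open>A necessary condition is enough for the claim about Einstein metrics, so the definition
  is evaluated on the frame at one arbitrary point.\<close>

lemma einstein_frame:
  assumes "einstein A g"
  obtains s where "\<And>i j. i < n \<Longrightarrow> j < n \<Longrightarrow> (\<Sum>a<n. Rm a i j a) = (if i = j then s else 0)"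
proof -
  obtain s where s: "\<forall>p E. orthonormal_at A g p E \<longrightarrow>
      (\<forall>X\<in>vector_fields A. \<forall>Y\<in>vector_fields A. ricci A g E X Y p = s * g p (X p) (Y p))"
    using assms unfolding einstein_def by blast
  have "(\<Sum>a<n. Rm a i j a) = (if i = j then s else 0)" if "i < n" "j < n" for i j
  proof -
    have "ricci A g E (E i) (E j) undefined = s * g undefined (E i undefined) (E j undefined)"
      using s orthonormal_frame E_field that by blast
    then show ?thesis
      using that by (simp add: ricci_def n_def[symmetric] curvature_frame orthonormal split: if_splits)
  qed
  then show ?thesis by (rule that)
qed

end

section \<open>Orthonormal families in a subspace with an inner product\<close>

definition inner_on :: "'v::real_vector set \<Rightarrow> ('v \<Rightarrow> 'v \<Rightarrow> real) \<Rightarrow> bool" where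
  "inner_on L ip \<longleftrightarrow> subspace L \<and>
     (\<forall>u\<in>L. \<forall>v\<in>L. \<forall>w\<in>L. \<forall>c. ip (u + v) w = ip u w + ip v w \<and> ip (c *\<^sub>R u) w = c * ip u w \<and>
        ip u v = ip v u \<and> (u \<noteq> 0 \<longrightarrow> 0 < ip u u))"

definition orthonormal_family :: "'v::real_vector set \<Rightarrow> ('v \<Rightarrow> 'v \<Rightarrow> real) \<Rightarrow> nat \<Rightarrow> (nat \<Rightarrow> 'v) \<Rightarrow> bool" where
  "orthonormal_family L ip m b \<longleftrightarrow> (\<forall>i<m. b i \<in> L) \<and> (\<forall>i<m. \<forall>j<m. ip (b i) (b j) = (if i = j then 1 else 0))"

lemma inner_onD:
  assumes "inner_on L ip"
  shows "subspace L" "u \<in> L \<Longrightarrow> v \<in> L \<Longrightarrow> w \<in> L \<Longrightarrow> ip (u + v) w = ip u w + ip v w"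
    "u \<in> L \<Longrightarrow> w \<in> L \<Longrightarrow> ip (k *\<^sub>R u) w = k * ip u w" "u \<in> L \<Longrightarrow> v \<in> L \<Longrightarrow> ip u v = ip v u"
    "u \<in> L \<Longrightarrow> u \<noteq> 0 \<Longrightarrow> 0 < ip u u"
  using assms unfolding inner_on_def by blast+

lemma inner_on_sum:
  assumes ip: "inner_on L ip" and u: "\<And>i. i \<in> I \<Longrightarrow> u i \<in> L" and w: "w \<in> L"
  shows "ip (\<Sum>i\<in>I. u i) w = (\<Sum>i\<in>I. ip (u i) w)"
proof -
  note L = inner_onD(1)[OF ip]
  have 0: "ip 0 w = 0"
    using inner_onD(3)[OF ip subspace_0[OF L] w, of 0] by simp
  show ?thesis
    using u by (induction I rule: infinite_finite_induct)
      (simp_all add: 0 inner_onD(2)[OF ip] subspace_sum[OF L] w)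
qed

lemma inner_on_combination:
  assumes ip: "inner_on L ip" and b: "orthonormal_family L ip m b" and j: "j < m"
  shows "ip (\<Sum>i<m. x i *\<^sub>R b i) (b j) = x j"
proof -
  note L = inner_onD(1)[OF ip]
  have bL: "b i \<in> L" if "i < m" for i using b that unfolding orthonormal_family_def by blast
  have "ip (\<Sum>i<m. x i *\<^sub>R b i) (b j) = (\<Sum>i<m. ip (x i *\<^sub>R b i) (b j))"
    by (rule inner_on_sum[OF ip]) (use bL j in \<open>auto intro: subspace_scale[OF L]\<close>)
  also have "\<dots> = (\<Sum>i<m. if i = j then x i else 0)"
    using b j by (intro sum.cong refl) (auto simp: inner_onD(3)[OF ip bL bL] orthonormal_family_def)
  finally show ?thesis using j by simp
qed

lemma orthonormal_expansion:
  assumes ip: "inner_on L ip" and b: "orthonormal_family L ip m b" and u: "u \<in> span (b ` {..<m})"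
  shows "u = (\<Sum>i<m. ip u (b i) *\<^sub>R b i)"
proof -
  have bL: "b i \<in> L" if "i < m" for i using b that unfolding orthonormal_family_def by blast
  let ?V = "{\<Sum>i<m. x i *\<^sub>R b i | x. True}"
  have "span (b ` {..<m}) \<subseteq> ?V"
  proof (rule span_minimal)
    show "b ` {..<m} \<subseteq> ?V"
    proof safe
      fix j assume "j < m"
      then have "b j = (\<Sum>i<m. (if i = j then 1 else 0) *\<^sub>R b i)"
        by (simp add: if_distrib[of "\<lambda>x. x *\<^sub>R _"] cong: if_cong)
      then show "\<exists>x. b j = (\<Sum>i<m. x i *\<^sub>R b i) \<and> True" by (intro exI conjI TrueI)
    qed
    show "subspace ?V"
    proof (rule subspaceI)
      show "0 \<in> ?V" by (rule CollectI, rule exI[of _ "\<lambda>_. 0"]) simp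
    next
      fix v w assume "v \<in> ?V" "w \<in> ?V"
      then obtain x y where "v = (\<Sum>i<m. x i *\<^sub>R b i)" "w = (\<Sum>i<m. y i *\<^sub>R b i)" by blast
      then show "v + w \<in> ?V"
        by (intro CollectI exI[of _ "\<lambda>i. x i + y i"]) (simp add: scaleR_left_distrib sum.distrib)
    next
      fix k v assume "v \<in> ?V"
      then obtain x where "v = (\<Sum>i<m. x i *\<^sub>R b i)" by blast
      then show "k *\<^sub>R v \<in> ?V"
        by (intro CollectI exI[of _ "\<lambda>i. k * x i"]) (simp add: scaleR_sum_right)
    qed
  qed
  with u obtain x where x: "u = (\<Sum>i<m. x i *\<^sub>R b i)" by blast
  then show ?thesis
    using inner_on_combination[OF ip b] by simp
qed

lemma orthonormal_independent:
  assumes ip: "inner_on L ip" and b: "orthonormal_family L ip m b"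
  shows "independent (b ` {..<m})" "card (b ` {..<m}) = m"
proof -
  have inj: "inj_on b {..<m}"
  proof (rule inj_onI)
    fix i j assume ij: "i \<in> {..<m}" "j \<in> {..<m}" "b i = b j"
    have o: "ip (b i) (b j) = (if i = j then 1 else 0)" if "i < m" "j < m" for i j
      using b that unfolding orthonormal_family_def by blast
    show "i = j"
      using o[of i i] o[of i j] ij by (simp split: if_splits)
  qed
  then show "card (b ` {..<m}) = m" by (simp add: card_image)
  show "independent (b ` {..<m})"
  proof (rule independent_if_scalars_zero)
    fix f v assume 0: "(\<Sum>x\<in>b ` {..<m}. f x *\<^sub>R x) = 0" and "v \<in> b ` {..<m}"
    then obtain j where j: "j < m" "v = b j" by blast
    have "(\<Sum>i<m. f (b i) *\<^sub>R b i) = 0"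
      using 0 by (simp add: sum.reindex[OF inj])
    then have "f (b j) = ip 0 (b j)"
      using inner_on_combination[OF ip b j(1), of "\<lambda>i. f (b i)"] by simp
    also have "ip 0 (b j) = 0"
      using inner_on_sum[OF ip, of "{}" undefined "b j"] b j unfolding orthonormal_family_def by simp
    finally show "f v = 0" using j by simp
  qed simp
qed

text \<open>The length \<open>m\<close> is left open because \<open>B\<close> may be dependent: a
  vector whose residual \<open>y\<close> vanishes contributes nothing. The length is recovered later
  from a dimension count.\<close>

lemma gram_schmidt:
  assumes ip: "inner_on L ip" and "finite B" "B \<subseteq> L"
  shows "\<exists>m b. orthonormal_family (span B) ip m b \<and> span (b ` {..<m}) = span B"
  using assms(2,3)
proof (induction B)
  case empty
  show ?case by (intro exI[of _ 0] exI[of _ undefined]) (simp add: orthonormal_family_def)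
next
  case (insert x B)
  note L = inner_onD(1)[OF ip]
  have BL: "span B \<subseteq> L" "x \<in> L" using insert.prems span_minimal[OF _ L] by blast+
  obtain m b where b: "orthonormal_family (span B) ip m b" "span (b ` {..<m}) = span B"
    using insert by blast
  have bL: "orthonormal_family L ip m b" using b(1) BL unfolding orthonormal_family_def by blast
  define z where "z = (\<Sum>i<m. ip x (b i) *\<^sub>R b i)"
  define y where "y = x - z"
  have z: "z \<in> span B"
    unfolding z_def using b(1) by (auto simp: orthonormal_family_def intro!: span_sum span_scale)
  have spany: "span (insert y B) = span (insert x B)"
    by (rule eq_span_insert_eq) (use z in \<open>simp add: y_def span_neg\<close>)
  show ?case
  proof (cases "y = 0")
    case True
    then have "span (insert x B) = span B"
      using spany by (simp add: span_insert_0)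
    then show ?thesis using b by auto
  next
    case False
    have zL: "z \<in> L" and yL: "y \<in> L"
      using z BL by (auto simp: y_def intro!: subspace_diff[OF L])
    have pos: "0 < ip y y" by (rule inner_onD(5)[OF ip yL False])
    define u where "u = (1 / sqrt (ip y y)) *\<^sub>R y"
    have uL: "u \<in> L" unfolding u_def by (rule subspace_scale[OF L yL])
    have yb: "ip y (b j) = 0" if j: "j < m" for j
    proof -
      have bj: "b j \<in> L" using bL j unfolding orthonormal_family_def by blast
      have "ip (y + z) (b j) = ip y (b j) + ip z (b j)" by (rule inner_onD(2)[OF ip yL zL bj])
      then show ?thesis
        using inner_on_combination[OF ip bL j, of "\<lambda>i. ip x (b i)"] by (simp add: y_def z_def)
    qed
    have ub: "ip u (b j) = 0" "ip (b j) u = 0" if j: "j < m" for j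
    proof -
      have bj: "b j \<in> L" using bL j unfolding orthonormal_family_def by blast
      show "ip u (b j) = 0" unfolding u_def inner_onD(3)[OF ip yL bj] by (simp add: yb j)
      then show "ip (b j) u = 0" using inner_onD(4)[OF ip bj uL] by simp
    qed
    have uu: "ip u u = 1"
    proof -
      have "ip y u = ip u y" by (rule inner_onD(4)[OF ip yL uL])
      also have "ip u y = 1 / sqrt (ip y y) * ip y y"
        unfolding u_def by (rule inner_onD(3)[OF ip yL yL])
      finally have "ip y u = 1 / sqrt (ip y y) * ip y y" .
      moreover have "ip u u = 1 / sqrt (ip y y) * ip y u"
        using inner_onD(3)[OF ip yL uL] unfolding u_def .
      moreover have "sqrt (ip y y) * sqrt (ip y y) = ip y y" "sqrt (ip y y) \<noteq> 0" using pos by simp_all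
      ultimately show ?thesis by (simp add: field_simps)
    qed
    let ?b = "b(m := u)"
    have im: "?b ` {..<Suc m} = insert u (b ` {..<m})"
      by (auto simp: lessThan_Suc)
    have uspan: "span (insert u (b ` {..<m})) = span (insert y B)"
    proof -
      have "u \<in> span (insert y (b ` {..<m}))"
        unfolding u_def by (intro span_scale span_base insertI1)
      moreover have "y = sqrt (ip y y) *\<^sub>R u" using pos by (simp add: u_def)
      then have "y \<in> span (insert u (b ` {..<m}))"
        by (metis span_scale span_base insertI1)
      ultimately have "span (insert u (b ` {..<m})) = span (insert y (b ` {..<m}))"
        unfolding span_eq by (auto intro: span_base)
      then show ?thesis using b(2) by (simp add: span_insert)
    qed
    have "orthonormal_family (span (insert x B)) ip (Suc m) ?b"
      unfolding orthonormal_family_def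
    proof (intro conjI allI impI)
      fix i assume "i < Suc m"
      then have "?b i \<in> span (insert u (b ` {..<m}))"
        unfolding im[symmetric] by (intro span_base imageI) simp
      then show "?b i \<in> span (insert x B)" using uspan spany by simp
    next
      fix i j assume "i < Suc m" "j < Suc m"
      then show "ip (?b i) (?b j) = (if i = j then 1 else 0)"
        using bL ub uu unfolding orthonormal_family_def by (auto simp: less_Suc_eq)
    qed
    moreover have "span (?b ` {..<Suc m}) = span (insert x B)"
      unfolding im uspan spany ..
    ultimately show ?thesis by blast
  qed
qed

section \<open>Matrices of an almost abelian Lie algebra\<close>

definition symm_part :: "(nat \<Rightarrow> nat \<Rightarrow> real) \<Rightarrow> nat \<Rightarrow> nat \<Rightarrow> real" where
  "symm_part q i j = (q i j + q j i) / 2"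

definition skew_part :: "(nat \<Rightarrow> nat \<Rightarrow> real) \<Rightarrow> nat \<Rightarrow> nat \<Rightarrow> real" where
  "skew_part q i j = (q i j - q j i) / 2"

definition mat_mult :: "nat \<Rightarrow> (nat \<Rightarrow> nat \<Rightarrow> real) \<Rightarrow> (nat \<Rightarrow> nat \<Rightarrow> real) \<Rightarrow> nat \<Rightarrow> nat \<Rightarrow> real" where
  "mat_mult m X Y i j = (\<Sum>k<m. X i k * Y k j)"

definition mat_trace :: "nat \<Rightarrow> (nat \<Rightarrow> nat \<Rightarrow> real) \<Rightarrow> real" where
  "mat_trace m X = (\<Sum>i<m. X i i)"

lemma mat_mult_assoc: "mat_mult m (mat_mult m X Y) Z = mat_mult m X (mat_mult m Y Z)"
proof (intro ext)
  fix i j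
  have "mat_mult m (mat_mult m X Y) Z i j = (\<Sum>k<m. \<Sum>l<m. X i l * Y l k * Z k j)"
    by (simp add: mat_mult_def sum_distrib_right)
  also have "\<dots> = (\<Sum>l<m. \<Sum>k<m. X i l * Y l k * Z k j)" by (rule sum.swap)
  finally show "mat_mult m (mat_mult m X Y) Z i j = mat_mult m X (mat_mult m Y Z) i j"
    by (simp add: mat_mult_def sum_distrib_left mult.assoc)
qed

lemma mat_trace_commute: "mat_trace m (mat_mult m X Y) = mat_trace m (mat_mult m Y X)"
proof -
  have "mat_trace m (mat_mult m X Y) = (\<Sum>k<m. \<Sum>i<m. X i k * Y k i)"
    unfolding mat_trace_def mat_mult_def by (rule sum.swap)
  then show ?thesis by (simp add: mat_trace_def mat_mult_def mult.commute)
qed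

definition mat_comm :: "nat \<Rightarrow> (nat \<Rightarrow> nat \<Rightarrow> real) \<Rightarrow> (nat \<Rightarrow> nat \<Rightarrow> real) \<Rightarrow> nat \<Rightarrow> nat \<Rightarrow> real" where
  "mat_comm m X Y i j = mat_mult m X Y i j - mat_mult m Y X i j"

lemma symm_part_sym: "symm_part q i j = symm_part q j i" by (simp add: symm_part_def)

lemma skew_part_antisym: "skew_part q i j = - skew_part q j i" by (simp add: skew_part_def minus_divide_left)

lemma symm_part_square_sym: "mat_mult m (symm_part q) (symm_part q) i j = mat_mult m (symm_part q) (symm_part q) j i"
  unfolding mat_mult_def by (rule sum.cong[OF refl]) (metis mult.commute symm_part_sym)

lemma skew_mult_symm: "mat_mult m (skew_part q) (symm_part q) i j = - mat_mult m (symm_part q) (skew_part q) j i"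
  unfolding mat_mult_def sum_negf[symmetric]
  by (rule sum.cong[OF refl]) (metis mult.commute mult_minus_left symm_part_sym skew_part_antisym)

text \<open>Transposition reverses both products and changes the sign of the skew factor; the two
  effects cancel in the commutator.\<close>

lemma mat_comm_sym: "mat_comm m (symm_part q) (skew_part q) i j = mat_comm m (symm_part q) (skew_part q) j i"
  unfolding mat_comm_def skew_mult_symm by simp

text \<open>With \<open>Q = S + B\<close> and \<open>Q^t = S - B\<close>, only the mixed products
  survive. Normality is thereby the vanishing of the commutator that occurs in the
  curvature.\<close>

lemma normal_defect:
  "(\<Sum>k<m. q i k * q j k) - (\<Sum>k<m. q k i * q k j) = - 2 * mat_comm m (symm_part q) (skew_part q) i j"
proof -
  have "(\<Sum>k<m. q i k * q j k) - (\<Sum>k<m. q k i * q k j) =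
      (\<Sum>k<m. - 2 * (symm_part q i k * skew_part q k j - skew_part q i k * symm_part q k j))"
    unfolding sum_subtractf[symmetric]
    by (rule sum.cong[OF refl]) (simp add: symm_part_def skew_part_def field_simps)
  also have "\<dots> = - 2 * mat_comm m (symm_part q) (skew_part q) i j"
    by (simp add: mat_comm_def mat_mult_def sum_distrib_left[symmetric] sum_subtractf)
  finally show ?thesis .
qed

text \<open>Index \<open>0\<close> stands for \<open>e\<close> and index \<open>Suc i\<close> for the \<open>i\<close>-th vector of an orthonormal basis of the
  abelian ideal; column \<open>i\<close> of \<open>q\<close> holds the coordinates of \<open>[e, b\<^sub>i]\<close>.\<close>

fun aa_struct :: "(nat \<Rightarrow> nat \<Rightarrow> real) \<Rightarrow> nat \<Rightarrow> nat \<Rightarrow> nat \<Rightarrow> real" where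
  "aa_struct q 0 (Suc i) (Suc k) = q k i"
| "aa_struct q (Suc i) 0 (Suc k) = - q k i"
| "aa_struct q _ _ _ = 0"

text \<open>The solution of Koszul's formula for \<open>aa_struct\<close>. The first clause has the
  indices in the order \<open>k j\<close> because the entry is the \<open>k\<close>-th coordinate of
  \<open>B\<close> applied to the \<open>j\<close>-th basis vector; \<open>B\<close> being skew, the
  order decides the sign.\<close>

fun aa_conn :: "(nat \<Rightarrow> nat \<Rightarrow> real) \<Rightarrow> nat \<Rightarrow> nat \<Rightarrow> nat \<Rightarrow> real" where
  "aa_conn q 0 (Suc j) (Suc k) = skew_part q k j"
| "aa_conn q (Suc i) 0 (Suc k) = - symm_part q i k"
| "aa_conn q (Suc i) (Suc j) 0 = symm_part q i j"
| "aa_conn q _ _ _ = 0"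

lemma aa_conn_metric: "aa_conn q i j k = - aa_conn q i k j"
  by (cases i; cases j; cases k) (simp_all add: skew_part_def field_simps)

lemma aa_conn_torsion: "aa_conn q i j k - aa_conn q j i k = aa_struct q i j k"
  by (cases i; cases j; cases k) (simp_all add: skew_part_def symm_part_def field_simps)

abbreviation aa_curv :: "nat \<Rightarrow> (nat \<Rightarrow> nat \<Rightarrow> real) \<Rightarrow> nat \<Rightarrow> nat \<Rightarrow> nat \<Rightarrow> nat \<Rightarrow> real" where
  "aa_curv m q \<equiv> frame_curvature (Suc m) (aa_struct q) (aa_conn q)"

text \<open>The matrix of \<open>T\<close>, which is the negative of the Jacobi operator of
  \<open>e\<close>: its diagonal entries are minus the sectional curvatures of the planes containing
  \<open>e\<close>.\<close>

definition jacobi_mat :: "nat \<Rightarrow> (nat \<Rightarrow> nat \<Rightarrow> real) \<Rightarrow> nat \<Rightarrow> nat \<Rightarrow> real" where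
  "jacobi_mat m q i j = mat_mult m (symm_part q) (symm_part q) i j + mat_comm m (symm_part q) (skew_part q) i j"

lemma jacobi_mat_sym: "jacobi_mat m q i j = jacobi_mat m q j i"
  unfolding jacobi_mat_def using symm_part_square_sym mat_comm_sym by metis

lemma aa_curv_swap: "aa_curv m q j i k l = - aa_curv m q i j k l"
proof -
  have "aa_struct q j i p = - aa_struct q i j p" for p
    by (cases i; cases j; cases p) simp_all
  then show ?thesis
    unfolding frame_curvature_def sum_negf[symmetric] by (intro sum.cong refl) simp
qed

text \<open>Splitting off index \<open>0\<close> leaves sums over the ideal whose summands agree one
  by one. Geometrically, the last value is the Gauss equation of the flat abelian subgroup with
  shape operator given by \<open>S\<close>, and the vanishing of components with a single index
  \<open>0\<close> is its Codazzi equation.\<close>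

lemma aa_curv_values:
  "aa_curv m q 0 0 k l = 0"
  "aa_curv m q 0 (Suc i) 0 0 = 0"
  "aa_curv m q 0 (Suc i) (Suc j) 0 = - jacobi_mat m q i j"
  "aa_curv m q 0 (Suc i) 0 (Suc j) = jacobi_mat m q i j"
  "aa_curv m q 0 (Suc i) (Suc j) (Suc p) = 0"
  "aa_curv m q (Suc i) (Suc j) 0 0 = 0"
  "aa_curv m q (Suc i) (Suc j) 0 (Suc p) = 0"
  "aa_curv m q (Suc i) (Suc j) (Suc p) 0 = 0"
  "aa_curv m q (Suc i) (Suc j) (Suc p) (Suc r) = symm_part q i p * symm_part q j r - symm_part q j p * symm_part q i r"
proof -
  note expand = frame_curvature_def sum.lessThan_Suc_shift
  show "aa_curv m q 0 0 k l = 0"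
    using aa_curv_swap[of m q 0 0 k l] by simp
  show "aa_curv m q 0 (Suc i) 0 0 = 0" "aa_curv m q 0 (Suc i) (Suc j) (Suc p) = 0"
    "aa_curv m q (Suc i) (Suc j) 0 (Suc p) = 0" "aa_curv m q (Suc i) (Suc j) (Suc p) 0 = 0"
    by (simp_all add: expand del: sum.lessThan_Suc)
  show "aa_curv m q (Suc i) (Suc j) (Suc p) (Suc r) = symm_part q i p * symm_part q j r - symm_part q j p * symm_part q i r"
    by (simp add: expand del: sum.lessThan_Suc)
  show "aa_curv m q (Suc i) (Suc j) 0 0 = 0"
    by (simp add: expand del: sum.lessThan_Suc)
  show "aa_curv m q 0 (Suc i) (Suc j) 0 = - jacobi_mat m q i j"
    unfolding jacobi_mat_def mat_comm_def mat_mult_def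
    by (simp add: expand sum_subtractf[symmetric] sum.distrib[symmetric] sum_negf[symmetric] del: sum_negf sum.lessThan_Suc)
      (intro sum.cong refl, simp add: symm_part_def skew_part_def field_simps)
  show "aa_curv m q 0 (Suc i) 0 (Suc j) = jacobi_mat m q i j"
    unfolding jacobi_mat_sym[of m q i j] unfolding jacobi_mat_def mat_comm_def mat_mult_def
    by (simp add: expand sum_subtractf[symmetric] sum.distrib[symmetric] sum_negf[symmetric] del: sum_negf sum.lessThan_Suc)
      (intro sum.cong refl, simp add: symm_part_def skew_part_def field_simps)
qed

lemma aa_curv_values_swap:
  "aa_curv m q (Suc i) 0 k l = - aa_curv m q 0 (Suc i) k l"
  by (rule aa_curv_swap)

text \<open>If the first index is \<open>0\<close>, a nonzero component needs exactly one further
  \<open>0\<close>, among the last two. If the first index belongs to the ideal, then either the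
  second index is \<open>0\<close> and the same holds, or no index is \<open>0\<close>. Hence the
  mixed contractions pair components with disjoint supports, and the ideal block is a Jacobi part
  plus a Gauss part.\<close>

lemma aa_contract:
  "contract3 (Suc m) (aa_curv m q) 0 0 = 2 * (\<Sum>i<m. \<Sum>j<m. (jacobi_mat m q i j)\<^sup>2)"
    "contract3 (Suc m) (aa_curv m q) 0 (Suc i) = 0" "contract3 (Suc m) (aa_curv m q) (Suc i) 0 = 0"
    "contract3 (Suc m) (aa_curv m q) (Suc i) (Suc j) = 2 * (\<Sum>k<m. jacobi_mat m q i k * jacobi_mat m q j k)
      + 2 * (mat_trace m (mat_mult m (symm_part q) (symm_part q)) * mat_mult m (symm_part q) (symm_part q) i j -
        mat_mult m (mat_mult m (symm_part q) (symm_part q)) (mat_mult m (symm_part q) (symm_part q)) i j)"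
proof -
  note expand = contract3_def sum.lessThan_Suc_shift[where n = m] aa_curv_values aa_curv_values_swap
  show "contract3 (Suc m) (aa_curv m q) 0 0 = 2 * (\<Sum>i<m. \<Sum>j<m. (jacobi_mat m q i j)\<^sup>2)"
    by (simp add: expand sum.distrib sum_distrib_left power2_eq_square del: sum.lessThan_Suc)
  show "contract3 (Suc m) (aa_curv m q) 0 (Suc i) = 0" "contract3 (Suc m) (aa_curv m q) (Suc i) 0 = 0"
    by (simp_all add: expand del: sum.lessThan_Suc)
  let ?s = "symm_part q" and ?P = "mat_mult m (symm_part q) (symm_part q)"
  \<comment> \<open>The Gauss part multiplies two minors of \<open>S\<close>. Of the four products,
    two contract to \<open>tr(P) P\<close> and two, with negative sign, to \<open>P^2\<close>, where
    \<open>P = S^2\<close>.\<close>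
  let ?f = "\<lambda>p k l. (?s i k * ?s p l - ?s p k * ?s i l) * (?s j k * ?s p l - ?s p k * ?s j l)"
  have "(\<Sum>p<m. \<Sum>k<m. \<Sum>l<m. ?f p k l) =
      (\<Sum>p<m. \<Sum>k<m. \<Sum>l<m. (?s i k * ?s j k) * (?s p l * ?s p l)) + (\<Sum>p<m. \<Sum>k<m. \<Sum>l<m. (?s p k * ?s p k) * (?s i l * ?s j l))
      - (\<Sum>p<m. \<Sum>k<m. \<Sum>l<m. (?s i k * ?s p k) * (?s p l * ?s j l)) - (\<Sum>p<m. \<Sum>k<m. \<Sum>l<m. (?s p k * ?s j k) * (?s i l * ?s p l))"
    unfolding sum_subtractf[symmetric] sum.distrib[symmetric]
    by (intro sum.cong refl) (simp add: algebra_simps)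
  also have "\<dots> = 2 * (mat_trace m ?P * ?P i j - mat_mult m ?P ?P i j)"
  proof -
    have P: "(\<Sum>l<m. ?s a l * ?s b l) = ?P a b" for a b
      unfolding mat_mult_def by (intro sum.cong refl) (metis symm_part_sym)
    have 1: "(\<Sum>k<m. \<Sum>l<m. (?s a k * ?s b k) * (?s c l * ?s d l)) = ?P a b * ?P c d" for a b c d
      unfolding P[symmetric] by (simp only: sum_product)
    show ?thesis
      unfolding 1 mat_trace_def mat_mult_def[of m ?P ?P] by (simp add: sum_distrib_left sum_negf mult.commute)
  qed
  finally have F: "(\<Sum>p<m. \<Sum>k<m. \<Sum>l<m. ?f p k l) = 2 * (mat_trace m ?P * ?P i j - mat_mult m ?P ?P i j)" .
  have "contract3 (Suc m) (aa_curv m q) (Suc i) (Suc j) =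
      2 * (\<Sum>k<m. jacobi_mat m q i k * jacobi_mat m q j k) + (\<Sum>p<m. \<Sum>k<m. \<Sum>l<m. ?f p k l)"
    by (simp add: expand del: sum.lessThan_Suc)
  then show "contract3 (Suc m) (aa_curv m q) (Suc i) (Suc j) = 2 * (\<Sum>k<m. jacobi_mat m q i k * jacobi_mat m q j k)
      + 2 * (mat_trace m ?P * ?P i j - mat_mult m ?P ?P i j)"
    unfolding F .
qed

section \<open>Trace identities and their equality cases\<close>

lemma mat_trace_comm: "mat_trace m (mat_comm m X Y) = 0"
  using mat_trace_commute[of m X Y] by (simp add: mat_trace_def mat_comm_def sum_subtractf)

text \<open>The defect in the Cauchy-Schwarz inequality between \<open>X\<close> and the identity,
  as \<open>m\<close> times the squared distance of \<open>X\<close> from the scalar matrices. It is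
  applied to \<open>S^2\<close> for the weakly Einstein condition and to \<open>S\<close> for the
  Einstein condition.\<close>

lemma sum_sq_deviation:
  assumes "0 < m"
  shows "real m * (\<Sum>i<m. \<Sum>j<m. (X i j - (if i = j then mat_trace m X / real m else 0))\<^sup>2) =
    real m * (\<Sum>i<m. \<Sum>j<m. (X i j)\<^sup>2) - (mat_trace m X)\<^sup>2"
proof -
  let ?c = "mat_trace m X / real m"
  have "(\<Sum>i<m. \<Sum>j<m. (X i j - (if i = j then ?c else 0))\<^sup>2) =
      (\<Sum>i<m. \<Sum>j<m. (X i j)\<^sup>2 + (if i = j then ?c\<^sup>2 - 2 * ?c * X i i else 0))"
    by (intro sum.cong refl) (simp add: power2_eq_square algebra_simps)
  also have "\<dots> = (\<Sum>i<m. \<Sum>j<m. (X i j)\<^sup>2) + (real m * ?c\<^sup>2 - 2 * ?c * mat_trace m X)"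
    by (simp add: sum.distrib sum_subtractf sum_distrib_left mat_trace_def)
  finally show ?thesis using assms by (simp add: field_simps power2_eq_square)
qed

lemma entries_zero_if_sum_sq_zero:
  assumes "(\<Sum>i<m. \<Sum>j<m. (X i j)\<^sup>2) = (0::real)" "i < m" "j < (m::nat)"
  shows "X i j = 0"
proof -
  have "(\<Sum>j<m. (X i j)\<^sup>2) = 0"
    using assms by (simp add: sum_nonneg_eq_0_iff sum_nonneg)
  then show ?thesis using assms(3) by (simp add: sum_nonneg_eq_0_iff)
qed

text \<open>The left side is the ideal block of the condition after division by \<open>2\<close>,
  with the factor already taken from the component \<open>(e, e)\<close>.\<close>

lemma aa_weakly_einstein_matrix:
  fixes q :: "nat \<Rightarrow> nat \<Rightarrow> real" and m :: nat
  defines "P \<equiv> mat_mult m (symm_part q) (symm_part q)" and "W \<equiv> mat_comm m (symm_part q) (skew_part q)"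
  shows "(\<forall>i<m. \<forall>j<m. (\<Sum>k<m. jacobi_mat m q i k * jacobi_mat m q j k) + (mat_trace m P * P i j - mat_mult m P P i j) =
      (if i = j then (\<Sum>i<m. \<Sum>j<m. (jacobi_mat m q i j)\<^sup>2) else 0)) \<longleftrightarrow>
    (\<forall>i<m. \<forall>j<m. W i j = 0) \<and> (\<exists>c. \<forall>i<m. \<forall>j<m. P i j = (if i = j then c else 0))"
    (is "?L \<longleftrightarrow> ?R")
proof
  have T: "jacobi_mat m q i j = P i j + W i j" for i j by (simp add: jacobi_mat_def P_def W_def)
  have Psym: "P i j = P j i" for i j unfolding P_def by (rule symm_part_square_sym)
  have Wsym: "W i j = W j i" for i j unfolding W_def by (rule mat_comm_sym)
  show ?R if L: ?L
  proof (cases "m = 0")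
    case False
    \<comment> \<open>Only the diagonal equations are summed; the scalar right-hand side thereby
      gains the factor \<open>m\<close>.\<close>
    have "(\<Sum>i<m. (\<Sum>k<m. jacobi_mat m q i k * jacobi_mat m q i k) + (mat_trace m P * P i i - mat_mult m P P i i)) =
        (\<Sum>i<m. (\<Sum>i<m. \<Sum>j<m. (jacobi_mat m q i j)\<^sup>2))"
      using L by (intro sum.cong refl) simp
    then have 1: "(\<Sum>i<m. \<Sum>j<m. (jacobi_mat m q i j)\<^sup>2) + (mat_trace m P * mat_trace m P - mat_trace m (mat_mult m P P)) =
        real m * (\<Sum>i<m. \<Sum>j<m. (jacobi_mat m q i j)\<^sup>2)"
      by (simp add: sum.distrib sum_subtractf mat_trace_def sum_distrib_left power2_eq_square)
    have 2: "mat_trace m (mat_mult m P P) = (\<Sum>i<m. \<Sum>j<m. (P i j)\<^sup>2)"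
      unfolding mat_trace_def mat_mult_def[of m P] by (intro sum.cong refl) (metis Psym power2_eq_square)
    \<comment> \<open>As \<open>W\<close> is symmetric this is \<open>tr(P W)\<close>. It vanishes
      by cyclicity of the trace, because \<open>P = S^2\<close> commutes with
      \<open>S\<close>.\<close>
    have 3: "(\<Sum>i<m. \<Sum>j<m. P i j * W i j) = 0"
    proof -
      let ?s = "symm_part q" and ?a = "skew_part q"
      have "(\<Sum>i<m. \<Sum>j<m. P i j * W i j) = (\<Sum>i<m. \<Sum>j<m. P i j * W j i)"
        by (intro sum.cong refl) (metis Wsym)
      also have "\<dots> = mat_trace m (mat_mult m P (mat_mult m ?s ?a)) - mat_trace m (mat_mult m P (mat_mult m ?a ?s))"
        by (simp add: W_def mat_comm_def mat_mult_def[of m P] mat_trace_def right_diff_distrib sum_subtractf)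
      also have "mat_mult m P (mat_mult m ?a ?s) = mat_mult m (mat_mult m P ?a) ?s" by (simp only: mat_mult_assoc)
      also have "mat_trace m \<dots> = mat_trace m (mat_mult m ?s (mat_mult m P ?a))" by (rule mat_trace_commute)
      also have "mat_mult m ?s (mat_mult m P ?a) = mat_mult m P (mat_mult m ?s ?a)" unfolding P_def by (simp only: mat_mult_assoc)
      finally show ?thesis by simp
    qed
    have 4: "(\<Sum>i<m. \<Sum>j<m. (jacobi_mat m q i j)\<^sup>2) = (\<Sum>i<m. \<Sum>j<m. (P i j)\<^sup>2) + (\<Sum>i<m. \<Sum>j<m. (W i j)\<^sup>2)"
    proof -
      have "(\<Sum>i<m. \<Sum>j<m. (jacobi_mat m q i j)\<^sup>2) =
          (\<Sum>i<m. \<Sum>j<m. (P i j)\<^sup>2) + (\<Sum>i<m. \<Sum>j<m. (W i j)\<^sup>2) + 2 * (\<Sum>i<m. \<Sum>j<m. P i j * W i j)"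
        unfolding T sum_distrib_left sum.distrib[symmetric]
        by (intro sum.cong refl) (simp add: power2_eq_square algebra_simps)
      then show ?thesis using 3 by simp
    qed
    define d where "d = (\<Sum>i<m. \<Sum>j<m. (P i j - (if i = j then mat_trace m P / real m else 0))\<^sup>2)"
    define w where "w = (\<Sum>i<m. \<Sum>j<m. (W i j)\<^sup>2)"
    have d0: "0 \<le> d" "0 \<le> w" unfolding d_def w_def by (simp_all add: sum_nonneg)
    have "real m * d = real m * (\<Sum>i<m. \<Sum>j<m. (P i j)\<^sup>2) - (mat_trace m P)\<^sup>2"
      unfolding d_def using False by (intro sum_sq_deviation) simp
    \<comment> \<open>On the left of the traced equation \<open>tr(P^2)\<close> cancels and
      \<open>w\<close> occurs once; on the right both occur \<open>m\<close> times. This gives the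
      coefficients \<open>m\<close> and \<open>m - 1\<close>.\<close>
    then have 5: "real m * d + (real m - 1) * w = 0"
      using 1 unfolding 2 4 w_def[symmetric] by (simp add: algebra_simps power2_eq_square)
    have m1: "real m \<ge> 1" using False by simp
    then have "0 \<le> real m * d" "0 \<le> (real m - 1) * w" using d0 by simp_all
    with 5 have "real m * d = 0" and w: "(real m - 1) * w = 0" by linarith+
    then have "d = 0" using False by simp
    from entries_zero_if_sum_sq_zero[OF this[unfolded d_def]]
    have "\<forall>i<m. \<forall>j<m. P i j = (if i = j then mat_trace m P / real m else 0)" by auto
    moreover have "W i j = 0" if "i < m" "j < m" for i j
    proof (cases "m = 1")
      case True
      then show ?thesis using that by (simp add: W_def mat_comm_def mat_mult_def mult.commute)
    next
      case False
      then have "w = 0" using w m1 by simp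
      then show ?thesis unfolding w_def using entries_zero_if_sum_sq_zero that by blast
    qed
    ultimately show ?thesis by blast
  qed simp
  \<comment> \<open>Here \<open>T = P = c I\<close>, and the diagonal equation reads
    \<open>c^2 + (m c) c - c^2 = m c^2\<close>.\<close>
  show ?L if R: ?R
  proof -
    obtain c where c: "\<forall>i<m. \<forall>j<m. P i j = (if i = j then c else 0)" using R by blast
    have t: "jacobi_mat m q i j = (if i = j then c else 0)" if "i < m" "j < m" for i j
      using R c that by (simp add: T)
    have tt: "(\<Sum>k<m. jacobi_mat m q i k * jacobi_mat m q j k) = (if i = j then c * c else 0)" if ij: "i < m" "j < m" for i j
    proof -
      have "(\<Sum>k<m. jacobi_mat m q i k * jacobi_mat m q j k) = (\<Sum>k<m. if i = k then (if j = i then c * c else 0) else 0)"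
        using ij by (intro sum.cong refl) (auto simp: t)
      then show ?thesis using ij by auto
    qed
    have "(\<Sum>i<m. \<Sum>j<m. (jacobi_mat m q i j)\<^sup>2) = (\<Sum>i<m. c * c)"
      by (intro sum.cong refl) (simp add: power2_eq_square tt)
    then have n: "(\<Sum>i<m. \<Sum>j<m. (jacobi_mat m q i j)\<^sup>2) = real m * (c * c)" by simp
    have trP: "mat_trace m P = real m * c" using c by (simp add: mat_trace_def)
    have PP: "mat_mult m P P i j = (if i = j then c * c else 0)" if ij: "i < m" "j < m" for i j
    proof -
      have "mat_mult m P P i j = (\<Sum>k<m. if i = k then (if i = j then c * c else 0) else 0)"
        using ij c unfolding mat_mult_def[of m P] by (intro sum.cong refl) auto
      then show ?thesis using ij by auto
    qed
    show ?thesis using c by (auto simp: tt n trP PP algebra_simps)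
  qed
qed

text \<open>Comparison with the entry \<open>(0, 0)\<close> replaces the average over all
  \<open>Suc m\<close> diagonal entries by \<open>2 * r\<close>. Conversely, if every diagonal entry
  is \<open>2 * r\<close>, so is their average.\<close>

lemma aa_proportional_iff:
  "(\<forall>i<Suc m. \<forall>j<Suc m. contract3 (Suc m) (aa_curv m q) i j =
      (if i = j then (\<Sum>k<Suc m. contract3 (Suc m) (aa_curv m q) k k) / real (Suc m) else 0)) \<longleftrightarrow>
    (\<forall>i<m. \<forall>j<m. mat_comm m (symm_part q) (skew_part q) i j = 0) \<and>
    (\<exists>c. \<forall>i<m. \<forall>j<m. mat_mult m (symm_part q) (symm_part q) i j = (if i = j then c else 0))"
  (is "?L \<longleftrightarrow> ?R")
proof -
  let ?C = "contract3 (Suc m) (aa_curv m q)"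
  define r where "r = (\<Sum>i<m. \<Sum>j<m. (jacobi_mat m q i j)\<^sup>2)"
  have "?L \<longleftrightarrow> (\<forall>i<m. \<forall>j<m. ?C (Suc i) (Suc j) = (if i = j then 2 * r else 0))" (is "_ \<longleftrightarrow> ?M")
  proof
    assume L: ?L
    define s where "s = (\<Sum>k<Suc m. ?C k k) / real (Suc m)"
    have C: "?C i j = (if i = j then s else 0)" if "i < Suc m" "j < Suc m" for i j
      using L that unfolding s_def by blast
    have "s = 2 * r" using C[of 0 0] aa_contract(1)[of m q] by (simp add: r_def)
    then show ?M using C by simp
  next
    assume M: ?M
    have "(\<Sum>k<Suc m. ?C k k) = real (Suc m) * (2 * r)"
      unfolding sum.lessThan_Suc_shift using M by (simp add: aa_contract(1) r_def[symmetric] algebra_simps)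
    then have s: "(\<Sum>k<Suc m. ?C k k) / real (Suc m) = 2 * r" by simp
    show ?L unfolding s
    proof (intro allI impI)
      fix i j assume "i < Suc m" "j < Suc m"
      then show "?C i j = (if i = j then 2 * r else 0)"
        using M by (cases i; cases j) (simp_all add: aa_contract(1-3) r_def)
    qed
  qed
  also have "?M \<longleftrightarrow> ?R"
    unfolding aa_weakly_einstein_matrix[symmetric] aa_contract(4) r_def[symmetric]
    by (intro all_cong1 imp_cong refl) auto
  finally show ?thesis .
qed

text \<open>Two scalar consequences suffice: the Ricci curvature of \<open>e\<close>, and the sum of
  the Ricci curvatures of the basis vectors of the ideal. Eliminating \<open>s\<close> between them
  gives equality in Cauchy-Schwarz for \<open>S\<close> and the identity.\<close>

lemma aa_einstein_matrix:
  fixes q :: "nat \<Rightarrow> nat \<Rightarrow> real"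
  assumes "\<And>i j. i < Suc m \<Longrightarrow> j < Suc m \<Longrightarrow> (\<Sum>a<Suc m. aa_curv m q a i j a) = (if i = j then s else 0)"
  shows "\<exists>c. \<forall>i<m. \<forall>j<m. symm_part q i j = (if i = j then c else 0)"
proof (cases "m = 0")
  case False
  let ?s = "symm_part q" and ?P = "mat_mult m (symm_part q) (symm_part q)" and ?W = "mat_comm m (symm_part q) (skew_part q)"
  note expand = sum.lessThan_Suc_shift[where n = m] aa_curv_values aa_curv_values_swap
  have e1: "- mat_trace m ?P = s"
  proof -
    have "- (\<Sum>i<m. jacobi_mat m q i i) = s"
      using assms[of 0 0] by (simp add: expand sum_negf del: sum.lessThan_Suc)
    moreover have "(\<Sum>i<m. jacobi_mat m q i i) = mat_trace m ?P + mat_trace m ?W"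
      by (simp add: jacobi_mat_def mat_trace_def sum.distrib)
    ultimately show ?thesis by (simp add: mat_trace_comm)
  qed
  \<comment> \<open>The diagonal of \<open>S^2\<close> enters negatively through the plane with
    \<open>e\<close> and positively through the planes inside the ideal, and so drops out.\<close>
  have "- ?W i i - mat_trace m ?s * ?s i i = s" if i: "i < m" for i
  proof -
    have "- jacobi_mat m q i i + (\<Sum>p<m. ?s p i * ?s i p - ?s i i * ?s p p) = s"
      using assms[of "Suc i" "Suc i"] i by (simp add: expand del: sum.lessThan_Suc)
    moreover have "(\<Sum>p<m. ?s p i * ?s i p) = ?P i i"
      unfolding mat_mult_def by (simp add: mult.commute)
    ultimately show ?thesis
      by (simp add: jacobi_mat_def sum_subtractf mat_trace_def sum_distrib_left mult.commute)
  qed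
  then have "(\<Sum>i<m. - ?W i i - mat_trace m ?s * ?s i i) = (\<Sum>i<m. s)" by (intro sum.cong refl) simp
  then have e2: "- mat_trace m ?W - mat_trace m ?s * mat_trace m ?s = real m * s"
    by (simp add: mat_trace_def[of m ?W] mat_trace_def[of m ?s] sum_subtractf sum_negf sum_distrib_left)
  have "mat_trace m ?P = (\<Sum>i<m. \<Sum>j<m. (?s i j)\<^sup>2)"
    unfolding mat_trace_def mat_mult_def power2_eq_square by (intro sum.cong refl) (metis symm_part_sym)
  with e1 have "s = - (\<Sum>i<m. \<Sum>j<m. (?s i j)\<^sup>2)" by simp
  with e2 have "real m * (\<Sum>i<m. \<Sum>j<m. (?s i j)\<^sup>2) - (mat_trace m ?s)\<^sup>2 = 0"
    by (simp add: mat_trace_comm power2_eq_square)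
  then have "(\<Sum>i<m. \<Sum>j<m. (?s i j - (if i = j then mat_trace m ?s / real m else 0))\<^sup>2) = 0"
    using sum_sq_deviation[of m ?s] False by simp
  from entries_zero_if_sum_sq_zero[OF this] show ?thesis by (intro exI[of _ "mat_trace m ?s / real m"]) auto
qed simp

section \<open>Operators in orthonormal coordinates\<close>

definition mat_vec :: "nat \<Rightarrow> (nat \<Rightarrow> nat \<Rightarrow> real) \<Rightarrow> (nat \<Rightarrow> real) \<Rightarrow> nat \<Rightarrow> real" where
  "mat_vec m X x i = (\<Sum>k<m. X i k * x k)"

lemma mat_vec_mat_vec: "mat_vec m X (mat_vec m Y x) = mat_vec m (mat_mult m X Y) x"
proof (rule ext)
  fix i
  have "mat_vec m X (mat_vec m Y x) i = (\<Sum>k<m. \<Sum>l<m. X i k * Y k l * x l)"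
    by (simp add: mat_vec_def sum_distrib_left mult.assoc)
  also have "\<dots> = (\<Sum>l<m. \<Sum>k<m. X i k * Y k l * x l)" by (rule sum.swap)
  finally show "mat_vec m X (mat_vec m Y x) i = mat_vec m (mat_mult m X Y) x i"
    by (simp add: mat_vec_def mat_mult_def sum_distrib_right)
qed

lemma mat_vec_eq_iff:
  "(\<forall>x. \<forall>i<m. mat_vec m X x i = mat_vec m Y x i) \<longleftrightarrow> (\<forall>i<m. \<forall>j<m. X i j = Y i j)"
proof
  assume L: "\<forall>x. \<forall>i<m. mat_vec m X x i = mat_vec m Y x i"
  show "\<forall>i<m. \<forall>j<m. X i j = Y i j"
  proof (intro allI impI)
    fix i j assume "i < m" "j < m"
    then show "X i j = Y i j"
      using L[rule_format, of i "\<lambda>k. if k = j then 1 else 0"]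
      by (simp add: mat_vec_def if_distrib[of "\<lambda>x. _ * x"] cong: if_cong)
  qed
qed (simp add: mat_vec_def)

lemma mat_vec_scalar: "i < m \<Longrightarrow> mat_vec m (\<lambda>i j. if i = j then c else 0) x i = c * x i"
  by (simp add: mat_vec_def if_distrib[of "\<lambda>x. x * _"] cong: if_cong)

text \<open>The bridge from operators to matrices: \<open>vec\<close> identifies coordinate tuples
  with \<open>V\<close>, and identities on all of \<open>V\<close> become entrywise identities. The
  transpose is given by a definite description, so the transposed matrix has to be shown to be a
  solution and the only one.\<close>

lemma operator_matrices:
  fixes Q Qt S :: "'v::real_vector \<Rightarrow> 'v"
  assumes ip: "inner_on V ip" and b: "orthonormal_family V ip m b" and span: "span (b ` {..<m}) = V"
    and Qb: "\<And>i. i < m \<Longrightarrow> Q (b i) = (\<Sum>k<m. q k i *\<^sub>R b k)"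
    and Qadd: "\<And>X Y. X \<in> V \<Longrightarrow> Y \<in> V \<Longrightarrow> Q (X + Y) = Q X + Q Y"
    and Qscale: "\<And>k X. X \<in> V \<Longrightarrow> Q (k *\<^sub>R X) = k *\<^sub>R Q X"
    and Qt: "Qt = transpose_on V ip Q"
    and S: "S = (\<lambda>X. (1/2) *\<^sub>R (Q X + Qt X))"
  shows "(\<forall>X\<in>V. Q (Qt X) = Qt (Q X)) \<longleftrightarrow> (\<forall>i<m. \<forall>j<m. mat_comm m (symm_part q) (skew_part q) i j = 0)"
    "(\<exists>k. \<forall>X\<in>V. S (S X) = k *\<^sub>R X) \<longleftrightarrow>
      (\<exists>k. \<forall>i<m. \<forall>j<m. mat_mult m (symm_part q) (symm_part q) i j = (if i = j then k else 0))"
    "(\<exists>k. \<forall>X\<in>V. S X = k *\<^sub>R X) \<longleftrightarrow> (\<exists>k. \<forall>i<m. \<forall>j<m. symm_part q i j = (if i = j then k else 0))"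
proof -
  note V = inner_onD(1)[OF ip]
  have bV: "b i \<in> V" if "i < m" for i using b that unfolding orthonormal_family_def by blast
  define vec where "vec x = (\<Sum>i<m. x i *\<^sub>R b i)" for x
  have vecV: "vec x \<in> V" for x
    unfolding vec_def by (intro subspace_sum[OF V] subspace_scale[OF V] bV) simp
  have vec_surj: "\<exists>x. X = vec x" if "X \<in> V" for X
    unfolding vec_def by (rule exI, rule orthonormal_expansion[OF ip b]) (simp only: span that)
  have vec_coord: "ip (vec x) (b j) = x j" if "j < m" for x j
    unfolding vec_def by (rule inner_on_combination[OF ip b that])
  have vec_eq: "vec x = vec y \<longleftrightarrow> (\<forall>i<m. x i = y i)" for x y
  proof
    assume *: "vec x = vec y"
    show "\<forall>i<m. x i = y i"
    proof (intro allI impI)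
      fix i assume "i < m"
      then show "x i = y i" using vec_coord[of i x] vec_coord[of i y] * by simp
    qed
  qed (simp add: vec_def)
  have ball: "(\<forall>X\<in>V. P X) \<longleftrightarrow> (\<forall>x. P (vec x))" for P
    using vecV vec_surj by blast
  have ip_vec: "ip X (vec y) = (\<Sum>i<m. ip X (b i) * y i)" if X: "X \<in> V" for X y
  proof -
    have "ip X (vec y) = ip (vec y) X" by (rule inner_onD(4)[OF ip X vecV])
    also have "\<dots> = (\<Sum>i<m. ip (y i *\<^sub>R b i) X)"
      unfolding vec_def by (rule inner_on_sum[OF ip _ X]) (simp add: subspace_scale[OF V] bV)
    also have "\<dots> = (\<Sum>i<m. ip X (b i) * y i)"
      by (intro sum.cong refl)
        (simp add: inner_onD(3)[OF ip bV X] inner_onD(4)[OF ip X bV] mult.commute)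
    finally show ?thesis .
  qed
  have vec_scale: "k *\<^sub>R vec x = vec (\<lambda>i. k * x i)" for k x
    by (simp add: vec_def scaleR_sum_right)
  have Q0: "Q 0 = 0" using Qscale[OF subspace_0[OF V], of 0] by simp
  have Qvec: "Q (vec x) = vec (mat_vec m q x)" for x
  proof -
    have "Q (\<Sum>i\<in>I. x i *\<^sub>R b i) = (\<Sum>i\<in>I. x i *\<^sub>R Q (b i))" if "I \<subseteq> {..<m}" for I
      using that
    proof (induction I rule: infinite_finite_induct)
      case (insert i I)
      have "Q (x i *\<^sub>R b i + (\<Sum>i\<in>I. x i *\<^sub>R b i)) = Q (x i *\<^sub>R b i) + Q (\<Sum>i\<in>I. x i *\<^sub>R b i)"
        by (intro Qadd subspace_sum[OF V] subspace_scale[OF V] bV) (use insert.prems in auto)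
      then show ?case using insert Qscale[OF bV, of i "x i"] by simp
    qed (simp_all add: Q0)
    then have "Q (vec x) = (\<Sum>i<m. \<Sum>k<m. (q k i * x i) *\<^sub>R b k)"
      by (simp add: vec_def Qb scaleR_sum_right mult.commute)
    also have "\<dots> = (\<Sum>k<m. \<Sum>i<m. (q k i * x i) *\<^sub>R b k)" by (rule sum.swap)
    finally show ?thesis by (simp add: vec_def mat_vec_def scaleR_sum_left)
  qed
  let ?qt = "\<lambda>i j. q j i"
  have Qtvec: "Qt (vec x) = vec (mat_vec m ?qt x)" for x
    unfolding Qt transpose_on_def
  proof (rule the_equality)
    have "ip (Q (vec y)) (vec x) = ip (vec y) (vec (mat_vec m ?qt x))" for y
    proof -
      have "ip (Q (vec y)) (vec x) = (\<Sum>k<m. \<Sum>i<m. q k i * y i * x k)"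
        by (simp add: Qvec ip_vec[OF vecV] vec_coord mat_vec_def sum_distrib_right)
      also have "\<dots> = (\<Sum>i<m. \<Sum>k<m. q k i * y i * x k)" by (rule sum.swap)
      also have "\<dots> = ip (vec y) (vec (mat_vec m ?qt x))"
        by (simp add: ip_vec[OF vecV] vec_coord mat_vec_def sum_distrib_left mult_ac)
      finally show ?thesis .
    qed
    then show *: "vec (mat_vec m ?qt x) \<in> V \<and> (\<forall>X\<in>V. ip (Q X) (vec x) = ip X (vec (mat_vec m ?qt x)))"
      unfolding ball by (simp add: vecV)
    fix z assume z: "z \<in> V \<and> (\<forall>X\<in>V. ip (Q X) (vec x) = ip X z)"
    then obtain w where w: "z = vec w" using vec_surj by blast
    \<comment> \<open>Uniqueness: the defining property fixes the inner products
      \<open>ip X z\<close> for \<open>X = Q\<close>-independent test vectors, in particular for the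
      basis vectors \<open>b i\<close>, and hence all coordinates of \<open>z\<close>.\<close>
    have "w i = mat_vec m ?qt x i" if i: "i < m" for i
    proof -
      have "ip (b i) z = ip (b i) (vec (mat_vec m ?qt x))"
        using z * bV[OF i] by metis
      then have "ip z (b i) = ip (vec (mat_vec m ?qt x)) (b i)"
        using inner_onD(4)[OF ip bV[OF i]] z vecV by metis
      then show ?thesis unfolding w vec_coord[OF i] .
    qed
    then show "z = vec (mat_vec m ?qt x)" unfolding w vec_eq by blast
  qed
  have Svec: "S (vec x) = vec (mat_vec m (symm_part q) x)" for x
  proof -
    have "(mat_vec m q x i + mat_vec m ?qt x i) / 2 = mat_vec m (symm_part q) x i" for i
      unfolding mat_vec_def sum.distrib[symmetric] sum_divide_distrib
      by (intro sum.cong refl) (simp add: symm_part_def field_simps)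
    moreover have "S (vec x) = vec (\<lambda>i. (mat_vec m q x i + mat_vec m ?qt x i) / 2)"
      unfolding S Qvec Qtvec unfolding vec_def sum.distrib[symmetric] scaleR_left_distrib[symmetric] scaleR_sum_right
      by simp
    ultimately show ?thesis by simp
  qed
  have "(\<forall>X\<in>V. Q (Qt X) = Qt (Q X)) \<longleftrightarrow> (\<forall>i<m. \<forall>j<m. mat_mult m q ?qt i j = mat_mult m ?qt q i j)"
    unfolding ball Qvec Qtvec vec_eq mat_vec_mat_vec by (rule mat_vec_eq_iff)
  also have "\<dots> \<longleftrightarrow> (\<forall>i<m. \<forall>j<m. mat_comm m (symm_part q) (skew_part q) i j = 0)"
  proof -
    have "mat_mult m q ?qt i j = mat_mult m ?qt q i j \<longleftrightarrow> mat_comm m (symm_part q) (skew_part q) i j = 0" for i j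
      using normal_defect[where q = q and m = m and i = i and j = j] unfolding mat_mult_def by (intro iffI) simp_all
    then show ?thesis by simp
  qed
  finally show "(\<forall>X\<in>V. Q (Qt X) = Qt (Q X)) \<longleftrightarrow> (\<forall>i<m. \<forall>j<m. mat_comm m (symm_part q) (skew_part q) i j = 0)" .
  have scalar: "(\<forall>x. \<forall>i<m. mat_vec m X x i = k * x i) \<longleftrightarrow> (\<forall>i<m. \<forall>j<m. X i j = (if i = j then k else 0))" for X k
    using mat_vec_eq_iff[of m X "\<lambda>i j. if i = j then k else 0"] by (simp add: mat_vec_scalar)
  show "(\<exists>k. \<forall>X\<in>V. S (S X) = k *\<^sub>R X) \<longleftrightarrow>
      (\<exists>k. \<forall>i<m. \<forall>j<m. mat_mult m (symm_part q) (symm_part q) i j = (if i = j then k else 0))"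
    unfolding ball Svec vec_scale vec_eq mat_vec_mat_vec scalar ..
  show "(\<exists>k. \<forall>X\<in>V. S X = k *\<^sub>R X) \<longleftrightarrow> (\<exists>k. \<forall>i<m. \<forall>j<m. symm_part q i j = (if i = j then k else 0))"
    unfolding ball Svec vec_scale vec_eq scalar ..
qed

section \<open>The frame adapted to the abelian ideal\<close>

lemma bracket_right_linear:
  assumes A: "smooth_atlas A" and e: "e \<in> vector_fields A" and X: "X \<in> vector_fields A" and Y: "Y \<in> vector_fields A"
  shows "bracket A e (X + Y) = bracket A e X + bracket A e Y" "bracket A e (k *\<^sub>R X) = k *\<^sub>R bracket A e X"
proof -
  note der = tangent_derivation[OF A vector_fieldD(1)[OF e]]
  have "bracket A e (X + Y) p f = (bracket A e X + bracket A e Y) p f \<and>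
      bracket A e (k *\<^sub>R X) p f = (k *\<^sub>R bracket A e X) p f" for p f
  proof (cases "smooth_near A p f")
    case True
    have sX: "smooth_near A p (\<lambda>q. X q f)" and sY: "smooth_near A p (\<lambda>q. Y q f)"
      using vector_fieldD(3)[OF X True] vector_fieldD(3)[OF Y True] .
    have c: "smooth_near A p (\<lambda>q. k)" by (rule smooth_near_const[OF A])
    show ?thesis
      using der(1)[OF sX sY] der(2)[OF c sX] der(3)[OF c c, of k] True
      by (simp add: bracket_def scaleR_fun_def algebra_simps)
  qed (simp add: bracket_def scaleR_fun_def)
  then show "bracket A e (X + Y) = bracket A e X + bracket A e Y" "bracket A e (k *\<^sub>R X) = k *\<^sub>R bracket A e X"
    by (intro ext, blast)+
qed

context lie_group
begin

text \<open>Positivity depends on left-invariance: \<open>lie_inner\<close> only sees values at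
  \<open>gid\<close>, and a left-invariant field that vanishes there vanishes everywhere.\<close>

lemma inner_on_lie_algebra:
  assumes g: "riemannian_metric A g"
  shows "inner_on (lie_algebra gmul A) (lie_inner gid g)"
proof -
  have T: "X gid \<in> tangent_space A gid" if "X \<in> lie_algebra gmul A" for X
    using vector_fieldD(1)[OF lie_algebraD(1)[OF that]] .
  have nz: "X gid \<noteq> 0" if X: "X \<in> lie_algebra gmul A" "X \<noteq> 0" for X
  proof
    assume "X gid = 0"
    then have "X p = 0" for p
      using lie_algebraD(3)[OF X(1), of p] by (simp add: push_left_def fun_eq_iff)
    then show False using X(2) by (simp add: fun_eq_iff)
  qed
  show ?thesis
    unfolding inner_on_def lie_inner_def
    using metric_tangent[OF atlas g T T T] nz subspace_lie_algebra
    by (auto simp: scaleR_fun_def[of _ "_ :: 'g vfield"])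
qed

text \<open>An orthonormal basis of the ideal is extended by \<open>e\<close>, placed at index
  \<open>0\<close> through \<open>case_nat\<close>. Codimension one makes the resulting length equal
  to the dimension of the group, so the family spans the Lie algebra.\<close>

lemma adapted_frame:
  assumes g: "riemannian_metric A g" and \<aa>: "abelian_ideal_codim_one gmul A \<aa>"
    and e: "e \<in> lie_algebra gmul A" "lie_inner gid g e e = 1" "\<forall>X\<in>\<aa>. lie_inner gid g e X = 0"
  obtains m b where "Suc m = DIM('e)" "orthonormal_family \<aa> (lie_inner gid g) m b" "span (b ` {..<m}) = \<aa>"
    "orthonormal_family (lie_algebra gmul A) (lie_inner gid g) (Suc m) (case_nat e b)"
    "span (case_nat e b ` {..<Suc m}) = lie_algebra gmul A"
proof -
  let ?L = "lie_algebra gmul A" and ?ip = "lie_inner gid g"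
  have aL: "\<aa> \<subseteq> ?L" "subspace \<aa>" and dim: "dim ?L = dim \<aa> + 1"
    using \<aa> unfolding abelian_ideal_codim_one_def by blast+
  note ip = inner_on_lie_algebra[OF g]
  obtain B where B: "finite B" "card B = DIM('e)" "independent B" "span B = ?L"
    by (rule lie_algebra_basis)
  have dimL: "dim ?L = DIM('e)"
    using dim_eq_card[of B ?L] B span_span by metis
  obtain Ba where Ba: "Ba \<subseteq> \<aa>" "independent Ba" "\<aa> \<subseteq> span Ba"
    by (rule basis_exists)
  have "finite Ba"
    using independent_span_bound[OF B(1) Ba(2)] Ba(1) aL(1) B(4) by blast
  have spanBa: "span Ba = \<aa>"
    using Ba span_minimal[OF Ba(1) aL(2)] by blast
  obtain m b where b: "orthonormal_family \<aa> ?ip m b" "span (b ` {..<m}) = \<aa>"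
    using gram_schmidt[OF ip \<open>finite Ba\<close>] Ba(1) aL(1) unfolding spanBa by blast
  have bL: "orthonormal_family ?L ?ip m b"
    using b(1) aL(1) unfolding orthonormal_family_def by blast
  have "dim \<aa> = m"
    using dim_eq_card[of "b ` {..<m}" \<aa>] orthonormal_independent[OF ip bL] b(2) span_span by metis
  then have m: "Suc m = DIM('e)" using dim dimL by simp
  let ?E = "case_nat e b"
  have E: "orthonormal_family ?L ?ip (Suc m) ?E"
    unfolding orthonormal_family_def
  proof (intro conjI allI impI)
    fix i assume "i < Suc m"
    then show "?E i \<in> ?L" using e(1) bL by (cases i) (simp_all add: orthonormal_family_def)
  next
    fix i j assume ij: "i < Suc m" "j < Suc m"
    have "?ip e (b k) = 0" "?ip (b k) e = 0" if "k < m" for k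
    proof -
      have bk: "b k \<in> \<aa>" using b(1) that unfolding orthonormal_family_def by blast
      then show "?ip e (b k) = 0" using e(3) by blast
      then show "?ip (b k) e = 0" using inner_onD(4)[OF ip e(1)] bk aL(1) by (metis subsetD)
    qed
    then show "?ip (?E i) (?E j) = (if i = j then 1 else 0)"
      using ij b(1) e(2) by (cases i; cases j) (simp_all add: orthonormal_family_def)
  qed
  have "span (?E ` {..<Suc m}) = ?L"
  proof
    show "span (?E ` {..<Suc m}) \<subseteq> ?L"
      by (rule span_minimal[OF _ subspace_lie_algebra]) (use E in \<open>auto simp: orthonormal_family_def\<close>)
    show "?L \<subseteq> span (?E ` {..<Suc m})"
    proof
      fix X assume X: "X \<in> ?L"
      show "X \<in> span (?E ` {..<Suc m})"
      proof (rule ccontr)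
        assume N: "X \<notin> span (?E ` {..<Suc m})"
        \<comment> \<open>A vector outside the span would yield \<open>m + 2\<close> independent
          vectors in a space of dimension \<open>m + 1\<close>.\<close>
        have "independent (insert X (?E ` {..<Suc m}))"
          by (rule independent_insertI[OF N orthonormal_independent(1)[OF ip E]])
        moreover have "insert X (?E ` {..<Suc m}) \<subseteq> span B"
          unfolding B(4) using X E by (auto simp: orthonormal_family_def)
        ultimately have "card (insert X (?E ` {..<Suc m})) \<le> card B"
          using independent_span_bound[OF B(1)] by blast
        moreover have "card (insert X (?E ` {..<Suc m})) = Suc (card (?E ` {..<Suc m}))"
          by (rule card_insert_disjoint) (use N span_base[of X "?E ` {..<Suc m}"] in auto)
        ultimately show False
          using orthonormal_independent(2)[OF ip E] B(2) m by linarith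
      qed
    qed
  qed
  then show ?thesis by (rule that[OF m b E])
qed

lemma adapted_homogeneous_frame:
  assumes g: "riemannian_metric A g" "left_invariant_metric gmul A g"
    and \<aa>: "abelian_ideal_codim_one gmul A \<aa>" and e: "e \<in> lie_algebra gmul A"
    and m: "Suc m = DIM('e)" and b: "orthonormal_family \<aa> (lie_inner gid g) m b" "span (b ` {..<m}) = \<aa>"
    and E: "orthonormal_family (lie_algebra gmul A) (lie_inner gid g) (Suc m) (case_nat e b)"
    and spanE: "span (case_nat e b ` {..<Suc m}) = lie_algebra gmul A"
    and q: "\<And>i. i < m \<Longrightarrow> bracket A e (b i) = (\<Sum>k<m. q k i *\<^sub>R b k)"
  shows "homogeneous_frame A g (case_nat e b) (aa_struct q) (aa_conn q) (Suc m)"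
proof
  let ?E = "case_nat e b" and ?ip = "lie_inner gid g"
  note ip = inner_on_lie_algebra[OF g(1)]
  have EL: "?E i \<in> lie_algebra gmul A" if "i < Suc m" for i
    using E that unfolding orthonormal_family_def by blast
  show "Suc m = DIM('e)" "smooth_atlas A" "riemannian_metric A g"
    by (rule m, rule atlas, rule g(1))
  show "?E i \<in> vector_fields A" if "i < Suc m" for i
    by (rule lie_algebraD(1)[OF EL[OF that]])
  show "g p (?E i p) (?E j p) = (if i = j then 1 else 0)" if "i < Suc m" "j < Suc m" for i j p
    unfolding lie_inner_left_invariant[OF g(2) EL[OF that(1)] EL[OF that(2)]]
    using E that unfolding orthonormal_family_def by blast
  show "u = (\<Sum>i<Suc m. g p u (?E i p) *\<^sub>R ?E i p)" if u: "u \<in> tangent_space A p" for u p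
  proof -
    \<comment> \<open>The expansion at \<open>p\<close> is inherited from the Lie algebra:
      \<open>u\<close> is the value of a left-invariant field, and inner products of such fields do
      not depend on the point.\<close>
    obtain X where X: "X \<in> lie_algebra gmul A" "X p = u" using lie_algebra_through[OF u] .
    have "X = (\<Sum>i<Suc m. ?ip X (?E i) *\<^sub>R ?E i)"
      by (rule orthonormal_expansion[OF ip E]) (simp only: spanE X)
    then have "X p = (\<Sum>i<Suc m. ?ip X (?E i) *\<^sub>R ?E i) p" by (rule arg_cong)
    also have "\<dots> = (\<Sum>i<Suc m. ?ip X (?E i) *\<^sub>R ?E i p)"
      unfolding sum_fun_apply[of _ _ p] by (intro sum.cong refl) (simp only: scaleR_fun_def)
    also have "\<dots> = (\<Sum>i<Suc m. g p (X p) (?E i p) *\<^sub>R ?E i p)"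
      by (intro sum.cong refl) (simp only: lie_inner_left_invariant[OF g(2) X(1) EL] lessThan_iff)
    finally show ?thesis unfolding X(2) .
  qed
  show "bracket A (?E i) (?E j) = (\<Sum>k<Suc m. aa_struct q i j k *\<^sub>R ?E k)" if ij: "i < Suc m" "j < Suc m" for i j
  proof (cases i)
    case 0
    show ?thesis
    proof (cases j)
      case 0
      have "bracket A e e = 0" by (simp add: bracket_def fun_eq_iff)
      then show ?thesis using \<open>i = 0\<close> 0 by simp
    next
      case (Suc j')
      then show ?thesis using \<open>i = 0\<close> q[of j'] ij
        by (simp add: sum.lessThan_Suc_shift del: sum.lessThan_Suc)
    qed
  next
    case i: (Suc i')
    show ?thesis
    proof (cases j)
      case 0
      have "bracket A (b i') e = - (\<Sum>k<m. q k i' *\<^sub>R b k)"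
        using bracket_antisym[of A "b i'" e] q[of i'] i ij by simp
      then show ?thesis using i 0
        by (simp add: sum.lessThan_Suc_shift sum_negf del: sum.lessThan_Suc)
    next
      case (Suc j')
      have "bracket A (b i') (b j') = 0"
        using \<aa> b(1) ij i Suc unfolding abelian_ideal_codim_one_def orthonormal_family_def by simp
      then show ?thesis using i Suc by (simp add: sum.lessThan_Suc_shift del: sum.lessThan_Suc)
    qed
  qed
  show "aa_conn q i j k = - aa_conn q i k j" for i j k by (rule aa_conn_metric)
  show "aa_conn q i j k - aa_conn q j i k = aa_struct q i j k" for i j k by (rule aa_conn_torsion)
qed

end

theorem theorem1p1:
  fixes gmul :: "'g::{t2_space,second_countable_topology} \<Rightarrow> 'g \<Rightarrow> 'g"
    and gid :: 'g
    and ginv :: "'g \<Rightarrow> 'g"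
    and A :: "('g, 'e::euclidean_space) atlas"
    and g :: "'g metric"
    and \<aa> :: "'g vfield set"
    and e :: "'g vfield"
    and Q Qt S :: "'g vfield \<Rightarrow> 'g vfield"
  assumes "lie_group gmul gid ginv A"
    and "riemannian_metric A g" and "left_invariant_metric gmul A g"
    and "abelian_ideal_codim_one gmul A \<aa>"
    and "e \<in> lie_algebra gmul A" and "lie_inner gid g e e = 1"
    and "\<forall>X\<in>\<aa>. lie_inner gid g e X = 0"
    and "Q = bracket A e"
    and "Qt = transpose_on \<aa> (lie_inner gid g) Q"
    and "S = (\<lambda>X. (1/2) *\<^sub>R (Q X + Qt X))"
  shows "(weakly_einstein A g \<longleftrightarrow>
            (\<forall>X\<in>\<aa>. Q (Qt X) = Qt (Q X)) \<and> (\<exists>c::real. \<forall>X\<in>\<aa>. S (S X) = c *\<^sub>R X))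
       \<and> (\<not> (\<exists>c::real. \<forall>X\<in>\<aa>. S X = c *\<^sub>R X) \<longrightarrow> \<not> einstein A g)"
proof -
  interpret lie_group gmul gid ginv A by (rule assms(1))
  let ?ip = "lie_inner gid g"
  have \<aa>: "\<aa> \<subseteq> lie_algebra gmul A" "subspace \<aa>" "\<And>X. X \<in> \<aa> \<Longrightarrow> Q X \<in> \<aa>"
    using assms(4,5) unfolding assms(8) abelian_ideal_codim_one_def by blast+
  have field: "X \<in> vector_fields A" if "X \<in> \<aa>" for X
    using \<aa>(1) that lie_algebraD(1) by blast
  have ip: "inner_on \<aa> ?ip"
    using inner_on_lie_algebra[OF assms(2)] \<aa>(1,2) unfolding inner_on_def by blast
  obtain m b where m: "Suc m = DIM('e)"
    and b: "orthonormal_family \<aa> ?ip m b" "span (b ` {..<m}) = \<aa>"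
    and E: "orthonormal_family (lie_algebra gmul A) ?ip (Suc m) (case_nat e b)"
      "span (case_nat e b ` {..<Suc m}) = lie_algebra gmul A"
    using adapted_frame[OF assms(2,4-7)] by blast
  \<comment> \<open>Coordinates of \<open>Q (b i)\<close> form column \<open>i\<close>, in agreement
    with \<open>aa_struct\<close>; they exist because the ideal is stable under
    \<open>Q\<close>.\<close>
  define q where "q k i = ?ip (Q (b i)) (b k)" for k i
  have Qb: "Q (b i) = (\<Sum>k<m. q k i *\<^sub>R b k)" if "i < m" for i
    unfolding q_def
    by (rule orthonormal_expansion[OF ip b(1)])
      (use b that \<aa>(3) in \<open>auto simp: orthonormal_family_def\<close>)
  interpret homogeneous_frame A g "case_nat e b" "aa_struct q" "aa_conn q" "Suc m"
    by (rule adapted_homogeneous_frame[OF assms(2-5) m b E]) (use Qb[unfolded assms(8)] in assumption)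
  have add: "Q (X + Y) = Q X + Q Y" and scale: "Q (k *\<^sub>R X) = k *\<^sub>R Q X" if "X \<in> \<aa>" "Y \<in> \<aa>" for X Y k
    unfolding assms(8)
    using bracket_right_linear[OF atlas lie_algebraD(1)[OF assms(5)] field[OF that(1)] field[OF that(2)]] .
  note ops = operator_matrices[OF ip b Qb add scale[OF _ subspace_0[OF \<aa>(2)]] assms(9,10)]
  have "weakly_einstein A g \<longleftrightarrow>
      (\<forall>X\<in>\<aa>. Q (Qt X) = Qt (Q X)) \<and> (\<exists>c::real. \<forall>X\<in>\<aa>. S (S X) = c *\<^sub>R X)"
    unfolding weakly_einstein_iff aa_proportional_iff using ops(1,2) by blast
  moreover have "\<exists>c::real. \<forall>X\<in>\<aa>. S X = c *\<^sub>R X" if ein: "einstein A g"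
  proof -
    obtain s where "\<And>i j. i < Suc m \<Longrightarrow> j < Suc m \<Longrightarrow> (\<Sum>a<Suc m. Rm a i j a) = (if i = j then s else 0)"
      using einstein_frame[OF ein] by blast
    from aa_einstein_matrix[OF this] show ?thesis using ops(3) by blast
  qed
  ultimately show ?thesis by blast
qed

end
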